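(* $d_K$ is a metric on $[\mathcal C_\infty]_{<1}$ satisfying the relation $$d_K(A,B)=\|P_1(A,R)-P_1(B,R)\|,\qquad A,B\in[\mathcal C_\infty]_{<1}.$$ In addition, for $A,B\in[\mathcal C_\infty]_{<1}$, the map $[0,1)\ni r\mapsto d_K(rA,rB)\in\mathbb R^+$ is increasing (in the weak sense), and $$d_K(A,B)=\sup_{r\in[0,1)}d_K(rA,rB).$$
   Context: Let $n\ge1$, $\mathcal H$ a complex Hilbert space, $\mathcal K$ an infinite-dimensional Hilbert space. $\mathbb F_n^+$ is the unital free semigroup on generators $g_1,\ldots,g_n$ with identity $g_0$; $|\alpha|$ is the length and $\tilde\alpha$ the reverse word of $\alpha$. $X_\alpha:=X_{i_1}\cdots X_{i_k}$ if $\alpha=g_{i_1}\cdots g_{i_k}$, $X_{g_0}:=I$. The joint spectral radius is $r(X):=\lim_{k\to\infty}\|\sum_{|\alpha|=k}X_\alpha X_\alpha^*\|^{1/2k}$ and $[\mathcal C_\infty]_{<1}:=\{X\in B(\mathcal H)^n:r(X)<1\}$. For $A,B\in[\mathcal C_\infty]_{<1}$, $d_K(A,B):=\sup_p\|\Re p(A)-\Re p(B)\|$, the supremum over all noncommutative polynomials $p\in\mathbb C[X_1,\ldots,X_n]\otimes M_m$, $m\in\mathbb N$, with $\Re p(0)=I$ and $\Re p(X):=\frac12(p(X)^*+p(X))\ge0$ for all $X\in B(\mathcal K)^n$ with $\|\sum_iX_iX_i^*\|<1$; here $p(A)=\sum_\alpha A_\alpha\otimes M_\alpha$ for $p=\sum_\alpha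 X_\alpha\otimes M_\alpha$. $R_i\varphi:=\varphi\otimes e_i$ are the right creation operators on the full Fock space $F^2(H_n)=\mathbb C1\oplus\bigoplus_{k\ge1}H_n^{\otimes k}$ ($e_1,\ldots,e_n$ an orthonormal basis of the $n$-dimensional Hilbert space $H_n$), and for $X\in[\mathcal C_\infty]_{<1}$ $$P_1(X,R):=\sum_{k=1}^\infty\sum_{|\alpha|=k}X_\alpha\otimes R_{\tilde\alpha}^*+I\otimes I+\sum_{k=1}^\infty\sum_{|\alpha|=k}X_\alpha^*\otimes R_{\tilde\alpha}$$ (convergent in operator norm). *)

theory Defs
  imports "HOL-Analysis.Analysis" "Jordan_Normal_Form.Matrix"
begin

section \<open>Complex Hilbert spaces\<close>

class complex_vector = real_vector +
  fixes scaleC :: "complex \<Rightarrow> 'a \<Rightarrow> 'a" (infixr \<open>*\<^sub>C\<close> 75)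
  assumes scaleC_add_right: "c *\<^sub>C (x + y) = c *\<^sub>C x + c *\<^sub>C y"
    and scaleC_add_left: "(c + d) *\<^sub>C x = c *\<^sub>C x + d *\<^sub>C x"
    and scaleC_scaleC: "c *\<^sub>C d *\<^sub>C x = (c * d) *\<^sub>C x"
    and scaleC_of_real: "of_real r *\<^sub>C x = r *\<^sub>R x"

text \<open>The inner product is linear in its first argument. Norm and real inner product are those of
  the underlying real Hilbert space, the latter being the real part of \<^term>\<open>cinner\<close>.\<close>

class chilbert_space = complex_vector + real_inner + complete_space +
  fixes cinner :: "'a \<Rightarrow> 'a \<Rightarrow> complex"
  assumes cinner_commute: "cinner y x = cnj (cinner x y)"
    and cinner_add_left: "cinner (x + y) z = cinner x z + cinner y z"
    and cinner_scaleC_left: "cinner (c *\<^sub>C x) y = c * cinner x y"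
    and inner_eq_Re_cinner: "inner x y = Re (cinner x y)"

definition infinite_dimensional :: "'a::complex_vector itself \<Rightarrow> bool" where
  "infinite_dimensional _ \<longleftrightarrow> \<not> (\<exists>S::'a set. finite S \<and> module.span scaleC S = UNIV)"

lemma scaleC_one [simp]: "1 *\<^sub>C x = (x::'a::complex_vector)"
  using scaleC_of_real[of 1 x] by simp

lemma scaleC_scaleR_commute: "c *\<^sub>C r *\<^sub>R x = r *\<^sub>R c *\<^sub>C (x::'a::complex_vector)"
  by (metis mult.commute scaleC_of_real scaleC_scaleC)

lemma scaleC_zero_right [simp]: "c *\<^sub>C 0 = (0::'a::complex_vector)"
  using scaleC_add_right[of c 0 0] by simp

lemma scaleC_minus_right: "c *\<^sub>C (- x) = - (c *\<^sub>C (x::'a::complex_vector))"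
  using scaleC_add_right[of c x "- x"] by (simp add: eq_neg_iff_add_eq_0 add.commute)

lemma cinner_self: "cinner x x = of_real ((norm x)\<^sup>2)" for x :: "'a::chilbert_space"
proof -
  have "Im (cinner x x) = 0"
    using cinner_commute[of x x] by (simp add: complex_eq_iff)
  moreover have "Re (cinner x x) = (norm x)\<^sup>2"
    by (simp add: power2_norm_eq_inner inner_eq_Re_cinner)
  ultimately show ?thesis by (simp add: complex_eq_iff)
qed

lemma cinner_add_right: "cinner x (y + z) = cinner x y + cinner x z"
  for x :: "'a::chilbert_space"
  by (metis cinner_add_left cinner_commute complex_cnj_add)

lemma cinner_scaleC_right: "cinner x (c *\<^sub>C y) = cnj c * cinner x y"
  for x :: "'a::chilbert_space"
  by (metis cinner_scaleC_left cinner_commute complex_cnj_mult)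

lemma norm_scaleC: "norm (c *\<^sub>C x) = cmod c * norm x" for x :: "'a::chilbert_space"
proof -
  have "complex_of_real ((norm (c *\<^sub>C x))\<^sup>2) = c * cnj c * cinner x x"
    unfolding cinner_self[symmetric] by (simp only: cinner_scaleC_left cinner_scaleC_right ac_simps)
  also have "\<dots> = of_real ((cmod c * norm x)\<^sup>2)"
    by (simp only: complex_norm_square[symmetric] cinner_self power_mult_distrib of_real_mult)
  finally have "complex_of_real ((norm (c *\<^sub>C x))\<^sup>2) = of_real ((cmod c * norm x)\<^sup>2)" .
  then have "(norm (c *\<^sub>C x))\<^sup>2 = (cmod c * norm x)\<^sup>2"
    using of_real_eq_iff by blast
  then show ?thesis by simp
qed

lemma Re_cinner_le: "Re (cinner x y) \<le> norm x * norm y" for x :: "'a::chilbert_space"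
  using norm_cauchy_schwarz[of x y] by (simp add: inner_eq_Re_cinner)

lemma norm_cinner_le: "cmod (cinner x y) \<le> norm x * norm y" for x :: "'a::chilbert_space"
proof (cases "cinner x y = 0")
  case False
  define c where "c = cnj (cinner x y) / cmod (cinner x y)"
  have c: "cmod c = 1"
    using False by (simp add: c_def norm_divide)
  have "cinner (c *\<^sub>C x) y = of_real (cmod (cinner x y))"
    using False
    by (simp add: c_def cinner_scaleC_left field_simps complex_norm_square[symmetric] power2_eq_square)
  then have "cmod (cinner x y) \<le> norm (c *\<^sub>C x) * norm y"
    using Re_cinner_le[of "c *\<^sub>C x" y] by simp
  then show ?thesis using c by (simp add: norm_scaleC)
qed simp

lemma bounded_linear_scaleC: "bounded_linear (\<lambda>x::'a::chilbert_space. c *\<^sub>C x)"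
  by (rule bounded_linear_intro[of _ "cmod c"])
    (simp_all add: scaleC_add_right scaleC_scaleR_commute norm_scaleC mult.commute)

instantiation complex :: chilbert_space
begin

definition scaleC_complex :: "complex \<Rightarrow> complex \<Rightarrow> complex" where
  "scaleC_complex c z = c * z"

definition cinner_complex :: "complex \<Rightarrow> complex \<Rightarrow> complex" where
  "cinner_complex z w = z * cnj w"

instance
  by standard
    (auto simp: scaleC_complex_def cinner_complex_def algebra_simps scaleR_conv_of_real
      inner_complex_def)

end


section \<open>The algebra of bounded operators\<close>

text \<open>The algebra of bounded complex-linear operators, with the operator norm inherited from the
  bounded real-linear operators and composition as product.\<close>

typedef (overloaded) 'h bop = "{T :: 'h::chilbert_space \<Rightarrow>\<^sub>L 'h. \<forall>c x. T (c *\<^sub>C x) = c *\<^sub>C T x}"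
  morphisms blinfun_of_bop Bop
  by (rule exI[of _ 0]) simp

setup_lifting type_definition_bop

lift_definition bop_apply :: "'h::chilbert_space bop \<Rightarrow> 'h \<Rightarrow> 'h" is blinfun_apply .

declare [[coercion bop_apply]]

instantiation bop :: (chilbert_space) real_normed_vector
begin

lift_definition zero_bop :: "'a bop" is 0 by simp
lift_definition plus_bop :: "'a bop \<Rightarrow> 'a bop \<Rightarrow> 'a bop" is "(+)"
  by (simp add: blinfun.add_left scaleC_add_right)
lift_definition uminus_bop :: "'a bop \<Rightarrow> 'a bop" is uminus
  by (simp add: blinfun.minus_left scaleC_minus_right)
lift_definition minus_bop :: "'a bop \<Rightarrow> 'a bop \<Rightarrow> 'a bop" is "(-)"
  by (simp add: diff_conv_add_uminus blinfun.add_left blinfun.minus_left scaleC_add_right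
      scaleC_minus_right del: add_uminus_conv_diff)
lift_definition scaleR_bop :: "real \<Rightarrow> 'a bop \<Rightarrow> 'a bop" is scaleR
  by (simp add: blinfun.scaleR_left scaleC_scaleR_commute)
lift_definition norm_bop :: "'a bop \<Rightarrow> real" is norm .
definition dist_bop :: "'a bop \<Rightarrow> 'a bop \<Rightarrow> real" where "dist_bop S T = norm (S - T)"
definition sgn_bop :: "'a bop \<Rightarrow> 'a bop" where "sgn_bop T = inverse (norm T) *\<^sub>R T"
definition uniformity_bop :: "('a bop \<times> 'a bop) filter" where
  "uniformity_bop = (INF e\<in>{0<..}. principal {(S, T). dist S T < e})"
definition open_bop :: "'a bop set \<Rightarrow> bool" where
  "open_bop U = (\<forall>S\<in>U. \<forall>\<^sub>F (S', T) in uniformity. S' = S \<longrightarrow> T \<in> U)"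

instance
proof
  fix S T U :: "'a bop" and r s :: real
  show "S + T + U = S + (T + U)" by transfer (simp add: add.assoc)
  show "S + T = T + S" by transfer (simp add: add.commute)
  show "0 + S = S" by transfer simp
  show "- S + S = 0" by transfer simp
  show "S - T = S + - T" by transfer simp
  show "r *\<^sub>R (S + T) = r *\<^sub>R S + r *\<^sub>R T" by transfer (simp add: scaleR_add_right)
  show "(r + s) *\<^sub>R S = r *\<^sub>R S + s *\<^sub>R S" by transfer (simp add: scaleR_add_left)
  show "r *\<^sub>R s *\<^sub>R S = (r * s) *\<^sub>R S" by transfer simp
  show "1 *\<^sub>R S = S" by transfer simp
  show "(norm S = 0) = (S = 0)" by transfer simp
  show "norm (S + T) \<le> norm S + norm T" by transfer (rule norm_triangle_ineq)
  show "norm (r *\<^sub>R S) = \<bar>r\<bar> * norm S" by transfer simp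
qed (simp_all add: dist_bop_def sgn_bop_def uniformity_bop_def open_bop_def)

end

instantiation bop :: (chilbert_space) complex_vector
begin

lift_definition scaleC_bop :: "complex \<Rightarrow> 'a bop \<Rightarrow> 'a bop" is
  "\<lambda>c T. Blinfun (\<lambda>x. c *\<^sub>C x) o\<^sub>L T"
  by (simp add: bounded_linear_Blinfun_apply bounded_linear_scaleC scaleC_scaleC mult.commute)

instance
proof
  fix S T :: "'a bop" and c d :: complex and r :: real
  note [simp] = bounded_linear_Blinfun_apply bounded_linear_scaleC blinfun.add_left
    blinfun.scaleR_left
  show "c *\<^sub>C (S + T) = c *\<^sub>C S + c *\<^sub>C T"
    by transfer (rule blinfun_eqI, simp add: scaleC_add_right)
  show "(c + d) *\<^sub>C S = c *\<^sub>C S + d *\<^sub>C S"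
    by transfer (rule blinfun_eqI, simp add: scaleC_add_left)
  show "c *\<^sub>C d *\<^sub>C S = (c * d) *\<^sub>C S"
    by transfer (rule blinfun_eqI, simp add: scaleC_scaleC)
  show "of_real r *\<^sub>C S = r *\<^sub>R S"
    by transfer (rule blinfun_eqI, simp add: scaleC_of_real)
qed

end

instantiation bop :: (chilbert_space) "{real_normed_algebra, monoid_mult}"
begin

lift_definition one_bop :: "'a bop" is id_blinfun by simp
lift_definition times_bop :: "'a bop \<Rightarrow> 'a bop \<Rightarrow> 'a bop" is blinfun_compose by simp

instance
proof
  fix S T U :: "'a bop" and r :: real
  show "S * T * U = S * (T * U)" by transfer (rule blinfun_eqI, simp)
  show "1 * S = S" by transfer (rule blinfun_eqI, simp)
  show "S * 1 = S" by transfer (rule blinfun_eqI, simp)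
  show "(S + T) * U = S * U + T * U"
    by transfer (rule blinfun_eqI, simp add: blinfun.add_left)
  show "S * (T + U) = S * T + S * U"
    by transfer (rule blinfun_eqI, simp add: blinfun.add_left blinfun.add_right)
  show "r *\<^sub>R S * T = r *\<^sub>R (S * T)"
    by transfer (rule blinfun_eqI, simp add: blinfun.scaleR_left)
  show "S * r *\<^sub>R T = r *\<^sub>R (S * T)"
    by transfer (rule blinfun_eqI, simp add: blinfun.scaleR_left blinfun.scaleR_right)
  show "norm (S * T) \<le> norm S * norm T"
    by transfer (rule norm_blinfun_compose)
qed

end

definition adj :: "'h::chilbert_space bop \<Rightarrow> 'h bop" where
  "adj T = (THE S :: 'h bop. \<forall>x y. cinner (T x) y = cinner x (S y))"


section \<open>Hilbert space tensor products with \<open>\<ell>\<^sup>2\<close>\<close>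

text \<open>\<open>('j, 'h) ell2\<close> is the space of square-summable families of vectors of \<open>'h\<close> indexed by \<open>'j\<close>.
  It is the Hilbert space tensor product of \<open>'h\<close> with \<open>('j, complex) ell2\<close>, the elementary tensors
  being \<open>h \<otimes>\<^sub>v f\<close> below.\<close>

typedef (overloaded) ('j, 'h) ell2 =
    "{f :: 'j \<Rightarrow> 'h::chilbert_space. (\<lambda>j. (norm (f j))\<^sup>2) summable_on UNIV}"
  morphisms ell2_nth Ell2
  by (rule exI[of _ "\<lambda>_. 0"]) simp

setup_lifting type_definition_ell2

lemma sq_norm_add_le: "(norm (x + y))\<^sup>2 \<le> 2 * (norm x)\<^sup>2 + 2 * (norm y)\<^sup>2"
  for x :: "'a::real_normed_vector"
proof -
  have "(norm (x + y))\<^sup>2 \<le> (norm x + norm y)\<^sup>2"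
    by (intro power_mono norm_triangle_ineq) simp
  also have "\<dots> \<le> 2 * (norm x)\<^sup>2 + 2 * (norm y)\<^sup>2"
    using sum_squares_bound[of "norm x" "norm y"] by (simp add: power2_sum)
  finally show ?thesis .
qed

lemma sq_summable_add:
  fixes f g :: "'j \<Rightarrow> 'h::real_normed_vector"
  assumes "(\<lambda>j. (norm (f j))\<^sup>2) summable_on UNIV" "(\<lambda>j. (norm (g j))\<^sup>2) summable_on UNIV"
  shows "(\<lambda>j. (norm (f j + g j))\<^sup>2) summable_on UNIV"
proof (rule summable_on_comparison_test)
  show "(\<lambda>j. 2 * (norm (f j))\<^sup>2 + 2 * (norm (g j))\<^sup>2) summable_on UNIV"
    by (intro summable_on_add summable_on_cmult_right assms)
qed (simp_all add: sq_norm_add_le)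

lemma summable_on_cinner:
  fixes f g :: "'j \<Rightarrow> 'h::chilbert_space"
  assumes "(\<lambda>j. (norm (f j))\<^sup>2) summable_on UNIV" "(\<lambda>j. (norm (g j))\<^sup>2) summable_on UNIV"
  shows "(\<lambda>j. cinner (f j) (g j)) summable_on UNIV"
proof -
  have "(\<lambda>j. cmod (cinner (f j) (g j))) summable_on UNIV"
  proof (rule summable_on_comparison_test)
    show "(\<lambda>j. (norm (f j))\<^sup>2 + (norm (g j))\<^sup>2) summable_on UNIV"
      by (intro summable_on_add assms)
    fix j
    have "cmod (cinner (f j) (g j)) \<le> norm (f j) * norm (g j)" by (rule norm_cinner_le)
    also have "\<dots> \<le> (norm (f j))\<^sup>2 + (norm (g j))\<^sup>2"
      using sum_squares_bound[of "norm (f j)" "norm (g j)"] mult_nonneg_nonneg[of "norm (f j)" "norm (g j)"]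
      by (simp del: mult_nonneg_nonneg)
    finally show "cmod (cinner (f j) (g j)) \<le> (norm (f j))\<^sup>2 + (norm (g j))\<^sup>2" .
  qed simp
  then show ?thesis by (rule abs_summable_summable)
qed

instantiation ell2 :: (type, chilbert_space) complex_vector
begin

lift_definition zero_ell2 :: "('a, 'b) ell2" is "\<lambda>_. 0" by simp
lift_definition plus_ell2 :: "('a, 'b) ell2 \<Rightarrow> ('a, 'b) ell2 \<Rightarrow> ('a, 'b) ell2" is
  "\<lambda>f g j. f j + g j" by (rule sq_summable_add)
lift_definition uminus_ell2 :: "('a, 'b) ell2 \<Rightarrow> ('a, 'b) ell2" is "\<lambda>f j. - f j" by simp
lift_definition minus_ell2 :: "('a, 'b) ell2 \<Rightarrow> ('a, 'b) ell2 \<Rightarrow> ('a, 'b) ell2" is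
  "\<lambda>f g j. f j - g j"
  using sq_summable_add[where g = "\<lambda>j. - g j" for g] by simp
lift_definition scaleR_ell2 :: "real \<Rightarrow> ('a, 'b) ell2 \<Rightarrow> ('a, 'b) ell2" is "\<lambda>r f j. r *\<^sub>R f j"
  by (simp add: power_mult_distrib summable_on_cmult_right)
lift_definition scaleC_ell2 :: "complex \<Rightarrow> ('a, 'b) ell2 \<Rightarrow> ('a, 'b) ell2" is "\<lambda>c f j. c *\<^sub>C f j"
  by (simp add: norm_scaleC power_mult_distrib summable_on_cmult_right)

instance
proof
  fix f g h :: "('a, 'b) ell2" and r s :: real and c d :: complex
  show "f + g + h = f + (g + h)" by transfer (simp add: add.assoc)
  show "f + g = g + f" by transfer (simp add: add.commute)
  show "0 + f = f" by transfer simp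
  show "- f + f = 0" by transfer simp
  show "f - g = f + - g" by transfer simp
  show "r *\<^sub>R (f + g) = r *\<^sub>R f + r *\<^sub>R g" by transfer (simp add: scaleR_add_right)
  show "(r + s) *\<^sub>R f = r *\<^sub>R f + s *\<^sub>R f" by transfer (simp add: scaleR_add_left)
  show "r *\<^sub>R s *\<^sub>R f = (r * s) *\<^sub>R f" by transfer simp
  show "1 *\<^sub>R f = f" by transfer simp
  show "c *\<^sub>C (f + g) = c *\<^sub>C f + c *\<^sub>C g" by transfer (simp add: scaleC_add_right)
  show "(c + d) *\<^sub>C f = c *\<^sub>C f + d *\<^sub>C f" by transfer (simp add: scaleC_add_left)
  show "c *\<^sub>C d *\<^sub>C f = (c * d) *\<^sub>C f" by transfer (simp add: scaleC_scaleC)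
  show "of_real r *\<^sub>C f = r *\<^sub>R f" by transfer (simp add: scaleC_of_real)
qed

end

lift_definition ell2_cinner :: "('j, 'h::chilbert_space) ell2 \<Rightarrow> ('j, 'h) ell2 \<Rightarrow> complex" is
  "\<lambda>f g. \<Sum>\<^sub>\<infinity>j. cinner (f j) (g j)" .

lemma ell2_cinner_self: "ell2_cinner f f = of_real (\<Sum>\<^sub>\<infinity>j. (norm (ell2_nth f j))\<^sup>2)"
proof -
  have "ell2_cinner f f = (\<Sum>\<^sub>\<infinity>j. of_real ((norm (ell2_nth f j))\<^sup>2))"
    by (simp only: ell2_cinner.rep_eq cinner_self)
  also have "\<dots> = of_real (\<Sum>\<^sub>\<infinity>j. (norm (ell2_nth f j))\<^sup>2)"
    using ell2_nth[of f]
    by (intro infsumI has_sum_bounded_linear[OF bounded_linear_of_real] has_sum_infsum) simp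
  finally show ?thesis .
qed

instantiation ell2 :: (type, chilbert_space) real_inner
begin

definition inner_ell2 :: "('a, 'b) ell2 \<Rightarrow> ('a, 'b) ell2 \<Rightarrow> real" where
  "inner_ell2 f g = Re (ell2_cinner f g)"
definition norm_ell2 :: "('a, 'b) ell2 \<Rightarrow> real" where
  "norm_ell2 f = sqrt (\<Sum>\<^sub>\<infinity>j. (norm (ell2_nth f j))\<^sup>2)"
definition dist_ell2 :: "('a, 'b) ell2 \<Rightarrow> ('a, 'b) ell2 \<Rightarrow> real" where
  "dist_ell2 f g = norm (f - g)"
definition sgn_ell2 :: "('a, 'b) ell2 \<Rightarrow> ('a, 'b) ell2" where "sgn_ell2 f = inverse (norm f) *\<^sub>R f"
definition uniformity_ell2 :: "(('a, 'b) ell2 \<times> ('a, 'b) ell2) filter" where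
  "uniformity_ell2 = (INF e\<in>{0<..}. principal {(f, g). dist f g < e})"
definition open_ell2 :: "('a, 'b) ell2 set \<Rightarrow> bool" where
  "open_ell2 U = (\<forall>f\<in>U. \<forall>\<^sub>F (f', g) in uniformity. f' = f \<longrightarrow> g \<in> U)"

instance
proof
  fix f g h :: "('a, 'b) ell2" and r :: real
  have cnj: "ell2_cinner g f = cnj (ell2_cinner f g)"
    by transfer (simp add: infsum_cnj[symmetric] cinner_commute[symmetric])
  show "inner f g = inner g f"
    by (simp add: inner_ell2_def cnj)
  have "ell2_cinner (f + g) h = ell2_cinner f h + ell2_cinner g h"
    by transfer (simp add: cinner_add_left infsum_add summable_on_cinner)
  then show "inner (f + g) h = inner f h + inner g h"
    by (simp add: inner_ell2_def)
  have "ell2_cinner (r *\<^sub>R f) g = of_real r * ell2_cinner f g"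
    by transfer (simp add: scaleC_of_real[symmetric] cinner_scaleC_left infsum_cmult_right')
  then show "inner (r *\<^sub>R f) g = r * inner f g"
    by (simp add: inner_ell2_def)
  show "0 \<le> inner f f"
    by (simp add: inner_ell2_def ell2_cinner_self infsum_nonneg)
  show "(inner f f = 0) = (f = 0)"
  proof
    assume *: "inner f f = 0"
    then have "ell2_nth f j = 0" for j
      using nonneg_infsum_le_0D[of "\<lambda>j. (norm (ell2_nth f j))\<^sup>2" UNIV j] ell2_nth[of f]
      by (simp add: inner_ell2_def ell2_cinner_self)
    then show "f = 0" by transfer auto
  next
    assume "f = 0"
    then show "inner f f = 0"
      by (simp add: inner_ell2_def ell2_cinner_self zero_ell2.rep_eq)
  qed
  show "norm f = sqrt (inner f f)"
    by (simp add: inner_ell2_def ell2_cinner_self norm_ell2_def)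
qed (simp_all add: dist_ell2_def sgn_ell2_def uniformity_ell2_def open_ell2_def)

end

lemma ell2_nth_diff: "ell2_nth (f - g) j = ell2_nth f j - ell2_nth g j"
  by transfer simp

lemma finite_sum_le_norm_ell2:
  assumes "finite F"
  shows "(\<Sum>j\<in>F. (norm (ell2_nth f j))\<^sup>2) \<le> (norm f)\<^sup>2"
  using finite_sum_le_infsum[of "\<lambda>j. (norm (ell2_nth f j))\<^sup>2" UNIV F] ell2_nth[of f] assms
  by (simp add: norm_ell2_def infsum_nonneg)

lemma norm_ell2_nth_le: "norm (ell2_nth f j) \<le> norm f"
  using finite_sum_le_norm_ell2[of "{j}" f] by (simp add: power2_le_iff_abs_le)

instance ell2 :: (type, chilbert_space) complete_space
proof
  fix X :: "nat \<Rightarrow> ('a, 'b) ell2"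
  assume X: "Cauchy X"
  have "Cauchy (\<lambda>n. ell2_nth (X n) j)" for j
  proof (rule metric_CauchyI)
    fix e :: real assume "e > 0"
    with X obtain N where "\<forall>m\<ge>N. \<forall>n\<ge>N. dist (X m) (X n) < e"
      unfolding Cauchy_def by blast
    moreover have "dist (ell2_nth f j) (ell2_nth g j) \<le> dist f g" for f g :: "('a, 'b) ell2"
      using norm_ell2_nth_le[of "f - g" j] by (simp add: dist_norm ell2_nth_diff)
    ultimately show "\<exists>N. \<forall>m\<ge>N. \<forall>n\<ge>N. dist (ell2_nth (X m) j) (ell2_nth (X n) j) < e"
      by (meson order.strict_trans1)
  qed
  then have "\<exists>l. (\<lambda>n. ell2_nth (X n) j) \<longlonglongrightarrow> l" for j
    by (simp only: Cauchy_convergent_iff convergent_def)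
  then obtain L where L: "(\<lambda>n. ell2_nth (X n) j) \<longlonglongrightarrow> L j" for j
    by metis
  have bound: "\<exists>N. \<forall>n\<ge>N. \<forall>F. finite F \<longrightarrow> (\<Sum>j\<in>F. (norm (ell2_nth (X n) j - L j))\<^sup>2) \<le> e\<^sup>2"
    if e: "e > 0" for e :: real
  proof -
    obtain N where N: "\<And>m n. m \<ge> N \<Longrightarrow> n \<ge> N \<Longrightarrow> dist (X m) (X n) < e"
      using X e unfolding Cauchy_def by blast
    have "(\<Sum>j\<in>F. (norm (ell2_nth (X n) j - L j))\<^sup>2) \<le> e\<^sup>2" if n: "n \<ge> N" and F: "finite F" for n F
    proof (rule LIMSEQ_le_const2)
      show "(\<lambda>m. \<Sum>j\<in>F. (norm (ell2_nth (X n) j - ell2_nth (X m) j))\<^sup>2)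
          \<longlonglongrightarrow> (\<Sum>j\<in>F. (norm (ell2_nth (X n) j - L j))\<^sup>2)"
        by (intro tendsto_intros L)
      have "(\<Sum>j\<in>F. (norm (ell2_nth (X n) j - ell2_nth (X m) j))\<^sup>2) \<le> e\<^sup>2" if "m \<ge> N" for m
      proof -
        have "(\<Sum>j\<in>F. (norm (ell2_nth (X n) j - ell2_nth (X m) j))\<^sup>2) \<le> (norm (X n - X m))\<^sup>2"
          using finite_sum_le_norm_ell2[OF F, of "X n - X m"] by (simp add: ell2_nth_diff)
        also have "\<dots> \<le> e\<^sup>2"
          using N[OF n that] by (intro power_mono) (simp_all add: dist_norm)
        finally show ?thesis .
      qed
      then show "\<exists>M. \<forall>m\<ge>M. (\<Sum>j\<in>F. (norm (ell2_nth (X n) j - ell2_nth (X m) j))\<^sup>2) \<le> e\<^sup>2"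
        by blast
    qed
    then show ?thesis by blast
  qed
  have summable: "(\<lambda>j. (norm (ell2_nth (X n) j - L j))\<^sup>2) summable_on UNIV"
    if "\<forall>F. finite F \<longrightarrow> (\<Sum>j\<in>F. (norm (ell2_nth (X n) j - L j))\<^sup>2) \<le> c" for n c
    using that by (intro nonneg_bdd_above_summable_on bdd_aboveI[of _ c]) auto
  obtain N0 where "\<forall>F. finite F \<longrightarrow> (\<Sum>j\<in>F. (norm (ell2_nth (X N0) j - L j))\<^sup>2) \<le> 1"
    using bound[of 1] by auto
  then have "(\<lambda>j. (norm (ell2_nth (X N0) j - (ell2_nth (X N0) j - L j)))\<^sup>2) summable_on UNIV"
    using sq_summable_add[of "ell2_nth (X N0)" "\<lambda>j. - (ell2_nth (X N0) j - L j)"] ell2_nth[of "X N0"]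
      summable[of N0 1]
    by (simp add: norm_minus_commute[of "L _"])
  then have L_ell2: "ell2_nth (Ell2 L) = L"
    by (simp add: Ell2_inverse)
  have "X \<longlonglongrightarrow> Ell2 L"
  proof (rule metric_LIMSEQ_I)
    fix e :: real assume "e > 0"
    then obtain N where N: "\<forall>n\<ge>N. \<forall>F. finite F \<longrightarrow>
        (\<Sum>j\<in>F. (norm (ell2_nth (X n) j - L j))\<^sup>2) \<le> (e / 2)\<^sup>2"
      using bound[of "e / 2"] by auto
    have "dist (X n) (Ell2 L) < e" if "n \<ge> N" for n
    proof -
      have "(norm (X n - Ell2 L))\<^sup>2 \<le> (e / 2)\<^sup>2"
        using N that summable[of n "(e / 2)\<^sup>2"]
        by (auto simp: norm_ell2_def ell2_nth_diff L_ell2 infsum_nonneg intro!: infsum_le_finite_sums)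
      then have "norm (X n - Ell2 L) \<le> e / 2"
        using \<open>e > 0\<close> by (simp add: power2_le_iff_abs_le)
      then show ?thesis using \<open>e > 0\<close> by (simp add: dist_norm)
    qed
    then show "\<exists>N. \<forall>n\<ge>N. dist (X n) (Ell2 L) < e" by blast
  qed
  then show "convergent X" by (rule convergentI)
qed

instantiation ell2 :: (type, chilbert_space) chilbert_space
begin

definition cinner_ell2 :: "('a, 'b) ell2 \<Rightarrow> ('a, 'b) ell2 \<Rightarrow> complex" where
  "cinner_ell2 = ell2_cinner"

instance
proof
  fix f g h :: "('a, 'b) ell2" and c :: complex
  show "cinner g f = cnj (cinner f g)"
    unfolding cinner_ell2_def
    by transfer (simp add: infsum_cnj[symmetric] cinner_commute[symmetric])
  show "cinner (f + g) h = cinner f h + cinner g h"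
    unfolding cinner_ell2_def
    by transfer (simp add: cinner_add_left infsum_add summable_on_cinner)
  show "cinner (c *\<^sub>C f) g = c * cinner f g"
    unfolding cinner_ell2_def
    by transfer (simp add: cinner_scaleC_left infsum_cmult_right')
  show "inner f g = Re (cinner f g)"
    by (simp add: inner_ell2_def cinner_ell2_def)
qed

end

lift_definition tensor_vec :: "'h::chilbert_space \<Rightarrow> ('j, complex) ell2 \<Rightarrow> ('j, 'h) ell2"
    (infixr \<open>\<otimes>\<^sub>v\<close> 70) is
  "\<lambda>h f j. f j *\<^sub>C h"
  by (simp add: norm_scaleC power_mult_distrib summable_on_cmult_left)

text \<open>The elementary tensors span a dense subspace, so they determine \<open>S \<otimes>\<^sub>o T\<close>.\<close>

definition tensor_op :: "'h::chilbert_space bop \<Rightarrow> ('j, complex) ell2 bop \<Rightarrow> ('j, 'h) ell2 bop"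
    (infixr \<open>\<otimes>\<^sub>o\<close> 70) where
  "S \<otimes>\<^sub>o T = (THE W :: ('j, 'h) ell2 bop. \<forall>h f. W (h \<otimes>\<^sub>v f) = S h \<otimes>\<^sub>v T f)"


section \<open>The joint spectral radius\<close>

text \<open>Elements of the free semigroup on \<open>'n\<close> are lists over \<open>'n\<close>.\<close>

definition word_op :: "('n \<Rightarrow> 'h::chilbert_space bop) \<Rightarrow> 'n list \<Rightarrow> 'h bop" where
  "word_op X \<alpha> = prod_list (map X \<alpha>)"

definition joint_spectral_radius :: "('n::finite \<Rightarrow> 'h::chilbert_space bop) \<Rightarrow> real" where
  "joint_spectral_radius X =
     lim (\<lambda>k. root (2 * k) (norm (\<Sum>\<alpha> | length \<alpha> = k. word_op X \<alpha> * adj (word_op X \<alpha>))))"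

definition spectral_ball :: "('n::finite \<Rightarrow> 'h::chilbert_space bop) set" where
  "spectral_ball = {X. joint_spectral_radius X < 1}"


section \<open>Operator matrices\<close>

text \<open>The algebraic tensor product of the bounded operators on \<open>'h\<close> with the \<open>m \<times> m\<close> complex
  matrices is represented by the \<open>m \<times> m\<close> matrices over \<^typ>\<open>'h bop\<close>, where the tensor product of
  \<open>T\<close> and \<open>M\<close> has the entries \<open>M $$ (i, j) *\<^sub>C T\<close>. These matrices act on the \<open>m\<close>-fold direct sum of
  \<open>'h\<close>, whose elements are given by functions on \<^typ>\<open>nat\<close> of which only the first \<open>m\<close> values
  matter.\<close>

definition opmat_apply ::
    "'h::chilbert_space bop mat \<Rightarrow> (nat \<Rightarrow> 'h) \<Rightarrow> nat \<Rightarrow> 'h" where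
  "opmat_apply P v i = (\<Sum>j<dim_col P. (P $$ (i, j)) (v j))"

definition opmat_norm :: "'h::chilbert_space bop mat \<Rightarrow> real" where
  "opmat_norm P = Sup {sqrt (\<Sum>i<dim_row P. (norm (opmat_apply P v i))\<^sup>2) | v.
     (\<Sum>j<dim_col P. (norm (v j))\<^sup>2) \<le> 1}"

definition opmat_nonneg :: "'h::chilbert_space bop mat \<Rightarrow> bool" where
  "opmat_nonneg P \<longleftrightarrow> (\<forall>v. let z = (\<Sum>i<dim_row P. cinner (opmat_apply P v i) (v i))
     in z \<in> \<real> \<and> 0 \<le> Re z)"

definition opmat_adj :: "'h::chilbert_space bop mat \<Rightarrow> 'h bop mat" where
  "opmat_adj P = mat (dim_col P) (dim_row P) (\<lambda>(i, j). adj (P $$ (j, i)))"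

definition opmat_Re :: "'h::chilbert_space bop mat \<Rightarrow> 'h bop mat" where
  "opmat_Re P = map_mat (\<lambda>T. (1 / 2) *\<^sub>R T) (opmat_adj P + P)"


section \<open>Noncommutative polynomials and the metric \<open>d\<^sub>K\<close>\<close>

definition nc_polynomials :: "nat \<Rightarrow> ('n list \<Rightarrow> complex mat) set" where
  "nc_polynomials m = {p. (\<forall>\<alpha>. p \<alpha> \<in> carrier_mat m m) \<and> finite {\<alpha>. p \<alpha> \<noteq> 0\<^sub>m m m}}"

definition nc_eval ::
    "nat \<Rightarrow> ('n list \<Rightarrow> complex mat) \<Rightarrow> ('n \<Rightarrow> 'h::chilbert_space bop) \<Rightarrow> 'h bop mat" where
  "nc_eval m p A =
     mat m m (\<lambda>(i, j). \<Sum>\<alpha> | p \<alpha> \<noteq> 0\<^sub>m m m. p \<alpha> $$ (i, j) *\<^sub>C word_op A \<alpha>)"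

text \<open>The condition at the origin is stated at the zero tuple of operators on \<open>'k\<close>.\<close>

definition positive_polynomials ::
    "'k::chilbert_space itself \<Rightarrow> nat \<Rightarrow> ('n::finite list \<Rightarrow> complex mat) set" where
  "positive_polynomials _ m = {p \<in> nc_polynomials m.
     opmat_Re (nc_eval m p (\<lambda>_. 0 :: 'k bop)) = 1\<^sub>m m \<and>
     (\<forall>X :: 'n \<Rightarrow> 'k bop. norm (\<Sum>i\<in>UNIV. X i * adj (X i)) < 1 \<longrightarrow>
        opmat_nonneg (opmat_Re (nc_eval m p X)))}"

text \<open>The supremum is taken in \<^typ>\<open>ennreal\<close>, so that it is meaningful without a boundedness
  assumption.\<close>

definition dK :: "'k::chilbert_space itself \<Rightarrow> ('n::finite \<Rightarrow> 'h::chilbert_space bop) \<Rightarrow>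
    ('n \<Rightarrow> 'h bop) \<Rightarrow> ennreal" where
  "dK K A B = (SUP m\<in>{1..}. SUP p\<in>positive_polynomials K m.
     ennreal (opmat_norm (opmat_Re (nc_eval m p A) - opmat_Re (nc_eval m p B))))"


section \<open>The full Fock space and the kernel \<open>P\<^sub>1\<close>\<close>

text \<open>The full Fock space is identified with \<open>('n list, complex) ell2\<close> through its orthonormal basis
  of the tensors \<open>e\<^sub>\<alpha>\<close>, where \<open>e\<^sub>\<alpha> \<otimes> e\<^sub>i\<close> is the basis vector of the word \<open>\<alpha> @ [i]\<close>.\<close>

type_synonym 'n fock = "('n list, complex) ell2"

lift_definition fock_basis :: "'n list \<Rightarrow> 'n fock" is "\<lambda>\<alpha> \<beta>. if \<beta> = \<alpha> then 1 else 0"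
proof -
  fix \<alpha> :: "'n list"
  have "(\<lambda>\<beta>. (norm (if \<beta> = \<alpha> then 1 else 0 :: complex))\<^sup>2) summable_on {\<alpha>}"
    by (rule summable_on_finite) simp
  then show "(\<lambda>\<beta>. (norm (if \<beta> = \<alpha> then 1 else 0 :: complex))\<^sup>2) summable_on UNIV"
    by (rule summable_on_cong_neutral[THEN iffD1, rotated -1]) auto
qed

definition right_creation :: "'n \<Rightarrow> 'n fock bop" where
  "right_creation i = (THE R :: 'n fock bop. \<forall>\<alpha>. R (fock_basis \<alpha>) = fock_basis (\<alpha> @ [i]))"

definition poisson_kernel ::
    "('n::finite \<Rightarrow> 'h::chilbert_space bop) \<Rightarrow> ('n list, 'h) ell2 bop" where
  "poisson_kernel X =
     (\<Sum>k. \<Sum>\<alpha> | length \<alpha> = Suc k. word_op X \<alpha> \<otimes>\<^sub>o adj (word_op right_creation (rev \<alpha>)))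
     + 1 \<otimes>\<^sub>o 1
     + (\<Sum>k. \<Sum>\<alpha> | length \<alpha> = Suc k. adj (word_op X \<alpha>) \<otimes>\<^sub>o word_op right_creation (rev \<alpha>))"

end

theory Submission
  imports Defs
begin

text \<open>Coefficientwise, the operator \<open>P\<^sub>1(X, R)\<close> is the Toeplitz kernel on words whose entry from
  \<open>\<beta>\<gamma>\<close> to \<open>\<beta>\<close> is \<open>X\<^sub>\<gamma>\<close>. Put \<open>T = P\<^sub>1(A, R) - P\<^sub>1(B, R)\<close> and \<open>c = \<parallel>T\<parallel>\<close>. The kernels \<open>c I \<plusminus> T\<close> are
  positive and Toeplitz, hence Gram kernels of vectors on which a row contraction of partial isometries acts
  by shifting words; evaluating a positive polynomial \<open>p\<close> on that row gives
  \<open>\<bar>\<langle>(\<Re> p(A) - \<Re> p(B)) v, v\<rangle>\<bar> \<le> c \<parallel>v\<parallel>\<^sup>2\<close>. Conversely, compressing the Poisson kernel to the words of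
  length at most \<open>N\<close> gives the real part of a positive polynomial, and the compressions of \<open>T\<close> exhaust its norm.
  The assertions on dilations follow because \<open>p(r X)\<close> is again a positive polynomial in \<open>X\<close>.\<close>

text \<open>Polynomials are positive on tuples over K inside the unit ball, whereas A and B act on H
  and may leave that ball. Only scalars can cross: for fixed vectors v_j in H the coefficients of c
  I + s T, with s = 1 or s = -1, form a scalar Toeplitz kernel, and this is what gets realised in K.
  Kernels of every finite size occur, which is why K must be infinite-dimensional. Positivity holds
  on the open ball only, but the realising row may have norm 1; it is scaled by r < 1, and r tends
  to 1 in a finite sum. The term c ||v||^2 comes from Re p(0) = I. The outcome bounds a quadratic
  form, which suffices since a difference of real parts is self-adjoint. In the converse direction
  nothing is approximated by polynomials: each compression is exactly the real part of one matrix
  polynomial. The operator P_1 is only ever seen through its matrix coefficients; the condition r(X)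
  < 1 enters through absolute convergence of the two series, which allows coefficients to be
  computed term by term.\<close>

instance chilbert_space \<subseteq> banach ..

section \<open>The Riesz representation theorem\<close>

text \<open>The representing vector is the minimiser of ||x||^2 - 2 g(x). Minimising sequences are
  Cauchy by the parallelogram law, completeness yields the minimiser, and the vanishing first
  variation there is the claim.\<close>

lemma Riesz_real:
  fixes g :: "'a::{real_inner, complete_space} \<Rightarrow> real"
  assumes "bounded_linear g"
  shows "\<exists>y. \<forall>x. g x = inner x y"
proof -
  interpret g: bounded_linear g by fact
  obtain K where K: "\<And>x. norm (g x) \<le> norm x * K"
    using g.bounded by blast
  define F where "F x = (norm x)\<^sup>2 - 2 * g x" for x
  have lower: "- K\<^sup>2 \<le> F x" for x
  proof -
    have "g x \<le> norm x * K" using K[of x] by simp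
    moreover have "0 \<le> (norm x - K)\<^sup>2" by simp
    ultimately show ?thesis unfolding F_def power2_diff by linarith
  qed
  have bdd: "bdd_below (range F)"
    by (rule bdd_belowI[of _ "- K\<^sup>2"]) (use lower in auto)
  define I where "I = Inf (range F)"
  have I_le: "I \<le> F x" for x
    unfolding I_def by (rule cInf_lower[OF _ bdd]) simp
  have "\<exists>x. F x < I + inverse (real (Suc n))" for n
  proof -
    have "Inf (range F) < I + inverse (real (Suc n))" by (simp add: I_def)
    from cInf_lessD[OF _ this] show ?thesis by auto
  qed
  then obtain u where u: "\<And>n. F (u n) < I + inverse (real (Suc n))" by metis
  \<comment> \<open>Parallelogram law: the linear terms cancel because \<open>g\<close> is linear,
    so two values of \<open>F\<close> close to the infimum force their arguments to be
    close.\<close>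
  have par: "(norm (x - y))\<^sup>2 = 2 * F x + 2 * F y - 4 * F ((1/2) *\<^sub>R (x + y))" for x y
    unfolding F_def g.scaleR g.add power2_norm_eq_inner
    by (simp add: inner_add_left inner_add_right inner_diff_left inner_diff_right
        inner_commute[of y x] algebra_simps)
  have near: "(norm (u m - u n))\<^sup>2 \<le> 4 * inverse (real (Suc N))" if "m \<ge> N" "n \<ge> N" for m n N
  proof -
    have "inverse (real (Suc m)) \<le> inverse (real (Suc N))" "inverse (real (Suc n)) \<le> inverse (real (Suc N))"
      using that by simp_all
    then show ?thesis
      using u[of m] u[of n] I_le[of "(1/2) *\<^sub>R (u m + u n)"] unfolding par by linarith
  qed
  have "Cauchy u"
  proof (rule metric_CauchyI)
    fix e :: real assume "e > 0"
    then obtain N where N: "inverse (real (Suc N)) < e\<^sup>2 / 4"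
      using reals_Archimedean[of "e\<^sup>2 / 4"] by auto
    have "dist (u m) (u n) < e" if "m \<ge> N" "n \<ge> N" for m n
    proof -
      have "(norm (u m - u n))\<^sup>2 < e\<^sup>2" using near[OF that] N by linarith
      then show ?thesis using \<open>e > 0\<close> by (simp add: dist_norm power_less_imp_less_base)
    qed
    then show "\<exists>M. \<forall>m\<ge>M. \<forall>n\<ge>M. dist (u m) (u n) < e" by blast
  qed
  then obtain y where y: "u \<longlonglongrightarrow> y"
    using Cauchy_convergent_iff convergent_def by blast
  have "(\<lambda>n. F (u n)) \<longlonglongrightarrow> F y"
    unfolding F_def by (intro tendsto_intros y g.tendsto)
  moreover have "(\<lambda>n. I + inverse (real (Suc n))) \<longlonglongrightarrow> I + 0"
    by (intro tendsto_intros LIMSEQ_inverse_real_of_nat)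
  ultimately have Fy: "F y \<le> I"
    using LIMSEQ_le[of "\<lambda>n. F (u n)" "F y" "\<lambda>n. I + inverse (real (Suc n))" I] u less_imp_le by auto
  have "g x = inner x y" for x
  proof -
    define d where "d = g x - inner x y"
    have *: "2 * t * d \<le> t\<^sup>2 * (norm x)\<^sup>2" for t
    proof -
      have "F y \<le> F (y + t *\<^sub>R x)" using Fy I_le order_trans by blast
      then show ?thesis
        unfolding F_def g.scaleR g.add d_def power2_norm_eq_inner
        by (simp add: inner_add_left inner_add_right inner_commute[of y x] power2_eq_square algebra_simps)
    qed
    have "d = 0"
    proof (rule ccontr)
      assume d: "d \<noteq> 0"
      \<comment> \<open>With t = d / s the linear term of the previous inequality beats the
        quadratic one; the summand 1 keeps \<open>s\<close> positive at x = 0.\<close>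
      define s where "s = (norm x)\<^sup>2 + 1"
      have s: "s > 0" "(norm x)\<^sup>2 < s" by (simp_all add: s_def add_nonneg_pos)
      have "2 * (d / s) * d \<le> (d / s)\<^sup>2 * (norm x)\<^sup>2" by (rule *)
      also have "\<dots> \<le> (d / s)\<^sup>2 * s" using s by (intro mult_left_mono) auto
      finally have "2 * d\<^sup>2 / s \<le> d\<^sup>2 / s"
        using s by (simp add: power2_eq_square field_simps)
      then show False using d s by (simp add: divide_le_cancel)
    qed
    then show ?thesis by (simp add: d_def)
  qed
  then show ?thesis by blast
qed

text \<open>The real part is represented by the real theorem, and complex linearity recovers the
  imaginary part through Im w = Re (-i w).\<close>

lemma Riesz:
  fixes f :: "'a::chilbert_space \<Rightarrow> complex"
  assumes "bounded_linear f" "\<And>c x. f (c *\<^sub>C x) = c * f x"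
  shows "\<exists>y. \<forall>x. f x = cinner x y"
proof -
  have "bounded_linear (\<lambda>x. Re (f x))"
    by (rule bounded_linear_compose[OF bounded_linear_Re assms(1)])
  then obtain y where y: "\<And>x. Re (f x) = inner x y" using Riesz_real by blast
  have "f x = cinner x y" for x
  proof (rule complex_eqI)
    show "Re (f x) = Re (cinner x y)" by (simp add: y inner_eq_Re_cinner)
    have "Im (f x) = Re (f ((-\<i>) *\<^sub>C x))" unfolding assms(2) by simp
    also have "\<dots> = Im (cinner x y)" unfolding y inner_eq_Re_cinner cinner_scaleC_left by simp
    finally show "Im (f x) = Im (cinner x y)" .
  qed
  then show ?thesis by blast
qed

section \<open>Bounded operators and adjoints\<close>

lemma bop_eqI: "(\<And>x. S x = T x) \<Longrightarrow> S = T" for S T :: "'h::chilbert_space bop"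
  by transfer (auto intro: blinfun_eqI)

lemma bounded_linear_bop: "bounded_linear (bop_apply T)"
  by transfer (rule blinfun.bounded_linear_right)

lemma bop_scaleC: "bop_apply T (c *\<^sub>C x) = c *\<^sub>C bop_apply T x"
  by transfer simp

lemma norm_bop: "norm (bop_apply T x) \<le> norm T * norm x"
  by transfer (rule norm_blinfun)

lemma norm_bop_bound: "0 \<le> b \<Longrightarrow> (\<And>x. norm (bop_apply T x) \<le> b * norm x) \<Longrightarrow> norm T \<le> b"
  by transfer (rule norm_blinfun_bound)

lemma ex_bop:
  fixes f :: "'h::chilbert_space \<Rightarrow> 'h"
  assumes "\<And>x y. f (x + y) = f x + f y" "\<And>c x. f (c *\<^sub>C x) = c *\<^sub>C f x" "\<And>x. norm (f x) \<le> b * norm x"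
  shows "\<exists>T. bop_apply T = f"
proof -
  have "bounded_linear f"
    by (rule bounded_linear_intro[of _ b])
      (simp_all add: assms(1,3) mult.commute[of _ b] flip: scaleC_of_real, simp add: assms(2))
  then have "bop_apply (Bop (Blinfun f)) = f"
    unfolding bop_apply_def by (simp add: Bop_inverse bounded_linear_Blinfun_apply assms(2))
  then show ?thesis by blast
qed

lemma bop_apply_simps [simp]:
  fixes S T :: "'h::chilbert_space bop"
  shows bop_zero: "(0 :: 'h bop) x = 0"
    and bop_plus: "(S + T) x = S x + T x"
    and bop_diff: "(S - T) x = S x - T x"
    and bop_uminus: "(- S) x = - S x"
    and bop_scaleR_left: "(r *\<^sub>R S) x = r *\<^sub>R S x"
    and bop_scaleC_left: "(c *\<^sub>C S) x = c *\<^sub>C S x"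
    and bop_one: "(1 :: 'h bop) x = x"
    and bop_times: "(S * T) x = S (T x)"
        apply (transfer, simp)
       apply (transfer, simp add: blinfun.add_left)
      apply (transfer, simp add: blinfun.diff_left)
     apply (transfer, simp add: blinfun.minus_left)
    apply (transfer, simp add: blinfun.scaleR_left)
   apply (transfer, simp add: bounded_linear_Blinfun_apply bounded_linear_scaleC)
  by (transfer, simp)+

lemma bop_right [simp]:
  fixes T :: "'h::chilbert_space bop"
  shows bop_zero_right: "T 0 = 0"
    and bop_add_right: "T (x + y) = T x + T y"
    and bop_diff_right: "T (x - y) = T x - T y"
    and bop_scaleR_right: "T (r *\<^sub>R x) = r *\<^sub>R T x"
  using bounded_linear_bop[of T]
  by (simp_all add: linear_0 linear_add linear_diff linear_scale bounded_linear.linear)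

lemma bop_sum: "(\<Sum>i\<in>I. T i) x = (\<Sum>i\<in>I. T i x)" for T :: "'i \<Rightarrow> 'h::chilbert_space bop"
  by (induction I rule: infinite_finite_induct) auto

lemma bop_sum_right: "T (\<Sum>i\<in>I. x i) = (\<Sum>i\<in>I. T (x i))" for T :: "'h::chilbert_space bop"
  by (induction I rule: infinite_finite_induct) auto

lemma cinner_zero [simp]: "cinner 0 x = 0" "cinner x 0 = 0" for x :: "'a::chilbert_space"
  using cinner_scaleC_left[of 0 0 x] cinner_scaleC_right[of x 0 0] by simp_all

lemma scaleC_zero_left [simp]: "0 *\<^sub>C x = 0" for x :: "'a::complex_vector"
  using scaleC_of_real[of 0 x] by simp

lemma cinner_scaleR: "cinner (r *\<^sub>R x) y = of_real r * cinner x y" "cinner x (r *\<^sub>R y) = of_real r * cinner x y"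
  for x :: "'a::chilbert_space"
  by (simp_all only: scaleC_of_real[symmetric] cinner_scaleC_left cinner_scaleC_right complex_cnj_complex_of_real)

lemma cinner_minus: "cinner (- x) y = - cinner x y" "cinner x (- y) = - cinner x y"
  for x :: "'a::chilbert_space"
  using cinner_add_left[of "-x" x y] cinner_add_right[of x "- y" y]
  by (simp_all add: eq_neg_iff_add_eq_0)

lemma cinner_diff_left: "cinner (x - y) z = cinner x z - cinner y z"
  and cinner_diff_right: "cinner z (x - y) = cinner z x - cinner z y"
  for x :: "'a::chilbert_space"
  using cinner_add_left[of x "- y" z] cinner_add_right[of z x "- y"] by (simp_all add: cinner_minus)

lemma cinner_sum_left: "cinner (\<Sum>i\<in>I. f i) y = (\<Sum>i\<in>I. cinner (f i) y)"
  and cinner_sum_right: "cinner y (\<Sum>i\<in>I. f i) = (\<Sum>i\<in>I. cinner y (f i))"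
  for y :: "'a::chilbert_space"
  by (induction I rule: infinite_finite_induct) (auto simp: cinner_add_left cinner_add_right)

lemma cinner_eqI: "(\<And>z. cinner z x = cinner z y) \<Longrightarrow> x = y" for x y :: "'a::chilbert_space"
proof -
  assume "\<And>z. cinner z x = cinner z y"
  then have "cinner (x - y) (x - y) = 0" by (simp add: cinner_diff_right)
  then show ?thesis by (simp add: cinner_self)
qed

text \<open>Riesz gives \<open>S y\<close> for each y separately; linearity follows by testing
  against all vectors, and the bound from ||S y||^2 = Re <T S y, y>.\<close>

lemma ex_adj: "\<exists>S. \<forall>x y. cinner (T x) y = cinner x (bop_apply S y)"
  for T :: "'h::chilbert_space bop"
proof -
  have "\<exists>z. \<forall>x. cinner (T x) y = cinner x z" for y
  proof (rule Riesz)
    show "bounded_linear (\<lambda>x. cinner (T x) y)"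
    proof (rule bounded_linear_intro[of _ "norm T * norm y"])
      fix x :: 'h and r :: real
      show "cinner (T (r *\<^sub>R x)) y = r *\<^sub>R cinner (T x) y"
        by (simp add: cinner_scaleR scaleR_conv_of_real)
      have "cmod (cinner (T x) y) \<le> norm (T x) * norm y" by (rule norm_cinner_le)
      also have "\<dots> \<le> (norm T * norm x) * norm y" by (intro mult_right_mono norm_bop) simp
      finally show "cmod (cinner (T x) y) \<le> norm x * (norm T * norm y)" by (simp add: mult_ac)
    qed (simp add: cinner_add_left)
  qed (simp add: bop_scaleC cinner_scaleC_left)
  then obtain S where S: "\<And>x y. cinner (T x) y = cinner x (S y)" by metis
  have "\<exists>S'. bop_apply S' = S"
  proof (rule ex_bop)
    show "S (x + y) = S x + S y" for x y
      by (rule cinner_eqI) (simp add: S[symmetric] cinner_add_right)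
    show "S (c *\<^sub>C x) = c *\<^sub>C S x" for c x
      by (rule cinner_eqI) (simp add: S[symmetric] cinner_scaleC_right)
    show "norm (S x) \<le> norm T * norm x" for x
    proof (cases "S x = 0")
      case False
      have "(norm (S x))\<^sup>2 = Re (cinner (T (S x)) x)" unfolding S cinner_self by simp
      also have "\<dots> \<le> norm (T (S x)) * norm x" by (rule Re_cinner_le)
      also have "\<dots> \<le> (norm T * norm (S x)) * norm x" by (intro mult_right_mono norm_bop) simp
      finally show ?thesis using False by (simp add: power2_eq_square mult_ac)
    qed simp
  qed
  then show ?thesis using S by metis
qed

text \<open>Existence and uniqueness together turn the \<open>THE\<close> in \<open>adj\<close> into
  a usable identity.\<close>

lemma cinner_adj: "cinner (T x) y = cinner x (adj T y)" for T :: "'h::chilbert_space bop"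
proof -
  obtain S :: "'h bop" where S: "\<forall>x y. cinner (T x) y = cinner x (S y)" using ex_adj by blast
  have "\<forall>x y. cinner (T x) y = cinner x (adj T y)"
    unfolding adj_def
  proof (rule theI[where P = "\<lambda>S. \<forall>x y. cinner (T x) y = cinner x (bop_apply S y)"], rule S)
    fix S' :: "'h bop" assume "\<forall>x y. cinner (T x) y = cinner x (S' y)"
    then show "S' = S" using S by - (rule bop_eqI, rule cinner_eqI, metis)
  qed
  then show ?thesis by blast
qed

lemma adj_eqI: "(\<And>x y. cinner (T x) y = cinner x (S y)) \<Longrightarrow> adj T = S"
  for S T :: "'h::chilbert_space bop"
  by (rule bop_eqI, rule cinner_eqI) (metis cinner_adj)

lemma cinner_adj': "cinner (adj T x) y = cinner x (T y)" for T :: "'h::chilbert_space bop"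
  by (metis cinner_adj cinner_commute)

lemma inner_adj: "inner (T x) y = inner x (adj T y)" "inner (adj T x) y = inner x (T y)"
  for T :: "'h::chilbert_space bop"
  by (simp_all only: inner_eq_Re_cinner cinner_adj' cinner_adj[of T])

lemma adj_adj [simp]: "adj (adj T) = T" for T :: "'h::chilbert_space bop"
  by (rule adj_eqI) (rule cinner_adj')

lemma adj_add: "adj (S + T) = adj S + adj T" for S T :: "'h::chilbert_space bop"
  by (rule adj_eqI) (simp add: cinner_add_left cinner_add_right cinner_adj)

lemma adj_zero [simp]: "adj (0 :: 'h::chilbert_space bop) = 0"
  by (rule adj_eqI) simp

lemma adj_sum: "adj (\<Sum>i\<in>I. T i) = (\<Sum>i\<in>I. adj (T i))" for T :: "'i \<Rightarrow> 'h::chilbert_space bop"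
  by (induction I rule: infinite_finite_induct) (simp_all add: adj_add)

lemma adj_scaleR: "adj (r *\<^sub>R T) = r *\<^sub>R adj T" for T :: "'h::chilbert_space bop"
  by (rule adj_eqI) (simp add: cinner_scaleR cinner_adj)

lemma adj_mult: "adj (S * T) = adj T * adj S" for S T :: "'h::chilbert_space bop"
  by (rule adj_eqI) (simp add: cinner_adj)

lemma adj_one [simp]: "adj (1 :: 'h::chilbert_space bop) = 1"
  by (rule adj_eqI) simp

lemma norm_adj_le: "norm (adj T) \<le> norm T" for T :: "'h::chilbert_space bop"
proof (rule norm_bop_bound)
  fix x
  show "norm (adj T x) \<le> norm T * norm x"
  proof (cases "adj T x = 0")
    case False
    have "(norm (adj T x))\<^sup>2 = inner (T (adj T x)) x" by (simp add: inner_adj power2_norm_eq_inner)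
    also have "\<dots> \<le> norm (T (adj T x)) * norm x" by (rule norm_cauchy_schwarz)
    also have "\<dots> \<le> (norm T * norm (adj T x)) * norm x" by (intro mult_right_mono norm_bop) simp
    finally show ?thesis using False by (simp add: power2_eq_square mult_ac)
  qed simp
qed simp

text \<open>Complex linearity survives pointwise limits, so these operators are closed among the
  bounded real-linear ones. Completeness lets the series in \<open>poisson_kernel\<close> converge
  once their norms are summable.\<close>

instance bop :: (chilbert_space) banach
proof
  fix X :: "nat \<Rightarrow> 'a bop" assume X: "Cauchy X"
  have dist: "dist (blinfun_of_bop S) (blinfun_of_bop T) = dist S T" for S T :: "'a bop"
    by (simp add: dist_norm norm_bop.rep_eq minus_bop.rep_eq)
  have "Cauchy (\<lambda>n. blinfun_of_bop (X n))" using X by (simp add: Cauchy_def dist)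
  then obtain L where L: "(\<lambda>n. blinfun_of_bop (X n)) \<longlonglongrightarrow> L"
    using Cauchy_convergent_iff convergent_def by blast
  have lim: "(\<lambda>n. X n x) \<longlonglongrightarrow> L x" for x
    unfolding bop_apply.rep_eq by (intro blinfun.tendsto L tendsto_const)
  have "L (c *\<^sub>C x) = c *\<^sub>C L x" for c x
    using lim[of "c *\<^sub>C x"] bounded_linear.tendsto[OF bounded_linear_scaleC lim[of x], of c]
    unfolding bop_scaleC by (rule LIMSEQ_unique)
  then have "blinfun_of_bop (Bop L) = L" by (simp add: Bop_inverse)
  then have "X \<longlonglongrightarrow> Bop L" using L unfolding tendsto_dist_iff[of _ L] tendsto_dist_iff[of _ "Bop L"]
    by (simp add: dist[symmetric])
  then show "convergent X" by (rule convergentI)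
qed

section \<open>Rows of operators\<close>

lemma sum_norm_adj_le:
  fixes Y :: "'i \<Rightarrow> 'h::chilbert_space bop"
  assumes "finite I"
  shows "(\<Sum>i\<in>I. (norm (adj (Y i) h))\<^sup>2) \<le> norm (\<Sum>i\<in>I. Y i * adj (Y i)) * (norm h)\<^sup>2"
proof -
  have "(\<Sum>i\<in>I. (norm (adj (Y i) h))\<^sup>2) = inner ((\<Sum>i\<in>I. Y i * adj (Y i)) h) h"
    by (simp add: bop_sum inner_sum_left inner_adj power2_norm_eq_inner)
  also have "\<dots> \<le> norm ((\<Sum>i\<in>I. Y i * adj (Y i)) h) * norm h" by (rule norm_cauchy_schwarz)
  also have "\<dots> \<le> (norm (\<Sum>i\<in>I. Y i * adj (Y i)) * norm h) * norm h"
    by (intro mult_right_mono norm_bop) simp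
  finally show ?thesis by (simp add: power2_eq_square mult_ac)
qed

text \<open>A bound for the column of adjoints passes to the row: pair the sum with itself, move
  each \<open>Y i\<close> across and apply Cauchy-Schwarz.\<close>

lemma norm_row_le:
  fixes Y :: "'i \<Rightarrow> 'h::chilbert_space bop"
  assumes "0 \<le> c" and col: "\<And>h. (\<Sum>i\<in>I. (norm (adj (Y i) h))\<^sup>2) \<le> c * (norm h)\<^sup>2"
  shows "(norm (\<Sum>i\<in>I. Y i (x i)))\<^sup>2 \<le> c * (\<Sum>i\<in>I. (norm (x i))\<^sup>2)"
proof -
  define y where "y = (\<Sum>i\<in>I. Y i (x i))"
  define s where "s = (\<Sum>i\<in>I. (norm (x i))\<^sup>2)"
  have "(norm y)\<^sup>2 = (\<Sum>i\<in>I. inner (x i) (adj (Y i) y))"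
    unfolding power2_norm_eq_inner y_def by (subst inner_sum_left) (simp add: inner_adj)
  also have "\<dots> \<le> (\<Sum>i\<in>I. \<bar>norm (x i)\<bar> * \<bar>norm (adj (Y i) y)\<bar>)"
    by (intro sum_mono) (simp add: norm_cauchy_schwarz)
  also have "\<dots> \<le> L2_set (\<lambda>i. norm (x i)) I * L2_set (\<lambda>i. norm (adj (Y i) y)) I"
    by (rule L2_set_mult_ineq)
  also have "\<dots> = sqrt (s * (\<Sum>i\<in>I. (norm (adj (Y i) y))\<^sup>2))"
    by (simp add: L2_set_def s_def real_sqrt_mult)
  also have "\<dots> \<le> sqrt (s * (c * (norm y)\<^sup>2))"
    by (intro real_sqrt_le_mono mult_left_mono col) (simp add: s_def sum_nonneg)
  finally have "(norm y)\<^sup>2 \<le> sqrt (c * s) * norm y"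
    by (simp add: real_sqrt_mult mult_ac)
  then have "norm y \<le> sqrt (c * s)"
    using \<open>0 \<le> c\<close> by (cases "y = 0") (simp_all add: power2_eq_square s_def sum_nonneg)
  moreover have "0 \<le> c * s" using \<open>0 \<le> c\<close> by (simp add: s_def sum_nonneg)
  ultimately show ?thesis
    unfolding y_def[symmetric] s_def[symmetric] by (metis norm_ge_zero power_mono real_sqrt_pow2)
qed

text \<open>Applied to the column of the vectors \<open>adj (Y i) h\<close>, the row bound gives
  ||y||^2 \<le> c <y, h> for the image y of h.\<close>

lemma norm_sum_adj_le:
  fixes Y :: "'i \<Rightarrow> 'h::chilbert_space bop"
  assumes "0 \<le> c" and row: "\<And>x. (norm (\<Sum>i\<in>I. Y i (x i)))\<^sup>2 \<le> c * (\<Sum>i\<in>I. (norm (x i))\<^sup>2)"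
  shows "norm (\<Sum>i\<in>I. Y i * adj (Y i)) \<le> c"
proof (rule norm_bop_bound[OF \<open>0 \<le> c\<close>])
  fix h
  define y where "y = (\<Sum>i\<in>I. Y i * adj (Y i)) h"
  have "(norm y)\<^sup>2 \<le> c * (\<Sum>i\<in>I. (norm (adj (Y i) h))\<^sup>2)"
    using row[of "\<lambda>i. adj (Y i) h"] by (simp add: y_def bop_sum)
  also have "(\<Sum>i\<in>I. (norm (adj (Y i) h))\<^sup>2) = inner y h"
    by (simp add: y_def bop_sum inner_sum_left inner_adj power2_norm_eq_inner)
  also have "c * \<dots> \<le> c * (norm y * norm h)"
    by (intro mult_left_mono norm_cauchy_schwarz assms)
  finally have "norm y * norm y \<le> norm y * (c * norm h)" by (simp add: power2_eq_square mult_ac)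
  then show "norm y \<le> c * norm h"
    using \<open>0 \<le> c\<close> by (cases "y = 0") auto
qed

section \<open>Words and levels\<close>

lemma word_op_simps [simp]:
  "word_op X [] = 1"
  "word_op X (i # \<alpha>) = X i * word_op X \<alpha>"
  "word_op X (\<alpha> @ \<beta>) = word_op X \<alpha> * word_op X \<beta>"
  by (simp_all add: word_op_def)

lemma word_op_scaleR: "word_op (\<lambda>i. r *\<^sub>R X i) \<alpha> = r ^ length \<alpha> *\<^sub>R word_op X \<alpha>"
  by (induction \<alpha>) simp_all

lemma finite_words [simp]: "finite {\<alpha> :: 'n::finite list. length \<alpha> = k}"
  using finite_lists_length_eq[of "UNIV :: 'n set" k] by simp

lemma finite_words_le [simp]: "finite {\<alpha> :: 'n::finite list. length \<alpha> \<le> k}"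
  using finite_lists_length_le[of "UNIV :: 'n set" k] by simp

lemma finite_words_less [simp]: "finite {\<alpha> :: 'n::finite list. length \<alpha> < k}"
  by (rule finite_subset[OF _ finite_words_le[of k]]) auto

lemma sum_words_add:
  "(\<Sum>\<alpha> | length \<alpha> = k + l. f \<alpha>) = (\<Sum>\<alpha> | length \<alpha> = k. \<Sum>\<beta> | length \<beta> = l. f (\<alpha> @ \<beta>))"
  for f :: "'n::finite list \<Rightarrow> 'b::comm_monoid_add"
  unfolding sum.cartesian_product
  by (rule sum.reindex_bij_witness[of _ "\<lambda>(\<alpha>, \<beta>). \<alpha> @ \<beta>" "\<lambda>\<alpha>. (take k \<alpha>, drop k \<alpha>)"]) auto

text \<open>Squared norm of the row of all words of length k; its root of order 2k is the sequence
  in \<open>joint_spectral_radius\<close>.\<close>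

definition level_norm :: "('n::finite \<Rightarrow> 'h::chilbert_space bop) \<Rightarrow> nat \<Rightarrow> real" where
  "level_norm X k = norm (\<Sum>\<alpha> | length \<alpha> = k. word_op X \<alpha> * adj (word_op X \<alpha>))"

lemma level_norm_nonneg: "0 \<le> level_norm X k"
  by (simp add: level_norm_def)

lemma level_row_le:
  "(norm (\<Sum>\<alpha> | length \<alpha> = k. word_op X \<alpha> (x \<alpha>)))\<^sup>2 \<le> level_norm X k * (\<Sum>\<alpha> | length \<alpha> = k. (norm (x \<alpha>))\<^sup>2)"
  unfolding level_norm_def by (intro norm_row_le sum_norm_adj_le finite_words norm_ge_zero)

text \<open>Words are cut after k letters, and the column estimate is applied to the tail and then
  to the head.\<close>

lemma level_norm_add: "level_norm X (k + l) \<le> level_norm X k * level_norm X l"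
proof -
  have "(\<Sum>\<alpha> | length \<alpha> = k + l. (norm (adj (word_op X \<alpha>) h))\<^sup>2) \<le> (level_norm X k * level_norm X l) * (norm h)\<^sup>2" for h
  proof -
    have "(\<Sum>\<alpha> | length \<alpha> = k + l. (norm (adj (word_op X \<alpha>) h))\<^sup>2)
        = (\<Sum>\<alpha> | length \<alpha> = k. \<Sum>\<beta> | length \<beta> = l. (norm (adj (word_op X \<beta>) (adj (word_op X \<alpha>) h)))\<^sup>2)"
      by (simp add: sum_words_add adj_mult)
    also have "\<dots> \<le> (\<Sum>\<alpha> | length \<alpha> = k. level_norm X l * (norm (adj (word_op X \<alpha>) h))\<^sup>2)"
      unfolding level_norm_def by (intro sum_mono sum_norm_adj_le finite_words)
    also have "\<dots> \<le> level_norm X l * (level_norm X k * (norm h)\<^sup>2)"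
      unfolding sum_distrib_left[symmetric]
      by (intro mult_left_mono level_norm_nonneg) (simp add: level_norm_def sum_norm_adj_le)
    finally show ?thesis by (simp add: mult_ac)
  qed
  then show ?thesis
    unfolding level_norm_def[of X "k + l"]
    by (intro norm_sum_adj_le norm_row_le mult_nonneg_nonneg level_norm_nonneg)
qed

section \<open>Submultiplicative sequences and the joint spectral radius\<close>

lemma submult_iterate:
  fixes a :: "nat \<Rightarrow> real"
  assumes "\<And>k. 0 \<le> a k" "\<And>k l. a (k + l) \<le> a k * a l"
  shows "a (q * m + s) \<le> a m ^ q * a s"
proof (induction q)
  case (Suc q)
  have "a (Suc q * m + s) \<le> a m * a (q * m + s)" using assms(2)[of m "q * m + s"] by (simp add: add_ac)
  also have "\<dots> \<le> a m * (a m ^ q * a s)" by (intro mult_left_mono Suc assms)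
  finally show ?case by (simp add: mult_ac)
qed simp

text \<open>Fekete's lemma in multiplicative form, the limit being the infimum of the roots. Writing
  k = q m + s, the finitely many remainders s contribute a bounded factor, whose k-th root tends to
  1.\<close>

lemma submult_root_convergent:
  fixes a :: "nat \<Rightarrow> real"
  assumes nonneg: "\<And>k. 0 \<le> a k" and sub: "\<And>k l. a (k + l) \<le> a k * a l"
    and ge1: "\<And>k. 1 \<le> k \<Longrightarrow> 1 \<le> a k"
  shows "convergent (\<lambda>k. root k (a k))"
proof -
  define b where "b k = root k (a k)" for k
  have b1: "1 \<le> b k" if "k \<ge> 1" for k
    using that ge1[OF that] by (simp add: b_def)
  define L where "L = Inf (b ` {1..})"
  have bdd: "bdd_below (b ` {1..})" by (rule bdd_belowI[of _ 1]) (use b1 in auto)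
  have L_le: "L \<le> b k" if "k \<ge> 1" for k
    unfolding L_def by (rule cInf_lower[OF _ bdd]) (use that in auto)
  have L1: "1 \<le> L" unfolding L_def by (rule cInf_greatest) (use b1 in auto)
  have "b \<longlonglongrightarrow> L"
  proof (rule order_tendstoI)
    fix x assume "x < L"
    then show "\<forall>\<^sub>F k in sequentially. x < b k"
      using L_le by (intro eventually_sequentiallyI[of 1]) (meson order.strict_trans2)
  next
    fix x assume "L < x"
    then obtain y where y: "L < y" "y < x" using dense by blast
    obtain m where m: "m \<ge> 1" "b m < y"
      using cInf_lessD[of "b ` {1..}" y] y(1) by (auto simp: L_def)
    have y1: "1 < y" using y L1 by simp
    have am: "a m \<le> y ^ m"
    proof -
      have "a m = b m ^ m" using m by (simp add: b_def nonneg)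
      also have "\<dots> \<le> y ^ m" using m b1[of m] by (intro power_mono) auto
      finally show ?thesis .
    qed
    \<comment> \<open>Bounds all remainder terms; the summand 1 makes \<open>M\<close> positive, so
      that its roots tend to 1.\<close>
    define M where "M = 1 + (\<Sum>s<m. a s)"
    have M: "a s \<le> M" if "s < m" for s
      using member_le_sum[of s "{..<m}" a] that nonneg by (simp add: M_def)
    have M1: "M \<ge> 1" by (simp add: M_def sum_nonneg nonneg)
    have le: "b k \<le> y * root k M" if "k \<ge> 1" for k
    proof -
      have "a k \<le> a m ^ (k div m) * a (k mod m)"
        using submult_iterate[of a "k div m" m "k mod m"] nonneg sub by simp
      also have "\<dots> \<le> (y ^ m) ^ (k div m) * M"
        using m M[of "k mod m"] am y1 nonneg by (intro mult_mono power_mono) auto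
      also have "(y ^ m) ^ (k div m) \<le> y ^ k"
        using y1 by (auto simp: power_mult[symmetric] intro!: power_increasing)
      finally have "a k \<le> y ^ k * M" using M1 by (simp add: mult_right_mono)
      then have "root k (a k) \<le> root k (y ^ k * M)" using that by simp
      also have "\<dots> = y * root k M" using that y1 by (simp add: real_root_mult real_root_power_cancel)
      finally show ?thesis by (simp add: b_def)
    qed
    have "(\<lambda>k. y * root k M) \<longlonglongrightarrow> y * 1"
      using M1 by (intro tendsto_intros LIMSEQ_root_const) simp
    then have "\<forall>\<^sub>F k in sequentially. y * root k M < x" using y by (intro order_tendstoD) auto
    then show "\<forall>\<^sub>F k in sequentially. b k < x"
      using eventually_ge_at_top[of 1] by eventually_elim (use le in force)
  qed
  then show ?thesis unfolding b_def by (rule convergentI)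
qed

text \<open>A single term below 1 already forces geometric decay.\<close>

lemma submult_summable:
  fixes b :: "nat \<Rightarrow> real"
  assumes nonneg: "\<And>k. 0 \<le> b k" and sub: "\<And>k l. b (k + l) \<le> b k * b l"
    and m: "1 \<le> m" "b m < 1"
  shows "summable b"
proof -
  \<comment> \<open>Strictly between 0 and 1 even if \<open>b m\<close> is 0, so that the ratio
    \<open>q\<close> is positive and division by \<open>c\<close> is harmless.\<close>
  define c where "c = (1 + b m) / 2"
  have c: "0 < c" "c < 1" "b m \<le> c" using m nonneg[of m] by (simp_all add: c_def)
  define q where "q = root m c"
  have q: "0 < q" "q < 1" "q ^ m = c" using c m by (simp_all add: q_def)
  define M where "M = (\<Sum>s<m. b s)"
  have M: "b s \<le> M" if "s < m" for s
    using member_le_sum[of s "{..<m}" b] that nonneg by (simp add: M_def)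
  have M0: "0 \<le> M" by (simp add: M_def sum_nonneg nonneg)
  have le: "b k \<le> M / c * q ^ k" for k
  proof -
    have "b k \<le> b m ^ (k div m) * b (k mod m)"
      using submult_iterate[of b "k div m" m "k mod m"] nonneg sub by simp
    also have "\<dots> \<le> c ^ (k div m) * M"
      using m M[of "k mod m"] c nonneg by (intro mult_mono power_mono) auto
    also have "c ^ (k div m) \<le> q ^ k / c"
    proof -
      have "q ^ m \<le> q ^ (k mod m)" using q m by (intro power_decreasing) auto
      then have "c ^ (k div m) * c \<le> q ^ (m * (k div m)) * q ^ (k mod m)"
        unfolding power_mult q(3) using c by (intro mult_left_mono) auto
      also have "\<dots> = q ^ k" by (simp add: power_add[symmetric])
      finally show ?thesis using c by (simp add: field_simps)
    qed
    finally show ?thesis using M0 by (simp add: mult_right_mono mult_ac)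
  qed
  show ?thesis
    by (rule summable_comparison_test'[of "\<lambda>k. M / c * q ^ k" 0])
      (use le nonneg q in \<open>auto intro!: summable_mult summable_geometric\<close>)
qed

text \<open>\<open>sqrt (level_norm X k)\<close> bounds the degree k part of the kernel, so this
  yields absolute convergence of both series. It is the only consequence of r(X) < 1 used
  below.\<close>

definition decaying :: "('n::finite \<Rightarrow> 'h::chilbert_space bop) \<Rightarrow> bool" where
  "decaying X \<longleftrightarrow> summable (\<lambda>k. sqrt (level_norm X k))"

text \<open>\<open>lim\<close> is unspecified for divergent sequences, so the definition alone says
  nothing about the levels. If no level norm of positive length were below 1, the roots would
  converge by Fekete's lemma, to a limit at least 1, and the radius would be that limit. Hence some
  level is below 1, which gives summability.\<close>

lemma spectral_ball_decaying:
  assumes "X \<in> spectral_ball"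
  shows "decaying X"
proof -
  let ?a = "level_norm X"
  have "\<exists>m\<ge>1. ?a m < 1"
  proof (rule ccontr)
    assume "\<not> ?thesis"
    then have ge1: "1 \<le> ?a k" if "1 \<le> k" for k using that by force
    have "convergent (\<lambda>k. root k (?a k))"
      by (rule submult_root_convergent[OF level_norm_nonneg level_norm_add ge1])
    then obtain L where L: "(\<lambda>k. root k (?a k)) \<longlonglongrightarrow> L" by (auto simp: convergent_def)
    have "(\<lambda>k. sqrt (root k (?a k))) \<longlonglongrightarrow> sqrt L" by (intro tendsto_intros L)
    also have "(\<lambda>k. sqrt (root k (?a k))) = (\<lambda>k. root (2 * k) (?a k))"
      by (simp add: sqrt_def real_root_mult_exp)
    finally have lim: "(\<lambda>k. root (2 * k) (?a k)) \<longlonglongrightarrow> sqrt L" .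
    have "1 \<le> sqrt L"
      by (rule LIMSEQ_le_const[OF lim]) (use ge1 in \<open>auto intro!: exI[of _ 1]\<close>)
    moreover have "joint_spectral_radius X = sqrt L"
      using limI[OF lim] by (simp add: joint_spectral_radius_def level_norm_def)
    ultimately show False using assms by (simp add: spectral_ball_def)
  qed
  then obtain m where m: "m \<ge> 1" "?a m < 1" by blast
  show ?thesis
    unfolding decaying_def
  proof (rule submult_summable[OF _ _ m(1)])
    show "sqrt (?a (k + l)) \<le> sqrt (?a k) * sqrt (?a l)" for k l
      using level_norm_add[of X k l] by (simp add: real_sqrt_mult[symmetric])
  qed (use m level_norm_nonneg in auto)
qed

section \<open>Vectors and operators on the \<open>\<ell>\<^sup>2\<close> spaces\<close>

lemma ell2_nth_simps [simp]:
  "ell2_nth 0 j = 0" "ell2_nth (f + g) j = ell2_nth f j + ell2_nth g j"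
  "ell2_nth (f - g) j = ell2_nth f j - ell2_nth g j"
  "ell2_nth (- f) j = - ell2_nth f j" "ell2_nth (c *\<^sub>C f) j = c *\<^sub>C ell2_nth f j"
  "ell2_nth (r *\<^sub>R f) j = r *\<^sub>R ell2_nth f j"
  "ell2_nth (h \<otimes>\<^sub>v u) j = ell2_nth u j *\<^sub>C h"
  by (transfer, simp)+

lemma ell2_nth_sum: "ell2_nth (\<Sum>i\<in>I. f i) j = (\<Sum>i\<in>I. ell2_nth (f i) j)"
  by (induction I rule: infinite_finite_induct) simp_all

lemma ell2_eqI: "(\<And>j. ell2_nth f j = ell2_nth g j) \<Longrightarrow> f = g"
  by (metis ell2_nth_inject ext)

lemma ex_ell2:
  assumes "\<And>F. finite F \<Longrightarrow> (\<Sum>j\<in>F. (norm (f j))\<^sup>2) \<le> c"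
  shows "\<exists>g. ell2_nth g = (f :: 'j \<Rightarrow> 'h::chilbert_space)"
proof -
  have "(\<lambda>j. (norm (f j))\<^sup>2) summable_on UNIV"
    using assms by (intro nonneg_bdd_above_summable_on bdd_aboveI[of _ c]) auto
  then show ?thesis using Ell2_inverse[of f] by blast
qed

lemma norm_ell2_le:
  assumes "0 \<le> c" "\<And>F. finite F \<Longrightarrow> (\<Sum>j\<in>F. (norm (ell2_nth f j))\<^sup>2) \<le> c\<^sup>2"
  shows "norm f \<le> c"
proof -
  have "(norm f)\<^sup>2 \<le> c\<^sup>2"
    using ell2_nth[of f] assms
    by (auto simp: norm_ell2_def infsum_nonneg intro!: infsum_le_finite_sums)
  then show ?thesis using \<open>0 \<le> c\<close> by (simp add: power2_le_iff_abs_le)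
qed

section \<open>Coordinate vectors, tensors and finite restrictions\<close>

lift_definition ell2_single :: "'j \<Rightarrow> 'h::chilbert_space \<Rightarrow> ('j, 'h) ell2" is
  "\<lambda>a h j. if j = a then h else 0"
proof -
  fix a :: 'j and h :: 'h
  have "(\<lambda>j. (norm (if j = a then h else 0))\<^sup>2) summable_on {a}"
    by (rule summable_on_finite) simp
  then show "(\<lambda>j. (norm (if j = a then h else 0))\<^sup>2) summable_on UNIV"
    by (rule summable_on_cong_neutral[THEN iffD1, rotated -1]) auto
qed

lemma ell2_nth_single: "ell2_nth (ell2_single a h) j = (if j = a then h else 0)"
  by transfer simp

lemma ell2_single_eq_tensor: "ell2_single a h = h \<otimes>\<^sub>v ell2_single a 1"
  by (rule ell2_eqI) (simp add: ell2_nth_single)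

lemma fock_basis_eq_single: "fock_basis \<alpha> = ell2_single \<alpha> 1"
  by transfer (simp add: fun_eq_iff)

lemma cinner_single_left: "cinner (ell2_single a h) f = cinner h (ell2_nth f a)"
proof -
  have "cinner (ell2_single a h) f = (\<Sum>\<^sub>\<infinity>j. cinner (if j = a then h else 0) (ell2_nth f j))"
    unfolding cinner_ell2_def by transfer simp
  also have "\<dots> = (\<Sum>\<^sub>\<infinity>j\<in>{a}. cinner h (ell2_nth f j))"
    by (rule infsum_cong_neutral) auto
  finally show ?thesis by simp
qed

lemma cinner_single_right: "cinner f (ell2_single a h) = cinner (ell2_nth f a) h"
  by (metis cinner_commute cinner_single_left)

text \<open>Adjoints replace a density argument: coordinates of \<open>adj S g\<close> are read off
  by testing against \<open>ell2_single\<close>, so the adjoints agree and with them the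
  operators.\<close>

lemma bop_ell2_eqI:
  fixes S T :: "('j, 'h::chilbert_space) ell2 bop"
  assumes "\<And>a h. S (ell2_single a h) = T (ell2_single a h)"
  shows "S = T"
proof (rule bop_eqI, rule cinner_eqI)
  fix f g :: "('j, 'h) ell2"
  have "adj S g = adj T g"
  proof (rule ell2_eqI, rule cinner_eqI)
    fix a h
    have "cinner (ell2_single a h) (adj S g) = cinner (ell2_single a h) (adj T g)"
      by (simp add: cinner_adj[symmetric] assms)
    then show "cinner h (ell2_nth (adj S g) a) = cinner h (ell2_nth (adj T g) a)"
      by (simp add: cinner_single_left)
  qed
  then show "cinner g (S f) = cinner g (T f)" by (simp add: cinner_adj'[symmetric])
qed

lemma adj_ell2_eqI:
  fixes S T :: "('j, 'h::chilbert_space) ell2 bop"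
  assumes "\<And>a h b k. cinner (T (ell2_single a h)) (ell2_single b k) = cinner (ell2_single a h) (S (ell2_single b k))"
  shows "adj T = S"
proof (rule bop_ell2_eqI)
  fix b k
  show "adj T (ell2_single b k) = S (ell2_single b k)"
  proof (rule ell2_eqI, rule cinner_eqI)
    fix a h
    show "cinner h (ell2_nth (adj T (ell2_single b k)) a) = cinner h (ell2_nth (S (ell2_single b k)) a)"
      using assms[of a h b k] by (simp add: cinner_adj cinner_single_left)
  qed
qed

text \<open>Each \<open>ell2_single a h\<close> is an elementary tensor, so the values on elementary
  tensors determine the operator and the \<open>THE\<close> in \<open>tensor_op\<close> is
  justified.\<close>

lemma tensor_op_eqI:
  assumes "\<And>h f. bop_apply W (h \<otimes>\<^sub>v f) = bop_apply S h \<otimes>\<^sub>v bop_apply T f"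
  shows "S \<otimes>\<^sub>o T = W"
  unfolding tensor_op_def
proof (rule the_equality)
  show "\<forall>h f. W (h \<otimes>\<^sub>v f) = S h \<otimes>\<^sub>v T f" using assms by blast
next
  fix W' assume W': "\<forall>h f. bop_apply W' (h \<otimes>\<^sub>v f) = S h \<otimes>\<^sub>v T f"
  show "W' = W"
  proof (rule bop_ell2_eqI)
    fix a h
    show "W' (ell2_single a h) = W (ell2_single a h)"
      unfolding ell2_single_eq_tensor[of a h] using W' assms by simp
  qed
qed

definition ell2_restrict :: "'j set \<Rightarrow> ('j, 'h::chilbert_space) ell2 \<Rightarrow> ('j, 'h) ell2" where
  "ell2_restrict F f = (\<Sum>j\<in>F. ell2_single j (ell2_nth f j))"

lemma cinner_restrict_left: "cinner (ell2_restrict F f) g = (\<Sum>j\<in>F. cinner (ell2_nth f j) (ell2_nth g j))"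
  by (simp add: ell2_restrict_def cinner_sum_left cinner_single_left)

lemma ell2_nth_restrict: "finite F \<Longrightarrow> ell2_nth (ell2_restrict F f) j = (if j \<in> F then ell2_nth f j else 0)"
  by (simp add: ell2_restrict_def ell2_nth_sum ell2_nth_single)

lemma cinner_restrict_self:
  "finite F \<Longrightarrow> cinner (ell2_restrict F f) (ell2_restrict F f) = cinner (ell2_restrict F f) f"
  by (simp add: cinner_restrict_left ell2_nth_restrict)

lemma norm_restrict: "finite F \<Longrightarrow> (norm (ell2_restrict F f))\<^sup>2 = (\<Sum>j\<in>F. (norm (ell2_nth f j))\<^sup>2)"
  by (simp add: power2_norm_eq_inner inner_eq_Re_cinner cinner_restrict_left ell2_nth_restrict)

lemma norm_le_of_restrict:
  assumes "0 \<le> c" "\<And>F. finite F \<Longrightarrow> norm (ell2_restrict F f) \<le> c"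
  shows "norm f \<le> c"
  by (rule norm_ell2_le[OF assms(1)])
    (use assms in \<open>simp add: norm_restrict[symmetric] power_mono\<close>)

lemma cmod_self_le_imp_norm_le:
  fixes x :: "'a::chilbert_space"
  assumes "cmod (cinner x x) \<le> norm x * c" "0 \<le> c"
  shows "norm x \<le> c"
  using assms by (cases "x = 0") (simp_all add: cinner_self power2_eq_square norm_mult)

text \<open>Finitely supported vectors detect the norm: the hypothesis bounds the adjoint on them
  first, and then \<open>T\<close> on every vector through the finite restrictions of
  \<open>T f\<close>.\<close>

lemma norm_bop_ell2_le:
  fixes T :: "('j, 'h::chilbert_space) ell2 bop"
  assumes "0 \<le> c"
    and "\<And>F f g. finite F \<Longrightarrow> cmod (cinner (T (ell2_restrict F f)) (ell2_restrict F g))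
        \<le> c * norm (ell2_restrict F f) * norm (ell2_restrict F g)"
  shows "norm T \<le> c"
proof (rule norm_bop_bound[OF assms(1)])
  fix f
  have two: "cmod (cinner (T (ell2_restrict F f)) (ell2_restrict G g)) \<le> c * norm (ell2_restrict F f) * norm (ell2_restrict G g)"
    if "finite F" "finite G" for F G f g
  proof -
    have "ell2_restrict (F \<union> G) (ell2_restrict F f) = ell2_restrict F f"
      "ell2_restrict (F \<union> G) (ell2_restrict G g) = ell2_restrict G g"
      using that by (auto intro!: ell2_eqI simp: ell2_nth_restrict)
    then show ?thesis using assms(2)[of "F \<union> G" "ell2_restrict F f" "ell2_restrict G g"] that by simp
  qed
  have one: "norm (adj T (ell2_restrict G g)) \<le> c * norm (ell2_restrict G g)" if "finite G" for G g
  proof (rule norm_le_of_restrict)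
    fix F :: "'j set" assume F: "finite F"
    let ?x = "ell2_restrict F (adj T (ell2_restrict G g))"
    have "cinner ?x ?x = cinner (T ?x) (ell2_restrict G g)"
      unfolding cinner_restrict_self[OF F] cinner_adj[of T] ..
    then show "norm ?x \<le> c * norm (ell2_restrict G g)"
      using two[OF F that, of "adj T (ell2_restrict G g)" g] assms(1)
      by - (rule cmod_self_le_imp_norm_le, simp_all add: mult_ac)
  qed (use assms in simp)
  show "norm (T f) \<le> c * norm f"
  proof (rule norm_le_of_restrict)
    fix F :: "'j set" assume F: "finite F"
    let ?x = "ell2_restrict F (T f)"
    have "cinner ?x ?x = cinner (adj T ?x) f"
      unfolding cinner_restrict_self[OF F] cinner_adj' ..
    then have "cmod (cinner ?x ?x) \<le> norm (adj T ?x) * norm f" by (simp add: norm_cinner_le)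
    also have "\<dots> \<le> (c * norm ?x) * norm f" by (intro mult_right_mono one F) simp
    finally show "norm ?x \<le> c * norm f"
      using assms(1) by - (rule cmod_self_le_imp_norm_le, simp_all add: mult_ac)
  qed (use assms in simp)
qed

section \<open>Weighted shifts along partial injections\<close>

text \<open>Injectivity where defined prevents a coordinate from being used twice, which keeps the
  induced map on \<open>ell2\<close> bounded.\<close>

definition partial_inj :: "('j \<Rightarrow> 'j option) \<Rightarrow> bool" where
  "partial_inj \<pi> \<longleftrightarrow> (\<forall>a b c. \<pi> a = Some c \<longrightarrow> \<pi> b = Some c \<longrightarrow> a = b)"

text \<open>One construction for both kinds of terms in the kernel: \<open>S\<close> tensored with
  the adjoint of a creation operator when \<pi> is a \<open>snoc_map\<close>, and with a creation
  operator when it is a \<open>strip_map\<close>.\<close>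

definition shift_op :: "('j \<Rightarrow> 'j option) \<Rightarrow> 'h::chilbert_space bop \<Rightarrow> ('j, 'h) ell2 bop" where
  "shift_op \<pi> S = (SOME W. \<forall>f j. ell2_nth (bop_apply W f) j =
     (case \<pi> j of None \<Rightarrow> 0 | Some k \<Rightarrow> S (ell2_nth f k)))"

lemma ell2_nth_shift_op:
  fixes S :: "'h::chilbert_space bop"
  assumes "partial_inj \<pi>"
  shows "ell2_nth (shift_op \<pi> S f) j = (case \<pi> j of None \<Rightarrow> 0 | Some k \<Rightarrow> S (ell2_nth f k))"
proof -
  define w where "w f j = (case \<pi> j of None \<Rightarrow> 0 | Some k \<Rightarrow> S (ell2_nth f k))" for f j
  have bound: "(\<Sum>j\<in>F. (norm (w f j))\<^sup>2) \<le> (norm S * norm f)\<^sup>2" if F: "finite F" for F f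
  proof -
    let ?D = "{j\<in>F. \<pi> j \<noteq> None}"
    have inj: "inj_on (\<lambda>j. the (\<pi> j)) ?D"
      using assms by (auto simp: inj_on_def partial_inj_def)
    have "(\<Sum>j\<in>F. (norm (w f j))\<^sup>2) = (\<Sum>j\<in>?D. (norm (w f j))\<^sup>2)"
      using F by (intro sum.mono_neutral_right) (auto simp: w_def)
    also have "\<dots> \<le> (\<Sum>j\<in>?D. (norm S)\<^sup>2 * (norm (ell2_nth f (the (\<pi> j))))\<^sup>2)"
      by (intro sum_mono) (auto simp: w_def power_mult_distrib[symmetric] intro!: power_mono norm_bop)
    also have "\<dots> = (norm S)\<^sup>2 * (\<Sum>k\<in>(\<lambda>j. the (\<pi> j)) ` ?D. (norm (ell2_nth f k))\<^sup>2)"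
      unfolding sum.reindex[OF inj] sum_distrib_left o_def ..
    also have "\<dots> \<le> (norm S)\<^sup>2 * (norm f)\<^sup>2"
      using F by (intro mult_left_mono finite_sum_le_norm_ell2) auto
    finally show ?thesis by (simp add: power_mult_distrib)
  qed
  have "\<exists>g. ell2_nth g = w f" for f using ex_ell2[OF bound] by blast
  then obtain W where W: "\<And>f. ell2_nth (W f) = w f" by metis
  have "\<exists>W'. bop_apply W' = W"
  proof (rule ex_bop)
    show "W (x + y) = W x + W y" for x y
      by (rule ell2_eqI) (simp add: W w_def split: option.split)
    show "W (c *\<^sub>C x) = c *\<^sub>C W x" for c x
      by (rule ell2_eqI) (simp add: W w_def bop_scaleC split: option.split)
    show "norm (W x) \<le> norm S * norm x" for x
      by (rule norm_ell2_le) (simp_all add: W bound)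
  qed
  then have "\<exists>W. \<forall>f j. ell2_nth (bop_apply W f) j = (case \<pi> j of None \<Rightarrow> 0 | Some k \<Rightarrow> S (ell2_nth f k))"
    using W by (metis w_def)
  from someI_ex[OF this] show ?thesis unfolding shift_op_def by blast
qed

lemma tensor_shift_op:
  assumes "partial_inj \<pi>"
  shows "S \<otimes>\<^sub>o shift_op \<pi> 1 = shift_op \<pi> S"
  by (rule tensor_op_eqI, rule ell2_eqI)
    (simp add: ell2_nth_shift_op[OF assms] bop_scaleC split: option.split)

lemma tensor_one: "1 \<otimes>\<^sub>o 1 = (1 :: ('j, 'h::chilbert_space) ell2 bop)"
  by (rule tensor_op_eqI) simp

section \<open>Shifts by words on the Fock space\<close>

definition snoc_map :: "'n list \<Rightarrow> 'n list \<Rightarrow> 'n list option" where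
  "snoc_map \<alpha> \<beta> = Some (\<beta> @ \<alpha>)"

definition strip_map :: "'n list \<Rightarrow> 'n list \<Rightarrow> 'n list option" where
  "strip_map \<alpha> \<beta> = (if \<exists>\<gamma>. \<beta> = \<gamma> @ \<alpha> then Some (SOME \<gamma>. \<beta> = \<gamma> @ \<alpha>) else None)"

lemma snoc_map_eq_Some [simp]: "snoc_map \<alpha> \<beta> = Some \<gamma> \<longleftrightarrow> \<gamma> = \<beta> @ \<alpha>"
  by (auto simp: snoc_map_def)

lemma strip_map_eq_Some [simp]: "strip_map \<alpha> \<beta> = Some \<gamma> \<longleftrightarrow> \<beta> = \<gamma> @ \<alpha>"
  by (auto simp: strip_map_def)

lemma partial_inj_snoc [simp]: "partial_inj (snoc_map \<alpha>)"
  and partial_inj_strip [simp]: "partial_inj (strip_map \<alpha>)"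
  by (auto simp: partial_inj_def)

lemma shift_op_single:
  assumes "partial_inj \<pi>"
  shows "ell2_nth (shift_op \<pi> S (ell2_single a h)) b = (if \<pi> b = Some a then S h else 0)"
  by (simp add: ell2_nth_shift_op[OF assms] ell2_nth_single split: option.split)

lemma strip_op_single: "shift_op (strip_map \<alpha>) S (ell2_single a h) = ell2_single (a @ \<alpha>) (S h)"
  by (rule ell2_eqI) (simp add: shift_op_single ell2_nth_single)

lemma adj_snoc_op: "adj (shift_op (snoc_map \<alpha>) S) = shift_op (strip_map \<alpha>) (adj S)"
  by (rule adj_ell2_eqI)
    (auto simp: cinner_single_left cinner_single_right shift_op_single cinner_adj)

lemma adj_strip_op: "adj (shift_op (strip_map \<alpha>) S) = shift_op (snoc_map \<alpha>) (adj S)"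
  by (metis adj_adj adj_snoc_op)

lemma right_creation_eq: "right_creation i = shift_op (strip_map [i]) 1"
  unfolding right_creation_def
proof (rule the_equality)
  show "\<forall>\<alpha>. shift_op (strip_map [i]) 1 (fock_basis \<alpha>) = fock_basis (\<alpha> @ [i])"
    by (simp add: fock_basis_eq_single strip_op_single)
next
  fix R :: "'a fock bop" assume R: "\<forall>\<alpha>. R (fock_basis \<alpha>) = fock_basis (\<alpha> @ [i])"
  show "R = shift_op (strip_map [i]) 1"
  proof (rule bop_ell2_eqI)
    fix a and h :: complex
    have *: "ell2_single b h = h *\<^sub>C fock_basis b" for b
      by (rule ell2_eqI) (simp add: fock_basis_eq_single ell2_nth_single scaleC_complex_def)
    show "R (ell2_single a h) = shift_op (strip_map [i]) 1 (ell2_single a h)"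
      using R by (simp add: strip_op_single) (simp add: * bop_scaleC)
  qed
qed

text \<open>The last factor of a product acts first, so reversing \<alpha> makes the creation
  operators append its letters in reading order.\<close>

lemma word_op_right_creation: "word_op right_creation (rev \<alpha>) = shift_op (strip_map \<alpha>) 1"
proof (induction \<alpha>)
  case Nil
  then show ?case by (intro bop_ell2_eqI) (simp add: strip_op_single)
next
  case (Cons i \<alpha>)
  then show ?case by (intro bop_ell2_eqI) (simp add: strip_op_single right_creation_eq)
qed

section \<open>Matrix coefficients of the kernel\<close>

text \<open>Homogeneous part of degree k in the first series of the kernel; its adjoint is the
  corresponding part of the second.\<close>

definition level_op :: "('n::finite \<Rightarrow> 'h::chilbert_space bop) \<Rightarrow> nat \<Rightarrow> ('n list, 'h) ell2 bop" where
  "level_op X k = (\<Sum>\<alpha> | length \<alpha> = k. shift_op (snoc_map \<alpha>) (word_op X \<alpha>))"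

lemma ell2_nth_level_op: "ell2_nth (level_op X k f) \<beta> = (\<Sum>\<alpha> | length \<alpha> = k. word_op X \<alpha> (ell2_nth f (\<beta> @ \<alpha>)))"
  by (simp add: level_op_def bop_sum ell2_nth_sum ell2_nth_shift_op) (simp add: snoc_map_def)

lemma norm_level_op_le: "norm (level_op X k) \<le> sqrt (level_norm X k)"
proof (rule norm_bop_bound)
  fix f
  show "norm (level_op X k f) \<le> sqrt (level_norm X k) * norm f"
  proof (rule norm_ell2_le)
    fix F :: "'a list set" assume F: "finite F"
    \<comment> \<open>The length of \<alpha> is fixed, so a word splits in at most one way and no
      coordinate of \<open>f\<close> is counted twice.\<close>
    have inj: "inj_on (\<lambda>(\<beta>, \<alpha>). \<beta> @ \<alpha>) (F \<times> {\<alpha>. length \<alpha> = k})"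
      by (auto simp: inj_on_def)
    have "(\<Sum>\<beta>\<in>F. (norm (ell2_nth (level_op X k f) \<beta>))\<^sup>2)
        \<le> (\<Sum>\<beta>\<in>F. level_norm X k * (\<Sum>\<alpha> | length \<alpha> = k. (norm (ell2_nth f (\<beta> @ \<alpha>)))\<^sup>2))"
      unfolding ell2_nth_level_op by (intro sum_mono level_row_le)
    also have "\<dots> = level_norm X k * (\<Sum>\<gamma>\<in>(\<lambda>(\<beta>, \<alpha>). \<beta> @ \<alpha>) ` (F \<times> {\<alpha>. length \<alpha> = k}). (norm (ell2_nth f \<gamma>))\<^sup>2)"
      unfolding sum.reindex[OF inj] sum_distrib_left[symmetric] sum.cartesian_product
      by (simp add: case_prod_beta o_def)
    also have "\<dots> \<le> level_norm X k * (norm f)\<^sup>2"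
      using F by (intro mult_left_mono finite_sum_le_norm_ell2 level_norm_nonneg) auto
    finally show "(\<Sum>\<beta>\<in>F. (norm (ell2_nth (level_op X k f) \<beta>))\<^sup>2) \<le> (sqrt (level_norm X k) * norm f)\<^sup>2"
      by (simp add: power_mult_distrib level_norm_nonneg)
  qed (simp add: level_norm_nonneg)
qed (simp add: level_norm_nonneg)

lemma poisson_kernel_eq:
  "poisson_kernel X = (\<Sum>k. level_op X (Suc k)) + 1 + (\<Sum>k. adj (level_op X (Suc k)))"
  unfolding poisson_kernel_def level_op_def adj_sum adj_snoc_op
  by (simp add: adj_strip_op word_op_right_creation tensor_shift_op tensor_one)

lemma bounded_linear_coefficient: "bounded_linear (\<lambda>T :: 'a::chilbert_space bop. cinner (T x) y)"
proof (rule bounded_linear_intro[of _ "norm x * norm y"])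
  fix T :: "'a bop"
  have "cmod (cinner (T x) y) \<le> norm (T x) * norm y" by (rule norm_cinner_le)
  also have "\<dots> \<le> (norm T * norm x) * norm y" by (intro mult_right_mono norm_bop) simp
  finally show "norm (cinner (T x) y) \<le> norm T * (norm x * norm y)" by (simp add: mult_ac)
qed (simp_all add: cinner_add_left cinner_scaleR scaleR_conv_of_real)

lemma level_op_coefficient:
  "cinner (level_op X k (ell2_single a h)) (ell2_single b v) =
    (if \<exists>\<gamma>. length \<gamma> = k \<and> a = b @ \<gamma> then cinner (word_op X (drop (length b) a) h) v else 0)"
proof -
  have "cinner (level_op X k (ell2_single a h)) (ell2_single b v)
      = (\<Sum>\<alpha> | length \<alpha> = k. if a = b @ \<alpha> then cinner (word_op X \<alpha> h) v else 0)"
    by (auto simp: cinner_single_right ell2_nth_level_op ell2_nth_single cinner_sum_left intro!: sum.cong)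
  also have "\<dots> = (if \<exists>\<gamma>. length \<gamma> = k \<and> a = b @ \<gamma> then cinner (word_op X (drop (length b) a) h) v else 0)"
  proof (cases "\<exists>\<gamma>. length \<gamma> = k \<and> a = b @ \<gamma>")
    case True
    then obtain \<gamma> where \<gamma>: "length \<gamma> = k" "a = b @ \<gamma>" by blast
    then show ?thesis by simp
  qed (auto intro!: sum.neutral)
  finally show ?thesis .
qed

lemma adj_level_op_coefficient:
  "cinner (adj (level_op X k) (ell2_single a h)) (ell2_single b v) =
    (if \<exists>\<gamma>. length \<gamma> = k \<and> b = a @ \<gamma> then cinner h (word_op X (drop (length a) b) v) else 0)"
proof -
  have "cinner (adj (level_op X k) (ell2_single a h)) (ell2_single b v)
     = cnj (cinner (level_op X k (ell2_single b v)) (ell2_single a h))"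
    by (simp add: cinner_adj' cinner_commute[symmetric])
  then show ?thesis unfolding level_op_coefficient if_distrib[of cnj] cinner_commute[symmetric] complex_cnj_zero .
qed

text \<open>Summation commutes with taking a coefficient, and each series contributes in at most one
  degree. The entry depends only on the word by which one index extends the other.\<close>

lemma poisson_coefficient:
  assumes "decaying X"
  shows "cinner (poisson_kernel X (ell2_single a h)) (ell2_single b v) =
    (if \<exists>\<gamma>. a = b @ \<gamma> then cinner (word_op X (drop (length b) a) h) v
     else if \<exists>\<gamma>. b = a @ \<gamma> then cinner h (word_op X (drop (length a) b) v) else 0)"
proof -
  let ?c = "\<lambda>T. cinner (bop_apply T (ell2_single a h)) (ell2_single b v)"
  have "summable (\<lambda>k. sqrt (level_norm X (Suc k)))"
    using assms summable_Suc_iff[of "\<lambda>k. sqrt (level_norm X k)"] by (simp add: decaying_def)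
  note * = summable_comparison_test'[OF this, of 0]
  have sum: "summable (\<lambda>k. level_op X (Suc k))" "summable (\<lambda>k. adj (level_op X (Suc k)))"
    by (rule *, rule norm_level_op_le) (rule *, rule order_trans[OF norm_adj_le norm_level_op_le])
  have "?c (\<Sum>k. level_op X (Suc k)) = (\<Sum>k. ?c (level_op X (Suc k)))"
    "?c (\<Sum>k. adj (level_op X (Suc k))) = (\<Sum>k. ?c (adj (level_op X (Suc k))))"
    by (rule bounded_linear.suminf[OF bounded_linear_coefficient] sum)+
  \<comment> \<open>The series starts in degree 1, so a word of length k + 1 sits at index k. If a
    is no proper extension of b, every term vanishes and the truncated subtraction does no
    harm.\<close>
  moreover have "(\<Sum>k. ?c (level_op X (Suc k))) = (\<Sum>k\<in>{length a - Suc (length b)}. ?c (level_op X (Suc k)))"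
    by (rule suminf_finite) (auto simp: level_op_coefficient)
  moreover have "(\<Sum>k. ?c (adj (level_op X (Suc k)))) = (\<Sum>k\<in>{length b - Suc (length a)}. ?c (adj (level_op X (Suc k))))"
    by (rule suminf_finite) (auto simp: adj_level_op_coefficient)
  ultimately have "?c (poisson_kernel X) = ?c (level_op X (Suc (length a - Suc (length b))))
      + cinner (ell2_single a h) (ell2_single b v) + ?c (adj (level_op X (Suc (length b - Suc (length a)))))"
    unfolding poisson_kernel_eq by (simp add: cinner_add_left)
  moreover consider "a = b" | \<gamma> where "a = b @ \<gamma>" "\<gamma> \<noteq> []" | \<gamma> where "b = a @ \<gamma>" "\<gamma> \<noteq> []"
    | "\<nexists>\<gamma>. a = b @ \<gamma>" "\<nexists>\<gamma>. b = a @ \<gamma>"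
    by (metis append_Nil2)
  then have "?c (level_op X (Suc (length a - Suc (length b))))
      + cinner (ell2_single a h) (ell2_single b v) + ?c (adj (level_op X (Suc (length b - Suc (length a)))))
      = (if \<exists>\<gamma>. a = b @ \<gamma> then cinner (word_op X (drop (length b) a) h) v
     else if \<exists>\<gamma>. b = a @ \<gamma> then cinner h (word_op X (drop (length a) b) v) else 0)"
    by cases (auto simp: level_op_coefficient adj_level_op_coefficient cinner_single_left ell2_nth_single
        Suc_diff_Suc length_greater_0_conv[symmetric] simp del: length_greater_0_conv)
  ultimately show ?thesis by simp
qed

section \<open>Gram matrices and partial isometries\<close>

lemma sum_insert_square:
  fixes f :: "'i \<Rightarrow> 'i \<Rightarrow> 'b::comm_monoid_add"
  assumes "finite F" "x \<notin> F"
  shows "(\<Sum>a\<in>insert x F. \<Sum>b\<in>insert x F. f a b)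
    = f x x + (\<Sum>b\<in>F. f x b) + (\<Sum>a\<in>F. f a x) + (\<Sum>a\<in>F. \<Sum>b\<in>F. f a b)"
  using assms by (simp add: sum.distrib add_ac)

text \<open>Induction on the index set. A zero pivot at x forces its row to vanish; a positive pivot
  is removed by the Schur complement, whose form is the full form minimised over the entry at
  x.\<close>

lemma Cholesky:
  fixes G :: "'i \<Rightarrow> 'i \<Rightarrow> complex"
  assumes "finite I"
    and "\<And>a b. a \<in> I \<Longrightarrow> b \<in> I \<Longrightarrow> G b a = cnj (G a b)"
    and "\<And>c. 0 \<le> Re (\<Sum>a\<in>I. \<Sum>b\<in>I. c a * cnj (c b) * G a b)"
  shows "\<exists>L :: 'i \<Rightarrow> nat \<Rightarrow> complex. \<forall>a\<in>I. \<forall>b\<in>I. G a b = (\<Sum>l<card I. L a l * cnj (L b l))"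
  using assms
proof (induction I arbitrary: G rule: finite_induct)
  case (insert x F)
  note herm = insert.prems(1) and psd = insert.prems(2)
  define g where "g = Re (G x x)"
  have Gxx: "G x x = of_real g"
    using herm[of x x] by (simp add: g_def complex_eq_iff)
  \<comment> \<open>The form with entry t at \<open>x\<close> left free; the choice of t decides
    both cases below.\<close>
  have form: "0 \<le> Re (t * cnj t * g + t * (\<Sum>b\<in>F. cnj (c b) * G x b) + cnj t * (\<Sum>a\<in>F. c a * G a x)
      + (\<Sum>a\<in>F. \<Sum>b\<in>F. c a * cnj (c b) * G a b))" for t c
  proof -
    define c' where "c' = c(x := t)"
    have c': "c' x = t" "\<And>a. a \<in> F \<Longrightarrow> c' a = c a"
      using insert.hyps by (auto simp: c'_def)
    have "(\<Sum>a\<in>insert x F. \<Sum>b\<in>insert x F. c' a * cnj (c' b) * G a b) =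
      t * cnj t * g + t * (\<Sum>b\<in>F. cnj (c b) * G x b) + cnj t * (\<Sum>a\<in>F. c a * G a x)
      + (\<Sum>a\<in>F. \<Sum>b\<in>F. c a * cnj (c b) * G a b)"
      unfolding sum_insert_square[OF insert.hyps] sum_distrib_left
      by (simp add: c' Gxx mult_ac cong: sum.cong)
    then show ?thesis using psd[of c'] by simp
  qed
  have g0: "0 \<le> g" using form[of 1 "\<lambda>_. 0"] by simp
  show ?case
  proof (cases "g = 0")
    case True
    have zero: "G x b = 0" if "b \<in> F" for b
    proof (rule ccontr)
      assume nz: "G x b \<noteq> 0"
      define z where "z = G x b"
      have "G b x = cnj z" using herm[of x b] that by (simp add: z_def)
      have pos: "0 \<le> Re (t * z + cnj t * cnj z + G b b)" for t
      proof -
        have "(\<Sum>b'\<in>F. cnj (if b' = b then 1 else 0) * G x b') = z"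
          "(\<Sum>a\<in>F. (if a = b then 1 else 0) * G a x) = cnj z"
          using insert.hyps that \<open>G b x = cnj z\<close>
          by (simp_all add: z_def if_distrib[of cnj] if_distrib[of "\<lambda>x. x * _"] cong: if_cong)
        moreover have "(\<Sum>a\<in>F. \<Sum>b'\<in>F. (if a = b then 1 else 0) * cnj (if b' = b then 1 else 0) * G a b')
            = (\<Sum>a\<in>F. if a = b then G a b else 0)"
          using insert.hyps that
          by (intro sum.cong) (simp_all add: if_distrib[of cnj] if_distrib[of "\<lambda>x. x * _"] cong: if_cong)
        then have "(\<Sum>a\<in>F. \<Sum>b'\<in>F. (if a = b then 1 else 0) * cnj (if b' = b then 1 else 0) * G a b') = G b b"
          using insert.hyps that by simp
        ultimately show ?thesis using form[of t "\<lambda>a. if a = b then 1 else 0"] True by simp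
      qed
      \<comment> \<open>Chosen so that t = -s cnj z gives the form the real part -1.\<close>
      define s where "s = (Re (G b b) + 1) / (2 * (cmod z)\<^sup>2)"
      have "0 \<le> Re (- of_real s * cnj z * z + cnj (- of_real s * cnj z) * cnj z + G b b)" by (rule pos)
      also have "- of_real s * cnj z * z + cnj (- of_real s * cnj z) * cnj z = of_real (- 2 * s * (cmod z)\<^sup>2)"
        unfolding of_real_mult complex_norm_square by (simp add: algebra_simps)
      also have "2 * s * (cmod z)\<^sup>2 = Re (G b b) + 1" using nz by (simp add: s_def z_def)
      then have "- 2 * s * (cmod z)\<^sup>2 = - Re (G b b) - 1" by simp
      finally show False by simp
    qed
    have zero': "G b x = 0" if "b \<in> F" for b using herm[of x b] zero[OF that] that by simp
    have "\<exists>L. \<forall>a\<in>F. \<forall>b\<in>F. G a b = (\<Sum>l<card F. L a l * cnj (L b l))"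
    proof (rule insert.IH)
      show "0 \<le> Re (\<Sum>a\<in>F. \<Sum>b\<in>F. c a * cnj (c b) * G a b)" for c using form[of 0 c] by simp
    qed (rule herm, simp_all)
    then obtain L where L: "\<And>a b. a \<in> F \<Longrightarrow> b \<in> F \<Longrightarrow> G a b = (\<Sum>l<card F. L a l * cnj (L b l))" by blast
    define L' where "L' a l = (if a = x \<or> l \<ge> card F then 0 else L a l)" for a l
    have "G a b = (\<Sum>l<card (insert x F). L' a l * cnj (L' b l))"
      if "a \<in> insert x F" "b \<in> insert x F" for a b
      using that insert.hyps True zero zero' Gxx L by (auto simp: L'_def intro!: sum.cong)
    then show ?thesis by blast
  next
    case False
    then have g: "g > 0" using g0 by simp
    define G' where "G' a b = G a b - G a x * G x b / g" for a b
    have "\<exists>L. \<forall>a\<in>F. \<forall>b\<in>F. G' a b = (\<Sum>l<card F. L a l * cnj (L b l))"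
    proof (rule insert.IH)
      show "G' b a = cnj (G' a b)" if "a \<in> F" "b \<in> F" for a b
        using that herm[of a b] herm[of a x] herm[of x b] by (simp add: G'_def)
      fix c
      define S where "S = (\<Sum>a\<in>F. c a * G a x)"
      have S': "(\<Sum>b\<in>F. cnj (c b) * G x b) = cnj S"
        unfolding S_def cnj_sum by (intro sum.cong) (simp_all add: herm[of _ x])
      have "(\<Sum>a\<in>F. \<Sum>b\<in>F. c a * cnj (c b) * G' a b)
          = (\<Sum>a\<in>F. \<Sum>b\<in>F. c a * cnj (c b) * G a b) - (\<Sum>a\<in>F. \<Sum>b\<in>F. (c a * G a x) * (cnj (c b) * G x b) / g)"
        by (simp add: G'_def algebra_simps sum_subtractf)
      also have "(\<Sum>a\<in>F. \<Sum>b\<in>F. (c a * G a x) * (cnj (c b) * G x b) / g) = S * cnj S / g"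
        unfolding S'[symmetric] unfolding S_def by (simp add: sum_product sum_divide_distrib)
      finally have 1: "(\<Sum>a\<in>F. \<Sum>b\<in>F. c a * cnj (c b) * G' a b)
          = (\<Sum>a\<in>F. \<Sum>b\<in>F. c a * cnj (c b) * G a b) - S * cnj S / g" .
      \<comment> \<open>The entry t = -S / g completes the square and leaves the form of the Schur
        complement.\<close>
      have "0 \<le> Re ((- S / g) * cnj (- S / g) * g + (- S / g) * cnj S + cnj (- S / g) * S
          + (\<Sum>a\<in>F. \<Sum>b\<in>F. c a * cnj (c b) * G a b))"
        using form[of "- S / g" c] unfolding S' S_def[symmetric] .
      also have "(- S / g) * cnj (- S / g) * g + (- S / g) * cnj S + cnj (- S / g) * S
          + (\<Sum>a\<in>F. \<Sum>b\<in>F. c a * cnj (c b) * G a b) = (\<Sum>a\<in>F. \<Sum>b\<in>F. c a * cnj (c b) * G' a b)"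
        unfolding 1 using g by (simp add: field_simps)
      finally show "0 \<le> Re (\<Sum>a\<in>F. \<Sum>b\<in>F. c a * cnj (c b) * G' a b)" .
    qed
    then obtain L where L: "\<And>a b. a \<in> F \<Longrightarrow> b \<in> F \<Longrightarrow> G' a b = (\<Sum>l<card F. L a l * cnj (L b l))" by blast
    \<comment> \<open>The new column restores the product that the Schur complement subtracted; the
      row of \<open>x\<close> has no other nonzero entry among the columns in use.\<close>
    define L' where "L' a l = (if l = card F then G a x / sqrt g else if a = x then 0 else L a l)" for a l
    have sq: "complex_of_real (sqrt g) * complex_of_real (sqrt g) = of_real g"
      using g by (simp flip: of_real_mult)
    have "G a b = (\<Sum>l<card (insert x F). L' a l * cnj (L' b l))"
      if ab: "a \<in> insert x F" "b \<in> insert x F" for a b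
    proof -
      have "(\<Sum>l<card (insert x F). L' a l * cnj (L' b l))
          = (\<Sum>l<card F. if a = x \<or> b = x then 0 else L a l * cnj (L b l)) + G a x * G x b / g"
        using insert.hyps herm[of b x] ab g
        by (simp add: L'_def sq) (auto intro!: sum.cong)
      also have "\<dots> = G a b"
      proof (cases "a = x \<or> b = x")
        case True
        then show ?thesis using g by (auto simp: Gxx)
      next
        case False
        then show ?thesis using ab L[of a b, symmetric] by (simp add: G'_def)
      qed
      finally show ?thesis by simp
    qed
    then show ?thesis by blast
  qed
qed simp

text \<open>Gram-Schmidt for a possibly dependent family, so the coefficients need not be
  unique.\<close>

lemma ex_projection:
  fixes u :: "'i \<Rightarrow> 'k::chilbert_space"
  assumes "finite I"
  shows "\<exists>c. \<forall>b\<in>I. cinner (x - (\<Sum>a\<in>I. c a *\<^sub>C u a)) (u b) = 0"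
  using assms
proof (induction I arbitrary: x rule: finite_induct)
  case (insert z F)
  obtain c where c: "\<forall>b\<in>F. cinner (u z - (\<Sum>a\<in>F. c a *\<^sub>C u a)) (u b) = 0" using insert.IH by blast
  obtain d where d: "\<forall>b\<in>F. cinner (x - (\<Sum>a\<in>F. d a *\<^sub>C u a)) (u b) = 0" using insert.IH by blast
  define v where "v = u z - (\<Sum>a\<in>F. c a *\<^sub>C u a)"
  define y where "y = x - (\<Sum>a\<in>F. d a *\<^sub>C u a)"
  \<comment> \<open>If \<open>u z\<close> already lies in the span then \<open>v\<close> is 0, and t
    = 0 by the convention on division.\<close>
  define t where "t = cinner y v / cinner v v"
  define e where "e a = (if a = z then t else d a - t * c a)" for a
  have sub: "p *\<^sub>C w - q *\<^sub>C w = (p - q) *\<^sub>C w" for p q and w :: 'k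
    using scaleC_add_left[of "p - q" q w] by (simp add: algebra_simps)
  have "(\<Sum>a\<in>insert z F. e a *\<^sub>C u a) = t *\<^sub>C u z + (\<Sum>a\<in>F. d a *\<^sub>C u a - t *\<^sub>C c a *\<^sub>C u a)"
    using insert.hyps by (auto simp: e_def sub scaleC_scaleC intro!: sum.cong)
  also have "\<dots> = t *\<^sub>C (u z - (\<Sum>a\<in>F. c a *\<^sub>C u a)) + (\<Sum>a\<in>F. d a *\<^sub>C u a)"
    by (simp add: sum_subtractf bounded_linear.linear[OF bounded_linear_scaleC] linear_sum linear_diff)
  finally have eq: "x - (\<Sum>a\<in>insert z F. e a *\<^sub>C u a) = y - t *\<^sub>C v"
    by (simp add: v_def y_def algebra_simps)
  have F: "cinner (y - t *\<^sub>C v) (u b) = 0" if "b \<in> F" for b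
    using c d that by (simp add: cinner_diff_left cinner_scaleC_left v_def y_def)
  have "cinner (y - t *\<^sub>C v) v = 0"
    by (cases "v = 0") (simp_all add: cinner_diff_left cinner_scaleC_left t_def cinner_self)
  moreover have "cinner (y - t *\<^sub>C v) (\<Sum>a\<in>F. c a *\<^sub>C u a) = 0"
    by (simp add: cinner_sum_right cinner_scaleC_right F)
  ultimately have "cinner (y - t *\<^sub>C v) (v + (\<Sum>a\<in>F. c a *\<^sub>C u a)) = 0"
    unfolding cinner_add_right by simp
  then have "cinner (y - t *\<^sub>C v) (u z) = 0" by (simp add: v_def)
  then show ?case using F eq by (intro exI[of _ e]) simp
qed simp

lemma module_scaleC: "Modules.module (scaleC :: complex \<Rightarrow> 'a::complex_vector \<Rightarrow> 'a)"
  by standard (simp_all add: scaleC_add_left scaleC_add_right scaleC_scaleC)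

text \<open>Finitely many vectors never span, so a vector outside their span leaves a nonzero
  residue to be normalised.\<close>

lemma ex_orthonormal:
  assumes "infinite_dimensional TYPE('k::chilbert_space)"
  shows "\<exists>e :: nat \<Rightarrow> 'k. \<forall>i<n. \<forall>j<n. cinner (e i) (e j) = (if i = j then 1 else 0)"
proof (induction n)
  case (Suc n)
  then obtain e :: "nat \<Rightarrow> 'k" where e: "\<And>i j. i < n \<Longrightarrow> j < n \<Longrightarrow> cinner (e i) (e j) = (if i = j then 1 else 0)"
    by blast
  interpret cv: Modules.module "scaleC :: complex \<Rightarrow> 'k \<Rightarrow> 'k" by (rule module_scaleC)
  have "cv.span (e ` {..<n}) \<noteq> UNIV"
    using assms unfolding infinite_dimensional_def by blast
  then obtain x where x: "x \<notin> cv.span (e ` {..<n})" by blast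
  obtain c where c: "\<forall>b\<in>{..<n}. cinner (x - (\<Sum>a<n. c a *\<^sub>C e a)) (e b) = 0"
    using ex_projection[of "{..<n}" x e] by auto
  define v where "v = x - (\<Sum>a<n. c a *\<^sub>C e a)"
  have "(\<Sum>a<n. c a *\<^sub>C e a) \<in> cv.span (e ` {..<n})"
    by (intro cv.span_sum cv.span_scale cv.span_base) simp
  then have "v \<noteq> 0" using x by (auto simp: v_def)
  define w where "w = (1 / norm v) *\<^sub>R v"
  have w: "cinner w w = 1"
    using \<open>v \<noteq> 0\<close> by (simp add: cinner_self w_def)
  have we: "cinner w (e j) = 0" if "j < n" for j
    using c that by (simp add: w_def cinner_scaleR v_def)
  have ew: "cinner (e j) w = 0" if "j < n" for j
    using we[OF that] cinner_commute[of w "e j"] by simp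
  show ?case
    by (rule exI[of _ "\<lambda>i. if i = n then w else e i"]) (auto simp: less_Suc_eq e w we ew)
qed simp

lemma norm_sum_eq_of_Gram_eq:
  fixes u w :: "'i \<Rightarrow> 'k::chilbert_space"
  assumes "\<And>a b. a \<in> J \<Longrightarrow> b \<in> J \<Longrightarrow> cinner (w a) (w b) = cinner (u a) (u b)"
  shows "norm (\<Sum>a\<in>J. c a *\<^sub>C w a) = norm (\<Sum>a\<in>J. c a *\<^sub>C u a)"
proof -
  have "cinner (\<Sum>a\<in>J. c a *\<^sub>C w a) (\<Sum>a\<in>J. c a *\<^sub>C w a) = cinner (\<Sum>a\<in>J. c a *\<^sub>C u a) (\<Sum>a\<in>J. c a *\<^sub>C u a)"
    by (simp add: cinner_sum_left cinner_sum_right cinner_scaleC_left cinner_scaleC_right assms)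
  then have "(norm (\<Sum>a\<in>J. c a *\<^sub>C w a))\<^sup>2 = (norm (\<Sum>a\<in>J. c a *\<^sub>C u a))\<^sup>2"
    unfolding cinner_self of_real_eq_iff .
  then show ?thesis by simp
qed

text \<open>Equal Gram matrices make the map from combinations of the \<open>u a\<close> to those of
  the \<open>w a\<close> well defined and isometric; composed with the projection onto the span of
  the \<open>u a\<close> it acts everywhere. The description of the range later yields orthogonality
  of different ranges.\<close>

lemma ex_partial_isometry:
  fixes u w :: "'i \<Rightarrow> 'k::chilbert_space"
  assumes fin: "finite J" and Gram: "\<And>a b. a \<in> J \<Longrightarrow> b \<in> J \<Longrightarrow> cinner (w a) (w b) = cinner (u a) (u b)"
  shows "\<exists>X :: 'k bop. (\<forall>a\<in>J. X (u a) = w a) \<and>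
    (\<forall>x. \<exists>c. X x = (\<Sum>a\<in>J. c a *\<^sub>C w a) \<and> norm (X x) \<le> norm x)"
proof -
  have "\<forall>x. \<exists>c. \<forall>b\<in>J. cinner (x - (\<Sum>a\<in>J. c a *\<^sub>C u a)) (u b) = 0"
    using ex_projection[OF fin] by blast
  then obtain c where c: "\<And>x b. b \<in> J \<Longrightarrow> cinner (x - (\<Sum>a\<in>J. c x a *\<^sub>C u a)) (u b) = 0" by metis
  define W where "W x = (\<Sum>a\<in>J. c x a *\<^sub>C w a)" for x
  have sub: "(\<Sum>a\<in>J. (p a - q a) *\<^sub>C f a) = (\<Sum>a\<in>J. p a *\<^sub>C f a) - (\<Sum>a\<in>J. q a *\<^sub>C f a)" for p q and f :: "'i \<Rightarrow> 'k"
  proof -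
    have "(p a - q a) *\<^sub>C f a = p a *\<^sub>C f a - q a *\<^sub>C f a" for a
      using scaleC_add_left[of "p a - q a" "q a" "f a"] by (simp add: algebra_simps)
    then show ?thesis by (simp add: sum_subtractf)
  qed
  \<comment> \<open>The chosen coefficients need not be linear in x when the \<open>u a\<close> are
    dependent. Any admissible coefficients give the same value, and linearity of \<open>W\<close>
    follows from that.\<close>
  have W: "W x = (\<Sum>a\<in>J. d a *\<^sub>C w a)" if d: "\<And>b. b \<in> J \<Longrightarrow> cinner (x - (\<Sum>a\<in>J. d a *\<^sub>C u a)) (u b) = 0" for x d
  proof -
    define s where "s = (\<Sum>a\<in>J. (c x a - d a) *\<^sub>C u a)"
    have "cinner s (u b) = 0" if "b \<in> J" for b
      using c[OF that, of x] d[OF that] by (simp add: s_def sub cinner_diff_left)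
    then have "cinner s s = 0"
      by (subst (2) s_def) (simp add: cinner_sum_right cinner_scaleC_right)
    then have "norm s = 0" by (simp add: cinner_self)
    then have "norm (\<Sum>a\<in>J. (c x a - d a) *\<^sub>C w a) = 0"
      using norm_sum_eq_of_Gram_eq[OF Gram, where c = "\<lambda>a. c x a - d a"] by (simp add: s_def)
    then show ?thesis by (simp add: sub W_def)
  qed
  have bound: "norm (W x) \<le> norm x" for x
  proof -
    define s where "s = (\<Sum>a\<in>J. c x a *\<^sub>C u a)"
    have "cinner (x - s) s = 0"
      using c[of _ x] by (subst (2) s_def) (simp add: cinner_sum_right cinner_scaleC_right s_def)
    then have "inner (x - s) s = 0" by (simp add: inner_eq_Re_cinner)
    then have "(norm x)\<^sup>2 = (norm (x - s))\<^sup>2 + (norm s)\<^sup>2"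
      by (simp add: power2_norm_eq_inner inner_diff_left inner_diff_right inner_commute)
    then have "norm s \<le> norm x" by (simp add: power2_le_imp_le)
    then show ?thesis by (simp add: W_def s_def norm_sum_eq_of_Gram_eq[OF Gram])
  qed
  have "\<exists>X. bop_apply X = W"
  proof (rule ex_bop)
    show "norm (W x) \<le> 1 * norm x" for x using bound by simp
    show "W (x + y) = W x + W y" for x y
    proof -
      have "W (x + y) = (\<Sum>a\<in>J. (c x a + c y a) *\<^sub>C w a)"
        using c[of _ x] c[of _ y]
        by (intro W) (simp add: scaleC_add_left sum.distrib cinner_diff_left cinner_add_left)
      then show ?thesis by (simp add: W_def scaleC_add_left sum.distrib)
    qed
    show "W (t *\<^sub>C x) = t *\<^sub>C W x" for t x
    proof -
      have scale: "(\<Sum>a\<in>J. (t * c x a) *\<^sub>C f a) = t *\<^sub>C (\<Sum>a\<in>J. c x a *\<^sub>C f a)" for f :: "'i \<Rightarrow> 'k"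
        by (simp add: bounded_linear.linear[OF bounded_linear_scaleC] linear_sum scaleC_scaleC)
      have "W (t *\<^sub>C x) = (\<Sum>a\<in>J. (t * c x a) *\<^sub>C w a)"
        using c[of _ x] by (intro W) (simp add: scale cinner_diff_left cinner_scaleC_left right_diff_distrib[symmetric])
      then show ?thesis by (simp add: scale W_def)
    qed
  qed
  then obtain X where X: "bop_apply X = W" by blast
  have "W (u b) = w b" if "b \<in> J" for b
  proof -
    have delta: "(\<Sum>a\<in>J. (if a = b then 1 else 0) *\<^sub>C f a) = f b" for f :: "'i \<Rightarrow> 'k"
      using fin that by (simp add: if_distrib[of "\<lambda>x. x *\<^sub>C _"] cong: if_cong)
    show ?thesis by (subst W[where d = "\<lambda>a. if a = b then 1 else 0"]) (simp_all add: delta)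
  qed
  then show ?thesis using X bound by (intro exI[of _ X]) (auto simp: W_def)
qed

section \<open>Forms of operator matrices\<close>

definition opmat_form :: "'h::chilbert_space bop mat \<Rightarrow> (nat \<Rightarrow> 'h) \<Rightarrow> (nat \<Rightarrow> 'h) \<Rightarrow> complex" where
  "opmat_form P v w = (\<Sum>i<dim_row P. cinner (opmat_apply P v i) (w i))"

lemma opmat_form_expand:
  assumes "P \<in> carrier_mat m m"
  shows "opmat_form P v w = (\<Sum>i<m. \<Sum>j<m. cinner ((P $$ (i, j)) (v j)) (w i))"
  using assms by (simp add: opmat_form_def opmat_apply_def cinner_sum_left)

lemma opmat_Re_carrier [simp]: "P \<in> carrier_mat m m \<Longrightarrow> opmat_Re P \<in> carrier_mat m m"
  by (simp add: opmat_Re_def opmat_adj_def)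

lemma opmat_Re_index:
  assumes "P \<in> carrier_mat m m" "i < m" "j < m"
  shows "opmat_Re P $$ (i, j) = (1/2) *\<^sub>R (adj (P $$ (j, i)) + P $$ (i, j))"
  using assms by (simp add: opmat_Re_def opmat_adj_def)

lemma opmat_form_Re:
  assumes P: "P \<in> carrier_mat m m"
  shows "opmat_form (opmat_Re P) v w = (opmat_form P v w + cnj (opmat_form P w v)) / 2"
proof -
  have "cnj (opmat_form P w v) = (\<Sum>j<m. \<Sum>i<m. cinner (adj (P $$ (j, i)) (v j)) (w i))"
    unfolding opmat_form_expand[OF P] cnj_sum by (simp add: cinner_commute[symmetric] cinner_adj')
  also have "\<dots> = (\<Sum>i<m. \<Sum>j<m. cinner (adj (P $$ (j, i)) (v j)) (w i))" by (rule sum.swap)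
  finally have *: "cnj (opmat_form P w v) = (\<Sum>i<m. \<Sum>j<m. cinner (adj (P $$ (j, i)) (v j)) (w i))" .
  show ?thesis
    unfolding opmat_form_expand[OF opmat_Re_carrier[OF P]] * unfolding opmat_form_expand[OF P]
    by (simp add: opmat_Re_index[OF P] cinner_scaleR cinner_add_left sum.distrib[symmetric] sum_divide_distrib
        scaleR_add_right[symmetric] add_ac del: scaleR_add_right)
qed

lemma opmat_form_diff:
  assumes "P \<in> carrier_mat m m" "Q \<in> carrier_mat m m"
  shows "opmat_form (P - Q) v w = opmat_form P v w - opmat_form Q v w"
proof -
  have PQ: "P - Q \<in> carrier_mat m m" using carrier_matD[OF assms(2)] by (intro carrier_matI) (simp_all only: index_minus_mat)
  have "(P - Q) $$ (i, j) = P $$ (i, j) - Q $$ (i, j)" if "i < m" "j < m" for i j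
    using carrier_matD[OF assms(2)] that by (simp only: index_minus_mat)
  then show ?thesis
    unfolding opmat_form_expand[OF PQ] opmat_form_expand[OF assms(1)] opmat_form_expand[OF assms(2)]
    by (simp add: cinner_diff_left sum_subtractf)
qed

lemma opmat_nonneg_Re_iff:
  assumes P: "P \<in> carrier_mat m m"
  shows "opmat_nonneg (opmat_Re P) \<longleftrightarrow> (\<forall>v. 0 \<le> Re (opmat_form P v v))"
proof -
  have "opmat_form (opmat_Re P) v v = of_real (Re (opmat_form P v v))" for v
    unfolding opmat_form_Re[OF P] by (simp add: complex_add_cnj)
  then show ?thesis
    unfolding opmat_nonneg_def by (simp add: opmat_form_def[symmetric] Let_def)
qed

lemma nc_eval_carrier [simp]: "nc_eval m p A \<in> carrier_mat m m"
  by (simp add: nc_eval_def)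

lemma opmat_form_nc_eval:
  "opmat_form (nc_eval m p A) v w =
    (\<Sum>i<m. \<Sum>j<m. \<Sum>\<alpha> | p \<alpha> \<noteq> 0\<^sub>m m m. p \<alpha> $$ (i, j) * cinner (word_op A \<alpha> (v j)) (w i))"
  unfolding opmat_form_expand[OF nc_eval_carrier]
  by (simp add: nc_eval_def bop_sum cinner_sum_left cinner_scaleC_left)

lemma word_op_zero: "word_op (\<lambda>_. 0) \<alpha> = (if \<alpha> = [] then 1 else 0)"
  by (cases \<alpha>) simp_all

lemma adj_scaleC: "adj (c *\<^sub>C T) = cnj c *\<^sub>C adj T" for T :: "'h::chilbert_space bop"
  by (rule adj_eqI) (simp add: cinner_scaleC_left cinner_scaleC_right cinner_adj)

lemma nc_eval_zero_index:
  assumes "p \<in> nc_polynomials m" "i < m" "j < m"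
  shows "nc_eval m p (\<lambda>_. 0 :: 'k::chilbert_space bop) $$ (i, j) = p [] $$ (i, j) *\<^sub>C 1"
proof -
  have "nc_eval m p (\<lambda>_. 0 :: 'k bop) $$ (i, j) = (\<Sum>\<alpha> | p \<alpha> \<noteq> 0\<^sub>m m m. if \<alpha> = [] then p \<alpha> $$ (i, j) *\<^sub>C (1 :: 'k bop) else 0)"
    using assms by (auto simp: nc_eval_def word_op_zero intro!: sum.cong)
  also have "\<dots> = p [] $$ (i, j) *\<^sub>C 1"
    using assms by (auto simp: nc_polynomials_def)
  finally show ?thesis .
qed

text \<open>The normalisation is stated with operators on \<open>'k\<close>; a nonzero vector there
  turns it into a scalar identity for the constant coefficient, which can then be used on
  \<open>'h\<close>.\<close>

lemma opmat_Re_zero_iff: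
  assumes p: "p \<in> nc_polynomials m" and x: "(x :: 'k::chilbert_space) \<noteq> 0"
  shows "opmat_Re (nc_eval m p (\<lambda>_. 0 :: 'k bop)) = 1\<^sub>m m \<longleftrightarrow>
    (\<forall>i<m. \<forall>j<m. p [] $$ (i, j) + cnj (p [] $$ (j, i)) = (if i = j then 2 else 0))"
proof -
  have inj: "c *\<^sub>C (1 :: 'k bop) = d *\<^sub>C 1 \<longleftrightarrow> c = d" for c d
  proof
    assume "c *\<^sub>C (1 :: 'k bop) = d *\<^sub>C 1"
    then have "(c *\<^sub>C (1 :: 'k bop)) x = (d *\<^sub>C (1 :: 'k bop)) x" by simp
    then have "cinner (c *\<^sub>C x) x = cinner (d *\<^sub>C x) x" by simp
    then show "c = d" using x by (simp add: cinner_scaleC_left cinner_self)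
  qed simp
  let ?N = "nc_eval m p (\<lambda>_. 0 :: 'k bop)"
  have "opmat_Re ?N = 1\<^sub>m m \<longleftrightarrow> (\<forall>i<m. \<forall>j<m. opmat_Re ?N $$ (i, j) = (if i = j then 1 else 0))"
    using carrier_matD[OF opmat_Re_carrier[OF nc_eval_carrier, of m p "\<lambda>_. 0 :: 'k bop"]] by (auto intro!: eq_matI)
  also have "\<dots> \<longleftrightarrow> (\<forall>i<m. \<forall>j<m. p [] $$ (i, j) + cnj (p [] $$ (j, i)) = (if i = j then 2 else 0))"
  proof -
    have "opmat_Re ?N $$ (i, j) = (if i = j then 1 else 0) \<longleftrightarrow>
        p [] $$ (i, j) + cnj (p [] $$ (j, i)) = (if i = j then 2 else 0)" if "i < m" "j < m" for i j
    proof -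
      have "opmat_Re ?N $$ (i, j) = ((p [] $$ (i, j) + cnj (p [] $$ (j, i))) / 2) *\<^sub>C 1"
        using that p unfolding opmat_Re_index[OF nc_eval_carrier that] nc_eval_zero_index[OF p that]
          nc_eval_zero_index[OF p that(2,1)] adj_scaleC
        by (simp add: scaleC_of_real[symmetric] scaleC_add_left[symmetric] scaleC_add_right scaleC_scaleC add_ac add_divide_distrib)
      moreover have "(if i = j then 1 else 0) = (if i = j then 1 else 0) *\<^sub>C (1 :: 'k bop)" by simp
      ultimately show ?thesis using inj by (simp add: divide_eq_eq)
    qed
    then show ?thesis by blast
  qed
  finally show ?thesis .
qed

section \<open>Positive polynomials and Toeplitz kernels\<close>

lemma infinite_dimensional_nonzero:
  assumes "infinite_dimensional TYPE('k::chilbert_space)"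
  shows "\<exists>x::'k. x \<noteq> 0"
proof -
  obtain e :: "nat \<Rightarrow> 'k" where "cinner (e 0) (e 0) = 1"
    using ex_orthonormal[OF assms, of 1] by auto
  then have "e 0 \<noteq> 0" by auto
  then show ?thesis by blast
qed

text \<open>Infinite dimension supplies as many orthonormal vectors as the Cholesky factor has
  columns.\<close>

lemma ex_Gram_vectors:
  fixes G :: "'i \<Rightarrow> 'i \<Rightarrow> complex"
  assumes "infinite_dimensional TYPE('k::chilbert_space)" "finite I"
    and "\<And>a b. a \<in> I \<Longrightarrow> b \<in> I \<Longrightarrow> G b a = cnj (G a b)"
    and "\<And>c. 0 \<le> Re (\<Sum>a\<in>I. \<Sum>b\<in>I. c a * cnj (c b) * G a b)"
  shows "\<exists>k :: 'i \<Rightarrow> 'k. \<forall>a\<in>I. \<forall>b\<in>I. cinner (k a) (k b) = G a b"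
proof -
  obtain L where L: "\<forall>a\<in>I. \<forall>b\<in>I. G a b = (\<Sum>l<card I. L a l * cnj (L b l))"
    using Cholesky[OF assms(2-4)] by blast
  obtain e :: "nat \<Rightarrow> 'k" where e: "\<forall>i<card I. \<forall>j<card I. cinner (e i) (e j) = (if i = j then 1 else 0)"
    using ex_orthonormal[OF assms(1)] by blast
  have "cinner (\<Sum>l<card I. L a l *\<^sub>C e l) (\<Sum>l<card I. L b l *\<^sub>C e l) = G a b" if "a \<in> I" "b \<in> I" for a b
  proof -
    have "cinner (\<Sum>l<card I. L a l *\<^sub>C e l) (\<Sum>l<card I. L b l *\<^sub>C e l)
        = (\<Sum>l<card I. \<Sum>l'<card I. cnj (L b l) * (L a l' * cinner (e l') (e l)))"
      by (simp add: cinner_sum_left cinner_sum_right cinner_scaleC_left cinner_scaleC_right sum_distrib_left)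
    also have "\<dots> = (\<Sum>l<card I. \<Sum>l'<card I. if l' = l then L a l * cnj (L b l) else 0)"
      using e by (intro sum.cong) auto
    finally show ?thesis using L that by simp
  qed
  then show ?thesis by (intro exI[of _ "\<lambda>a. \<Sum>l<card I. L a l *\<^sub>C e l"]) blast
qed

text \<open>A Toeplitz kernel is the Gram kernel of vectors which a row of partial isometries shifts into each
  other; positivity of the polynomial on that row is the assertion.\<close>

lemma positive_polynomial_Toeplitz:
  fixes G :: "'n::finite list \<times> nat \<Rightarrow> 'n list \<times> nat \<Rightarrow> complex"
  assumes inf: "infinite_dimensional TYPE('k::chilbert_space)"
    and p: "p \<in> positive_polynomials TYPE('k) m"
    and herm: "\<And>a b. G b a = cnj (G a b)"
    and psd: "\<And>I c. finite I \<Longrightarrow> 0 \<le> Re (\<Sum>a\<in>I. \<Sum>b\<in>I. c a * cnj (c b) * G a b)"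
    and shift: "\<And>i i' \<alpha> \<beta> j l. G (i # \<alpha>, j) (i' # \<beta>, l) = (if i = i' then G (\<alpha>, j) (\<beta>, l) else 0)"
  shows "0 \<le> Re (\<Sum>i<m. \<Sum>j<m. \<Sum>\<alpha> | p \<alpha> \<noteq> 0\<^sub>m m m. p \<alpha> $$ (i, j) * G (\<alpha>, j) ([], i))"
proof -
  have fin: "finite {\<alpha>. p \<alpha> \<noteq> 0\<^sub>m m m}"
    using p by (simp add: positive_polynomials_def nc_polynomials_def)
  define d where "d = Max (insert 0 (length ` {\<alpha>. p \<alpha> \<noteq> 0\<^sub>m m m}))"
  have d: "length \<alpha> \<le> d" if "p \<alpha> \<noteq> 0\<^sub>m m m" for \<alpha>
    unfolding d_def by (rule Max_ge) (use fin that in auto)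
  define I where "I = {\<alpha> :: 'n list. length \<alpha> \<le> d} \<times> {..<m}"
  \<comment> \<open>Strictly shorter words than in \<open>I\<close>, so that prefixing a letter
    stays where the vectors \<open>k\<close> realise the kernel.\<close>
  define J where "J = {\<alpha> :: 'n list. length \<alpha> < d} \<times> {..<m}"
  have finIJ: "finite I" "finite J" by (simp_all add: I_def J_def)
  obtain k :: "'n list \<times> nat \<Rightarrow> 'k" where k: "\<And>a b. a \<in> I \<Longrightarrow> b \<in> I \<Longrightarrow> cinner (k a) (k b) = G a b"
    using ex_Gram_vectors[OF inf finIJ(1), of G] herm psd[OF finIJ(1)] by metis
  define w where "w i a = k (i # fst a, snd a)" for i a
  \<comment> \<open>Prefixing one letter preserves the Gram matrix, and different letters give
    orthogonal vectors.\<close>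
  have ww: "cinner (w i a) (w i' b) = (if i = i' then cinner (k a) (k b) else 0)" if "a \<in> J" "b \<in> J" for i i' a b
    using that by (auto simp: w_def J_def I_def k shift)
  have "\<exists>X :: 'k bop. (\<forall>a\<in>J. X (k a) = w i a) \<and> (\<forall>x. \<exists>c. X x = (\<Sum>a\<in>J. c a *\<^sub>C w i a) \<and> norm (X x) \<le> norm x)" for i
    by (rule ex_partial_isometry[OF finIJ(2)]) (simp add: ww)
  then obtain X :: "'n \<Rightarrow> 'k bop" where X: "\<And>i a. a \<in> J \<Longrightarrow> X i (k a) = w i a"
    and range: "\<And>i x. \<exists>c. X i x = (\<Sum>a\<in>J. c a *\<^sub>C w i a)" and contr: "\<And>i x. norm (X i x) \<le> norm x"
    by metis
  have orth: "inner (X i x) (X i' y) = 0" if ii': "i \<noteq> i'" for i i' x y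
  proof -
    obtain c d where "X i x = (\<Sum>a\<in>J. c a *\<^sub>C w i a)" "X i' y = (\<Sum>a\<in>J. d a *\<^sub>C w i' a)"
      using range by metis
    then show ?thesis
      using ii' by (simp add: inner_eq_Re_cinner cinner_sum_left cinner_sum_right cinner_scaleC_left cinner_scaleC_right ww)
  qed
  \<comment> \<open>The ranges are mutually orthogonal, so Pythagoras makes the row of contractions
    a row contraction.\<close>
  have "norm (\<Sum>i\<in>UNIV. X i * adj (X i)) \<le> 1"
  proof (rule norm_sum_adj_le)
    fix x
    have "(norm (\<Sum>i\<in>UNIV. X i (x i)))\<^sup>2 = (\<Sum>i\<in>UNIV. (norm (X i (x i)))\<^sup>2)"
      by (rule norm_sum_Pythagorean) (auto simp: pairwise_def real_inner_class.orthogonal_def orth)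
    also have "\<dots> \<le> (\<Sum>i\<in>UNIV. (norm (x i))\<^sup>2)" by (intro sum_mono power_mono contr) simp
    finally show "(norm (\<Sum>i\<in>UNIV. X i (x i)))\<^sup>2 \<le> 1 * (\<Sum>i\<in>UNIV. (norm (x i))\<^sup>2)" by simp
  qed simp
  \<comment> \<open>Positivity of \<open>p\<close> is available on the open ball only, whereas this
    row may have norm 1.\<close>
  then have strict: "norm (\<Sum>i\<in>UNIV. (r *\<^sub>R X i) * adj (r *\<^sub>R X i)) < 1" if "0 < r" "r < 1" for r
  proof -
    have "(\<Sum>i\<in>UNIV. (r *\<^sub>R X i) * adj (r *\<^sub>R X i)) = (r * r) *\<^sub>R (\<Sum>i\<in>UNIV. X i * adj (X i))"
      by (simp add: adj_scaleR scaleR_right.sum)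
    then have "norm (\<Sum>i\<in>UNIV. (r *\<^sub>R X i) * adj (r *\<^sub>R X i)) = (r * r) * norm (\<Sum>i\<in>UNIV. X i * adj (X i))"
      using that by simp
    also have "\<dots> \<le> (r * r) * 1" using that \<open>norm _ \<le> 1\<close> by (intro mult_left_mono) auto
    also have "\<dots> < 1" using that mult_strict_mono[of r 1 r 1] by simp
    finally show ?thesis .
  qed
  have word: "word_op X \<alpha> (k ([], j)) = k (\<alpha>, j)" if "length \<alpha> \<le> d" "j < m" for \<alpha> j
    using that by (induction \<alpha>) (simp_all add: X J_def w_def)
  \<comment> \<open>The form is polynomial in r; its value at 1 is the claim and is reached from the
    left by continuity.\<close>
  define h where "h r = Re (\<Sum>i<m. \<Sum>j<m. \<Sum>\<alpha> | p \<alpha> \<noteq> 0\<^sub>m m m. p \<alpha> $$ (i, j) * (of_real (r ^ length \<alpha>) * G (\<alpha>, j) ([], i)))"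
    for r :: real
  have h: "0 \<le> h r" if "0 < r" "r < 1" for r
  proof -
    have "0 \<le> Re (opmat_form (nc_eval m p (\<lambda>i. r *\<^sub>R X i)) (\<lambda>j. k ([], j)) (\<lambda>j. k ([], j)))"
      using p strict[OF that] by (simp add: positive_polynomials_def opmat_nonneg_Re_iff[OF nc_eval_carrier])
    also have "opmat_form (nc_eval m p (\<lambda>i. r *\<^sub>R X i)) (\<lambda>j. k ([], j)) (\<lambda>j. k ([], j))
        = (\<Sum>i<m. \<Sum>j<m. \<Sum>\<alpha> | p \<alpha> \<noteq> 0\<^sub>m m m. p \<alpha> $$ (i, j) * (of_real (r ^ length \<alpha>) * G (\<alpha>, j) ([], i)))"
      unfolding opmat_form_nc_eval
      by (intro sum.cong refl) (simp add: word_op_scaleR cinner_scaleR word d k I_def)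
    finally show ?thesis by (simp only: h_def)
  qed
  have "(h \<longlongrightarrow> h 1) (at_left 1)"
    unfolding h_def by (intro tendsto_intros)
  moreover have "\<forall>\<^sub>F r in at_left 1. 0 \<le> h r"
    by (rule eventually_at_leftI[of 0]) (use h in auto)
  ultimately have "0 \<le> h 1" by (rule tendsto_lowerbound) simp
  then show ?thesis by (simp add: h_def)
qed

section \<open>The norm of an operator matrix\<close>

abbreviation tuple_norm :: "nat \<Rightarrow> (nat \<Rightarrow> 'h::chilbert_space) \<Rightarrow> real" where
  "tuple_norm m v \<equiv> L2_set (\<lambda>j. norm (v j)) {..<m}"

lemma tuple_norm_power2: "(tuple_norm m v)\<^sup>2 = (\<Sum>j<m. (norm (v j))\<^sup>2)"
  by (simp add: L2_set_def sum_nonneg)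

lemma cmod_sum_cinner_le: "cmod (\<Sum>i<m. cinner (v i) (w i)) \<le> tuple_norm m v * tuple_norm m w"
proof -
  have "cmod (\<Sum>i<m. cinner (v i) (w i)) \<le> (\<Sum>i<m. \<bar>norm (v i)\<bar> * \<bar>norm (w i)\<bar>)"
    by (rule order_trans[OF norm_sum]) (simp add: sum_mono norm_cinner_le)
  also have "\<dots> \<le> tuple_norm m v * tuple_norm m w" by (rule L2_set_mult_ineq)
  finally show ?thesis .
qed

lemma opmat_norm_altdef:
  assumes "P \<in> carrier_mat m m"
  shows "opmat_norm P = Sup ((\<lambda>v. tuple_norm m (opmat_apply P v)) ` {v. tuple_norm m v \<le> 1})"
  unfolding opmat_norm_def L2_set_def Setcompr_eq_image[symmetric] carrier_matD[OF assms] by simp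

lemma opmat_norm_le:
  assumes P: "P \<in> carrier_mat m m" and c: "0 \<le> c"
    and le: "\<And>v w. Re (opmat_form P v w) \<le> c * tuple_norm m v * tuple_norm m w"
  shows "opmat_norm P \<le> c"
  unfolding opmat_norm_altdef[OF P]
proof (rule cSup_least)
  have "(\<lambda>_. 0 :: 'a) \<in> {v. tuple_norm m v \<le> 1}" by (simp add: L2_set_def)
  then show "((\<lambda>v. tuple_norm m (opmat_apply P v)) ` {v. tuple_norm m v \<le> 1}) \<noteq> {}" unfolding image_is_empty by (metis empty_iff)
next
  fix s assume "s \<in> ((\<lambda>v. tuple_norm m (opmat_apply P v)) ` {v. tuple_norm m v \<le> 1})"
  then obtain v where s: "s = tuple_norm m (opmat_apply P v)" and v: "tuple_norm m v \<le> 1" by auto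
  have "opmat_form P v (opmat_apply P v) = of_real (s\<^sup>2)"
    using P by (simp only: opmat_form_def s tuple_norm_power2 cinner_self of_real_sum carrier_matD)
  then have "s\<^sup>2 \<le> c * tuple_norm m v * s"
    using le[of v "opmat_apply P v"] by (simp add: s)
  also have "\<dots> \<le> (c * 1) * s" using v c by (intro mult_right_mono mult_left_mono) (auto simp: s)
  finally have "s * s \<le> c * s" by (simp add: power2_eq_square)
  then show "s \<le> c" using c s L2_set_nonneg by (cases "s = 0") (auto simp: mult_le_cancel_right less_le)
qed

lemma opmat_apply_scaleR: "opmat_apply P (\<lambda>j. r *\<^sub>R v j) i = r *\<^sub>R opmat_apply P v i"
  by (simp add: opmat_apply_def scaleR_right.sum)

lemma tuple_norm_scaleR: "tuple_norm m (\<lambda>j. r *\<^sub>R v j) = \<bar>r\<bar> * tuple_norm m v"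
  by (simp add: L2_set_right_distrib[symmetric])

lemma tuple_norm_opmat_apply_le:
  assumes P: "P \<in> carrier_mat m m"
  shows "tuple_norm m (opmat_apply P v) \<le> opmat_norm P * tuple_norm m v"
proof (cases "tuple_norm m v = 0")
  case True
  then have "v j = 0" if "j < m" for j using that by (simp add: L2_set_eq_0_iff)
  then have "opmat_apply P v = (\<lambda>i. 0)" using P by (simp add: opmat_apply_def fun_eq_iff)
  then show ?thesis using True by (simp add: L2_set_def)
next
  case False
  \<comment> \<open>A crude bound which ensures that the real \<open>Sup\<close> in
    \<open>opmat_norm\<close> is an upper bound.\<close>
  define B where "B = (\<Sum>i<m. \<Sum>j<m. norm (P $$ (i, j)))"
  have bdd: "bdd_above ((\<lambda>v. tuple_norm m (opmat_apply P v)) ` {v. tuple_norm m v \<le> 1})"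
  proof (rule bdd_aboveI[of _ B])
    fix s assume "s \<in> ((\<lambda>v. tuple_norm m (opmat_apply P v)) ` {v. tuple_norm m v \<le> 1})"
    then obtain v where s: "s = tuple_norm m (opmat_apply P v)" and v: "tuple_norm m v \<le> 1" by auto
    have "norm (v j) \<le> 1" if "j < m" for j
      using member_le_L2_set[of "{..<m}" j "\<lambda>j. norm (v j)"] that v by simp
    then have "norm ((P $$ (i, j)) (v j)) \<le> norm (P $$ (i, j))" if "j < m" for i j
      using norm_bop[of "P $$ (i, j)" "v j"] mult_left_mono[of "norm (v j)" 1 "norm (P $$ (i, j))"] that by force
    then have "norm (opmat_apply P v i) \<le> (\<Sum>j<m. norm (P $$ (i, j)))" for i
      unfolding opmat_apply_def carrier_matD[OF P]
      by - (rule order_trans[OF norm_sum], rule sum_mono, simp)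
    then show "s \<le> B"
      unfolding s B_def by - (rule order_trans[OF L2_set_le_sum], simp, rule sum_mono, simp)
  qed
  let ?r = "1 / tuple_norm m v"
  have pos: "tuple_norm m v > 0" using False L2_set_nonneg[of "\<lambda>j. norm (v j)" "{..<m}"] by linarith
  have "tuple_norm m (\<lambda>j. ?r *\<^sub>R v j) \<le> 1" using pos unfolding tuple_norm_scaleR by simp
  then have "tuple_norm m (opmat_apply P (\<lambda>j. ?r *\<^sub>R v j)) \<le> opmat_norm P"
    unfolding opmat_norm_altdef[OF P] by (intro cSup_upper bdd imageI) simp
  then show ?thesis using pos unfolding opmat_apply_scaleR tuple_norm_scaleR by (simp add: field_simps)
qed

lemma cmod_opmat_form_le:
  assumes P: "P \<in> carrier_mat m m"
  shows "cmod (opmat_form P v w) \<le> opmat_norm P * tuple_norm m v * tuple_norm m w"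
proof -
  have "cmod (opmat_form P v w) \<le> tuple_norm m (opmat_apply P v) * tuple_norm m w"
    using P by (simp add: opmat_form_def cmod_sum_cinner_le)
  also have "\<dots> \<le> (opmat_norm P * tuple_norm m v) * tuple_norm m w"
    by (intro mult_right_mono tuple_norm_opmat_apply_le P L2_set_nonneg)
  finally show ?thesis .
qed

lemma opmat_diff_carrier: "Q \<in> carrier_mat m m \<Longrightarrow> P - Q \<in> carrier_mat m m"
  for P Q :: "'h::chilbert_space bop mat"
  using carrier_matD[of Q m m] by (intro carrier_matI) (simp_all only: index_minus_mat)

lemma opmat_form_add:
  assumes "P \<in> carrier_mat m m"
  shows "opmat_form P (\<lambda>j. v j + v' j) w = opmat_form P v w + opmat_form P v' w"
    and "opmat_form P (\<lambda>j. v j - v' j) w = opmat_form P v w - opmat_form P v' w"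
    and "opmat_form P v (\<lambda>j. w j + w' j) = opmat_form P v w + opmat_form P v w'"
    and "opmat_form P v (\<lambda>j. w j - w' j) = opmat_form P v w - opmat_form P v w'"
    and "opmat_form P (\<lambda>j. r *\<^sub>R v j) w = of_real r * opmat_form P v w"
    and "opmat_form P v (\<lambda>j. r *\<^sub>R w j) = of_real r * opmat_form P v w"
  unfolding opmat_form_expand[OF assms]
  by (simp_all add: cinner_add_left cinner_diff_left cinner_add_right cinner_diff_right cinner_scaleR
      sum.distrib sum_subtractf sum_distrib_left)

text \<open>The difference is self-adjoint, so its quadratic form controls its norm: polarisation
  reaches the off-diagonal values, the parallelogram law bounds them, and normalising both vectors
  turns the sum of squares into a product.\<close>

lemma opmat_norm_Re_diff_le:
  fixes P Q :: "'h::chilbert_space bop mat"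
  assumes P: "P \<in> carrier_mat m m" and Q: "Q \<in> carrier_mat m m" and c: "0 \<le> c"
    and bound: "\<And>v. \<bar>Re (opmat_form P v v - opmat_form Q v v)\<bar> \<le> c * (tuple_norm m v)\<^sup>2"
  shows "opmat_norm (opmat_Re P - opmat_Re Q) \<le> c"
proof (rule opmat_norm_le[OF opmat_diff_carrier[OF opmat_Re_carrier[OF Q]] c])
  fix v w :: "nat \<Rightarrow> 'h"
  define D where "D = opmat_Re P - opmat_Re Q"
  have D: "D \<in> carrier_mat m m" unfolding D_def by (rule opmat_diff_carrier[OF opmat_Re_carrier[OF Q]])
  define \<beta> where "\<beta> v w = Re (opmat_form P v w - opmat_form Q v w)" for v w
  have form: "Re (opmat_form D v w) = (\<beta> v w + \<beta> w v) / 2" for v w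
    unfolding \<beta>_def D_def opmat_form_diff[OF opmat_Re_carrier[OF P] opmat_Re_carrier[OF Q]]
      opmat_form_Re[OF P] opmat_form_Re[OF Q] by (simp add: field_simps)
  have half: "Re (opmat_form D v w) \<le> c / 2 * ((tuple_norm m v)\<^sup>2 + (tuple_norm m w)\<^sup>2)" for v w
  proof -
    have "2 * (\<beta> v w + \<beta> w v) = \<beta> (\<lambda>j. v j + w j) (\<lambda>j. v j + w j) - \<beta> (\<lambda>j. v j - w j) (\<lambda>j. v j - w j)"
      unfolding \<beta>_def opmat_form_add[OF P] opmat_form_add[OF Q] by simp
    also have "\<dots> \<le> c * (tuple_norm m (\<lambda>j. v j + w j))\<^sup>2 + c * (tuple_norm m (\<lambda>j. v j - w j))\<^sup>2"
      using bound[of "\<lambda>j. v j + w j"] bound[of "\<lambda>j. v j - w j"] by (simp add: \<beta>_def abs_le_iff)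
    also have "\<dots> = c * (\<Sum>j<m. (norm (v j + w j))\<^sup>2 + (norm (v j - w j))\<^sup>2)"
      by (simp add: tuple_norm_power2 sum.distrib distrib_left)
    also have "\<dots> = c * (\<Sum>j<m. 2 * (norm (v j))\<^sup>2 + 2 * (norm (w j))\<^sup>2)"
      by (simp add: power2_norm_eq_inner inner_add_left inner_add_right inner_diff_left inner_diff_right inner_commute)
    finally show ?thesis
      unfolding form tuple_norm_power2 by (simp add: sum.distrib sum_distrib_left[symmetric] algebra_simps)
  qed
  show "Re (opmat_form D v w) \<le> c * tuple_norm m v * tuple_norm m w"
  proof (cases "tuple_norm m v = 0 \<or> tuple_norm m w = 0")
    case True
    then have "(\<forall>j<m. v j = 0) \<or> (\<forall>j<m. w j = 0)" by (auto simp: L2_set_eq_0_iff)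
    then have "opmat_form D v w = 0" unfolding opmat_form_expand[OF D] by auto
    then show ?thesis using True by auto
  next
    case False
    then have pos: "tuple_norm m v > 0" "tuple_norm m w > 0" by (simp_all add: less_le)
    let ?v = "\<lambda>j. (1 / tuple_norm m v) *\<^sub>R v j" and ?w = "\<lambda>j. (1 / tuple_norm m w) *\<^sub>R w j"
    have "Re (opmat_form D ?v ?w) \<le> c / 2 * (1 + 1)"
      using half[of ?v ?w] pos unfolding tuple_norm_scaleR by simp
    then have "Re (opmat_form D v w) / (tuple_norm m v * tuple_norm m w) \<le> c"
      unfolding opmat_form_add[OF D] by (simp add: field_simps)
    then show ?thesis using pos by (simp add: divide_le_eq mult_ac)
  qed
qed

section \<open>Positive polynomials are dominated by the Poisson kernel\<close>

lemma poisson_coefficient_commute: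
  assumes "decaying X"
  shows "cinner (poisson_kernel X (ell2_single b v)) (ell2_single a h) =
    cnj (cinner (poisson_kernel X (ell2_single a h)) (ell2_single b v))"
  unfolding poisson_coefficient[OF assms] by (auto simp: cinner_commute[symmetric])

text \<open>Removing a common first letter changes neither which word extends the other nor by what;
  words with different first letters are incomparable.\<close>

lemma poisson_coefficient_Cons:
  assumes "decaying X"
  shows "cinner (poisson_kernel X (ell2_single (i # a) h)) (ell2_single (i' # b) v) =
    (if i = i' then cinner (poisson_kernel X (ell2_single a h)) (ell2_single b v) else 0)"
  unfolding poisson_coefficient[OF assms] by auto

lemma poisson_coefficient_Nil:
  assumes "decaying X"
  shows "cinner (poisson_kernel X (ell2_single a h)) (ell2_single [] v) = cinner (word_op X a h) v"
  unfolding poisson_coefficient[OF assms] by auto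

text \<open>The hypothesis says that \<open>M\<close> plus its adjoint is twice the
  identity.\<close>

lemma Re_constant_term:
  fixes v :: "nat \<Rightarrow> 'h::chilbert_space"
  assumes "\<forall>i<m. \<forall>j<m. M $$ (i, j) + cnj (M $$ (j, i)) = (if i = j then 2 else 0)"
  shows "Re (\<Sum>i<m. \<Sum>j<m. M $$ (i, j) * cinner (v j) (v i)) = (tuple_norm m v)\<^sup>2"
proof -
  define S where "S = (\<Sum>i<m. \<Sum>j<m. M $$ (i, j) * cinner (v j) (v i))"
  have "cnj S = (\<Sum>j<m. \<Sum>i<m. cnj (M $$ (j, i)) * cinner (v j) (v i))"
    by (simp add: S_def cinner_commute[symmetric])
  also have "\<dots> = (\<Sum>i<m. \<Sum>j<m. cnj (M $$ (j, i)) * cinner (v j) (v i))" by (rule sum.swap)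
  finally have "S + cnj S = (\<Sum>i<m. \<Sum>j<m. (M $$ (i, j) + cnj (M $$ (j, i))) * cinner (v j) (v i))"
    by (simp add: S_def sum.distrib distrib_right)
  also have "\<dots> = (\<Sum>i<m. \<Sum>j<m. if j = i then 2 * cinner (v i) (v i) else 0)"
    using assms by (intro sum.cong) auto
  also have "\<dots> = of_real (2 * (tuple_norm m v)\<^sup>2)"
    by (simp add: tuple_norm_power2 cinner_self sum_distrib_left)
  finally show ?thesis unfolding complex_add_cnj S_def[symmetric] of_real_eq_iff by simp
qed

lemma positive_polynomial_norm_le:
  fixes A B :: "'n::finite \<Rightarrow> 'h::chilbert_space bop"
  assumes inf: "infinite_dimensional TYPE('k::chilbert_space)"
    and p: "p \<in> positive_polynomials TYPE('k) m"
    and A: "decaying A" and B: "decaying B"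
  shows "opmat_norm (opmat_Re (nc_eval m p A) - opmat_Re (nc_eval m p B))
    \<le> norm (poisson_kernel A - poisson_kernel B)"
proof (rule opmat_norm_Re_diff_le[OF nc_eval_carrier nc_eval_carrier norm_ge_zero])
  fix v :: "nat \<Rightarrow> 'h"
  define T where "T = poisson_kernel A - poisson_kernel B"
  define c where "c = norm T"
  have pol: "p \<in> nc_polynomials m" using p by (simp add: positive_polynomials_def)
  obtain z :: 'k where z: "z \<noteq> 0" using infinite_dimensional_nonzero[OF inf] by blast
  have const: "\<forall>i<m. \<forall>j<m. p [] $$ (i, j) + cnj (p [] $$ (j, i)) = (if i = j then 2 else 0)"
    using p opmat_Re_zero_iff[OF pol z] by (simp add: positive_polynomials_def)
  define x where "x a = ell2_single (fst a) (v (snd a))" for a :: "'n list \<times> nat"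
  \<comment> \<open>The two signs of s give the two halves of the absolute value; \<open>G\<close>
    below is the kernel of c I + s T at the vectors \<open>x a\<close>.\<close>
  have key: "0 \<le> c * (tuple_norm m v)\<^sup>2 + s * Re (opmat_form (nc_eval m p A) v v - opmat_form (nc_eval m p B) v v)"
    if s: "\<bar>s\<bar> = 1" for s :: real
  proof -
    define G where "G a b = of_real c * cinner (x a) (x b) + of_real s * cinner (T (x a)) (x b)" for a b
    have "0 \<le> Re (\<Sum>i<m. \<Sum>j<m. \<Sum>\<alpha> | p \<alpha> \<noteq> 0\<^sub>m m m. p \<alpha> $$ (i, j) * G (\<alpha>, j) ([], i))"
    proof (rule positive_polynomial_Toeplitz[OF inf p])
      show "G b a = cnj (G a b)" for a b
        by (simp add: G_def T_def x_def cinner_diff_left poisson_coefficient_commute[OF A, of "fst b"]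
            poisson_coefficient_commute[OF B, of "fst b"]
            cinner_commute[of "ell2_single (fst b) (v (snd b))"])
      show "G (i # \<alpha>, j) (i' # \<beta>, l) = (if i = i' then G (\<alpha>, j) (\<beta>, l) else 0)" for i i' \<alpha> \<beta> j l
        by (simp add: G_def T_def x_def cinner_diff_left poisson_coefficient_Cons[OF A]
            poisson_coefficient_Cons[OF B] cinner_single_left ell2_nth_single)
      fix I :: "('n list \<times> nat) set" and d assume "finite I"
      define y where "y = (\<Sum>a\<in>I. d a *\<^sub>C x a)"
      have "(\<Sum>a\<in>I. \<Sum>b\<in>I. d a * cnj (d b) * G a b) = of_real c * cinner y y + of_real s * cinner (T y) y"
      proof -
        have "cinner y y = (\<Sum>a\<in>I. \<Sum>b\<in>I. d a * cnj (d b) * cinner (x a) (x b))"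
          unfolding y_def cinner_sum_left cinner_sum_right cinner_scaleC_left cinner_scaleC_right
          by (simp add: sum_distrib_left mult_ac) (rule sum.swap)
        moreover have "cinner (T y) y = (\<Sum>a\<in>I. \<Sum>b\<in>I. d a * cnj (d b) * cinner (T (x a)) (x b))"
          unfolding y_def bop_sum_right bop_scaleC cinner_sum_left cinner_sum_right cinner_scaleC_left cinner_scaleC_right
          by (simp add: sum_distrib_left mult_ac) (rule sum.swap)
        ultimately show ?thesis
          unfolding G_def by (simp add: sum_distrib_left distrib_left sum.distrib mult_ac)
      qed
      also have "Re \<dots> = c * (norm y)\<^sup>2 + s * Re (cinner (T y) y)"
        by (simp add: cinner_self)
      also have "\<dots> \<ge> 0"
      proof -
        have "\<bar>s * Re (cinner (T y) y)\<bar> \<le> cmod (cinner (T y) y)"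
          using s by (simp add: abs_mult abs_Re_le_cmod)
        also have "\<dots> \<le> norm (T y) * norm y" by (rule norm_cinner_le)
        also have "\<dots> \<le> (c * norm y) * norm y" unfolding c_def by (intro mult_right_mono norm_bop) simp
        finally show ?thesis by (simp add: power2_eq_square mult_ac)
      qed
      finally show "0 \<le> Re (\<Sum>a\<in>I. \<Sum>b\<in>I. d a * cnj (d b) * G a b)" .
    qed
    \<comment> \<open>Against the empty word the identity survives only at the constant term of
      \<open>p\<close>, while \<open>T\<close> produces the forms of p(A) - p(B).\<close>
    also have "(\<Sum>i<m. \<Sum>j<m. \<Sum>\<alpha> | p \<alpha> \<noteq> 0\<^sub>m m m. p \<alpha> $$ (i, j) * G (\<alpha>, j) ([], i))
      = (\<Sum>i<m. \<Sum>j<m. of_real c * (p [] $$ (i, j) * cinner (v j) (v i)))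
        + of_real s * (opmat_form (nc_eval m p A) v v - opmat_form (nc_eval m p B) v v)"
    proof -
      have G: "G (\<alpha>, j) ([], i) = (if \<alpha> = [] then of_real c * cinner (v j) (v i) else 0)
          + of_real s * (cinner (word_op A \<alpha> (v j)) (v i) - cinner (word_op B \<alpha> (v j)) (v i))" for \<alpha> i j
        by (simp add: G_def T_def x_def cinner_diff_left poisson_coefficient_Nil[OF A]
            poisson_coefficient_Nil[OF B] cinner_single_left ell2_nth_single)
      have "(\<Sum>\<alpha> | p \<alpha> \<noteq> 0\<^sub>m m m. p \<alpha> $$ (i, j) * (if \<alpha> = [] then of_real c * cinner (v j) (v i) else 0))
          = of_real c * (p [] $$ (i, j) * cinner (v j) (v i))" if "i < m" "j < m" for i j
        using pol that by (auto simp: nc_polynomials_def if_distrib[of "\<lambda>x. _ * x"] cong: if_cong)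
      then have "(\<Sum>i<m. \<Sum>j<m. \<Sum>\<alpha> | p \<alpha> \<noteq> 0\<^sub>m m m. p \<alpha> $$ (i, j) * (if \<alpha> = [] then of_real c * cinner (v j) (v i) else 0))
          = (\<Sum>i<m. \<Sum>j<m. of_real c * (p [] $$ (i, j) * cinner (v j) (v i)))"
        by (intro sum.cong refl) simp_all
      then show ?thesis
        unfolding opmat_form_nc_eval G
        by (simp add: distrib_left sum.distrib right_diff_distrib sum_subtractf sum_distrib_left mult_ac)
    qed
    also have "Re \<dots> = c * (tuple_norm m v)\<^sup>2 + s * Re (opmat_form (nc_eval m p A) v v - opmat_form (nc_eval m p B) v v)"
      unfolding Re_constant_term[OF const, of v, symmetric] by (simp add: sum_distrib_left[symmetric])
    finally show ?thesis .
  qed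
  show "\<bar>Re (opmat_form (nc_eval m p A) v v - opmat_form (nc_eval m p B) v v)\<bar>
      \<le> norm (poisson_kernel A - poisson_kernel B) * (tuple_norm m v)\<^sup>2"
    using key[of 1] key[of "-1"] by (simp add: c_def T_def abs_le_iff)
qed

section \<open>Truncations of the Poisson kernel are positive polynomials\<close>

lemma sum_words_le_Suc:
  fixes g :: "'n::finite list \<Rightarrow> 'b::comm_monoid_add"
  shows "(\<Sum>\<alpha> | length \<alpha> \<le> Suc N. g \<alpha>) = g [] + (\<Sum>i\<in>UNIV. \<Sum>\<alpha> | length \<alpha> \<le> N. g (i # \<alpha>))"
proof -
  have eq: "{\<alpha> :: 'n list. length \<alpha> \<le> Suc N} = insert [] ((\<lambda>(i, \<alpha>). i # \<alpha>) ` (UNIV \<times> {\<alpha>. length \<alpha> \<le> N}))"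
  proof (intro Set.set_eqI iffI)
    fix \<alpha> :: "'n list" assume "\<alpha> \<in> {\<alpha>. length \<alpha> \<le> Suc N}"
    then show "\<alpha> \<in> insert [] ((\<lambda>(i, \<alpha>). i # \<alpha>) ` (UNIV \<times> {\<alpha>. length \<alpha> \<le> N}))"
      by (cases \<alpha>) auto
  qed auto
  have inj: "inj_on (\<lambda>(i, \<alpha>). i # \<alpha>) (UNIV \<times> {\<alpha> :: 'n list. length \<alpha> \<le> N})" by (auto simp: inj_on_def)
  have "sum g ((\<lambda>(i, \<alpha>). i # \<alpha>) ` (UNIV \<times> {\<alpha>. length \<alpha> \<le> N})) = (\<Sum>i\<in>UNIV. \<Sum>\<alpha> | length \<alpha> \<le> N. g (i # \<alpha>))"
    unfolding sum.reindex[OF inj] sum.cartesian_product by (simp add: case_prod_beta)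
  then show ?thesis
    unfolding eq by (subst sum.insert) auto
qed

text \<open>With \<open>v = u - z\<close> and \<open>z \<beta> = (\<Sum>i. X i (u (\<beta> @ [i])))\<close> the form telescopes to
  \<open>\<parallel>u\<parallel>\<^sup>2 - \<parallel>z\<parallel>\<^sup>2\<close>.\<close>

lemma truncated_kernel_nonneg:
  fixes X :: "'n::finite \<Rightarrow> 'k::chilbert_space bop"
  assumes row: "\<And>x. (norm (\<Sum>i\<in>UNIV. X i (x i)))\<^sup>2 \<le> (\<Sum>i\<in>UNIV. (norm (x i))\<^sup>2)"
    and v: "\<And>\<beta>. N < length \<beta> \<Longrightarrow> v \<beta> = 0"
  shows "0 \<le> Re (\<Sum>\<beta> | length \<beta> \<le> N. \<Sum>\<alpha> | length \<alpha> \<le> N.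
    (if \<alpha> = [] then 1 else 2) * cinner (word_op X \<alpha> (v (\<beta> @ \<alpha>))) (v \<beta>))"
proof -
  let ?W = "{\<alpha> :: 'n list. length \<alpha> \<le> N}"
  \<comment> \<open>Neumann series of the row shift applied to \<open>v\<close>, finite because
    \<open>v\<close> vanishes on long words.\<close>
  define u where "u \<beta> = (\<Sum>\<alpha>\<in>?W. word_op X \<alpha> (v (\<beta> @ \<alpha>)))" for \<beta>
  define z where "z \<beta> = (\<Sum>i\<in>UNIV. X i (u (\<beta> @ [i])))" for \<beta>
  have u0: "u \<beta> = 0" if "N < length \<beta>" for \<beta>
    using that by (simp add: u_def v)
  have rec: "u \<beta> = v \<beta> + z \<beta>" for \<beta>
  proof -
    have "u \<beta> = (\<Sum>\<alpha> | length \<alpha> \<le> Suc N. word_op X \<alpha> (v (\<beta> @ \<alpha>)))"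
      unfolding u_def by (rule sum.mono_neutral_left) (auto simp: v)
    also have "\<dots> = v \<beta> + z \<beta>"
      by (simp add: sum_words_le_Suc z_def u_def bop_sum_right)
    finally show ?thesis .
  qed
  have "Re (\<Sum>\<alpha>\<in>?W. (if \<alpha> = [] then 1 else 2) * cinner (word_op X \<alpha> (v (\<beta> @ \<alpha>))) (v \<beta>))
      = (norm (u \<beta>))\<^sup>2 - (norm (z \<beta>))\<^sup>2" for \<beta>
  proof -
    have "(\<Sum>\<alpha>\<in>?W. (if \<alpha> = [] then 1 else 2) * cinner (word_op X \<alpha> (v (\<beta> @ \<alpha>))) (v \<beta>))
        = (\<Sum>\<alpha>\<in>?W. 2 * cinner (word_op X \<alpha> (v (\<beta> @ \<alpha>))) (v \<beta>) - (if \<alpha> = [] then cinner (v \<beta>) (v \<beta>) else 0))"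
      by (intro sum.cong) auto
    also have "\<dots> = 2 * cinner (u \<beta>) (v \<beta>) - cinner (v \<beta>) (v \<beta>)"
      by (simp add: sum_subtractf u_def cinner_sum_left sum_distrib_left)
    finally have "Re (\<Sum>\<alpha>\<in>?W. (if \<alpha> = [] then 1 else 2) * cinner (word_op X \<alpha> (v (\<beta> @ \<alpha>))) (v \<beta>))
        = 2 * inner (u \<beta>) (v \<beta>) - inner (v \<beta>) (v \<beta>)"
      by (simp add: inner_eq_Re_cinner)
    also have "\<dots> = (norm (u \<beta>))\<^sup>2 - (norm (z \<beta>))\<^sup>2"
      using rec[of \<beta>] by (simp add: power2_norm_eq_inner inner_add_left inner_add_right inner_commute)
    finally show ?thesis .
  qed
  then have "Re (\<Sum>\<beta>\<in>?W. \<Sum>\<alpha>\<in>?W. (if \<alpha> = [] then 1 else 2) * cinner (word_op X \<alpha> (v (\<beta> @ \<alpha>))) (v \<beta>))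
      = (\<Sum>\<beta>\<in>?W. (norm (u \<beta>))\<^sup>2) - (\<Sum>\<beta>\<in>?W. (norm (z \<beta>))\<^sup>2)"
    by (simp only: Re_sum sum_subtractf)
  moreover have "(\<Sum>\<beta>\<in>?W. (norm (z \<beta>))\<^sup>2) \<le> (\<Sum>\<beta>\<in>?W. (norm (u \<beta>))\<^sup>2)"
  proof -
    have inj: "inj_on (\<lambda>(\<beta>, i). \<beta> @ [i]) (?W \<times> UNIV)" by (auto simp: inj_on_def)
    have "(\<Sum>\<beta>\<in>?W. (norm (z \<beta>))\<^sup>2) \<le> (\<Sum>\<beta>\<in>?W. \<Sum>i\<in>UNIV. (norm (u (\<beta> @ [i])))\<^sup>2)"
      unfolding z_def by (intro sum_mono row)
    also have "\<dots> = (\<Sum>\<delta>\<in>(\<lambda>(\<beta>, i). \<beta> @ [i]) ` (?W \<times> UNIV). (norm (u \<delta>))\<^sup>2)"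
      unfolding sum.reindex[OF inj] sum.cartesian_product by (simp add: case_prod_beta)
    also have "\<dots> \<le> (\<Sum>\<delta>\<in>(\<lambda>(\<beta>, i). \<beta> @ [i]) ` (?W \<times> UNIV) \<union> ?W. (norm (u \<delta>))\<^sup>2)"
      by (rule sum_mono2) auto
    \<comment> \<open>Appending a letter may produce words of length N + 1, but \<open>u\<close>
      vanishes there.\<close>
    also have "\<dots> = (\<Sum>\<delta>\<in>?W. (norm (u \<delta>))\<^sup>2)"
      by (rule sum.mono_neutral_right) (use u0 in \<open>force simp: not_le\<close>)+
    finally show ?thesis .
  qed
  ultimately show ?thesis by simp
qed

text \<open>Matrix indices stand for words through \<open>f\<close>, and the real part is the
  compression of P_1(X, R) to these words. The coefficient 2 compensates the factor 1/2 in the real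
  part; the constant term 1 occurs in both summands and stays 1.\<close>

definition truncation_poly :: "(nat \<Rightarrow> 'n list) \<Rightarrow> nat \<Rightarrow> 'n list \<Rightarrow> complex mat" where
  "truncation_poly f m \<gamma> = mat m m (\<lambda>(i, j). if f j = f i @ \<gamma> then (if \<gamma> = [] then 1 else 2) else 0)"

context
  fixes f :: "nat \<Rightarrow> 'n::finite list" and m N :: nat
  assumes bij: "bij_betw f {..<m} {\<alpha>. length \<alpha> \<le> N}"
begin

lemma truncation_length: "j < m \<Longrightarrow> length (f j) \<le> N"
  using bij_betwE[OF bij] by blast

lemma truncation_inj: "i < m \<Longrightarrow> j < m \<Longrightarrow> f i = f j \<longleftrightarrow> i = j"
  using bij_betw_imp_inj_on[OF bij] by (auto simp: inj_on_def)

lemma truncation_poly_support: "{\<gamma>. truncation_poly f m \<gamma> \<noteq> 0\<^sub>m m m} \<subseteq> {\<alpha>. length \<alpha> \<le> N}"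
proof safe
  fix \<gamma> assume nz: "truncation_poly f m \<gamma> \<noteq> 0\<^sub>m m m"
  show "length \<gamma> \<le> N"
  proof (rule ccontr)
    assume "\<not> length \<gamma> \<le> N"
    then have "f j \<noteq> f i @ \<gamma>" if "j < m" for i j using truncation_length[OF that] by auto
    then have "truncation_poly f m \<gamma> = 0\<^sub>m m m" by (intro eq_matI) (auto simp: truncation_poly_def)
    then show False using nz by blast
  qed
qed

lemma truncation_poly_nc: "truncation_poly f m \<in> nc_polynomials m"
  using finite_subset[OF truncation_poly_support finite_words_le]
  by (simp add: nc_polynomials_def truncation_poly_def)

lemma truncation_form:
  "opmat_form (nc_eval m (truncation_poly f m) A) v w = (\<Sum>i<m. \<Sum>j<m. \<Sum>\<alpha> | length \<alpha> \<le> N.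
    if f j = f i @ \<alpha> then (if \<alpha> = [] then 1 else 2) * cinner (word_op A \<alpha> (v j)) (w i) else 0)"
proof -
  have "opmat_form (nc_eval m (truncation_poly f m) A) v w
      = (\<Sum>i<m. \<Sum>j<m. \<Sum>\<alpha> | length \<alpha> \<le> N. truncation_poly f m \<alpha> $$ (i, j) * cinner (word_op A \<alpha> (v j)) (w i))"
    unfolding opmat_form_nc_eval
    by (intro sum.cong refl sum.mono_neutral_left truncation_poly_support) auto
  also have "\<dots> = (\<Sum>i<m. \<Sum>j<m. \<Sum>\<alpha> | length \<alpha> \<le> N.
      if f j = f i @ \<alpha> then (if \<alpha> = [] then 1 else 2) * cinner (word_op A \<alpha> (v j)) (w i) else 0)"
    by (intro sum.cong refl) (simp add: truncation_poly_def)
  finally show ?thesis .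
qed

lemma truncation_poly_positive:
  assumes inf: "infinite_dimensional TYPE('k::chilbert_space)"
  shows "truncation_poly f m \<in> positive_polynomials TYPE('k) m"
proof -
  obtain z :: 'k where z: "z \<noteq> 0" using infinite_dimensional_nonzero[OF inf] by blast
  have "opmat_Re (nc_eval m (truncation_poly f m) (\<lambda>_. 0 :: 'k bop)) = 1\<^sub>m m"
    unfolding opmat_Re_zero_iff[OF truncation_poly_nc z]
    by (auto simp: truncation_poly_def truncation_inj)
  moreover have "opmat_nonneg (opmat_Re (nc_eval m (truncation_poly f m) X))"
    if X: "norm (\<Sum>i\<in>UNIV. X i * adj (X i)) < 1" for X :: "'n \<Rightarrow> 'k bop"
    unfolding opmat_nonneg_Re_iff[OF nc_eval_carrier]
  proof
    fix v :: "nat \<Rightarrow> 'k"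
    have row: "(norm (\<Sum>i\<in>UNIV. X i (x i)))\<^sup>2 \<le> (\<Sum>i\<in>UNIV. (norm (x i))\<^sup>2)" for x
    proof -
      have "(norm (\<Sum>i\<in>UNIV. X i (x i)))\<^sup>2 \<le> norm (\<Sum>i\<in>UNIV. X i * adj (X i)) * (\<Sum>i\<in>UNIV. (norm (x i))\<^sup>2)"
        by (rule norm_row_le[OF norm_ge_zero sum_norm_adj_le]) simp
      also have "\<dots> \<le> 1 * (\<Sum>i\<in>UNIV. (norm (x i))\<^sup>2)" using X by (intro mult_right_mono sum_nonneg) auto
      finally show ?thesis by simp
    qed
    \<comment> \<open>The vectors reindexed by words and extended by 0, so that the concatenations
      longer than N may remain in the sums.\<close>
    define v' where "v' \<beta> = (if length \<beta> \<le> N then v (the_inv_into {..<m} f \<beta>) else 0)" for \<beta>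
    have v': "v' (f j) = v j" if "j < m" for j
      using that truncation_length[OF that] the_inv_into_f_f[OF bij_betw_imp_inj_on[OF bij]] by (simp add: v'_def)
    have collapse: "(\<Sum>j<m. if f j = \<beta> then g (v j) else 0) = (if length \<beta> \<le> N then g (v' \<beta>) else 0)"
      for \<beta> and g :: "'k \<Rightarrow> complex"
    proof -
      have "(\<Sum>j<m. if f j = \<beta> then g (v j) else 0) = (\<Sum>j<m. if f j = \<beta> then g (v' (f j)) else 0)"
        by (intro sum.cong) (auto simp: v')
      also have "\<dots> = (\<Sum>\<alpha> | length \<alpha> \<le> N. if \<alpha> = \<beta> then g (v' \<alpha>) else 0)"
        by (rule sum.reindex_bij_betw[OF bij])
      finally show ?thesis by simp
    qed
    have g: "(\<Sum>j<m. if f j = \<beta> @ \<alpha> then c * cinner (word_op X \<alpha> (v j)) y else 0)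
        = c * cinner (word_op X \<alpha> (v' (\<beta> @ \<alpha>))) y" for \<alpha> \<beta> c y
      by (subst collapse) (simp add: v'_def)
    have "opmat_form (nc_eval m (truncation_poly f m) X) v v = (\<Sum>i<m. \<Sum>\<alpha> | length \<alpha> \<le> N. \<Sum>j<m.
        if f j = f i @ \<alpha> then (if \<alpha> = [] then 1 else 2) * cinner (word_op X \<alpha> (v j)) (v i) else 0)"
      unfolding truncation_form by (intro sum.cong refl sum.swap)
    also have "\<dots> = (\<Sum>i<m. \<Sum>\<alpha> | length \<alpha> \<le> N. (if \<alpha> = [] then 1 else 2) * cinner (word_op X \<alpha> (v' (f i @ \<alpha>))) (v' (f i)))"
      unfolding g by (intro sum.cong) (simp_all add: v')
    also have "\<dots> = (\<Sum>\<beta> | length \<beta> \<le> N. \<Sum>\<alpha> | length \<alpha> \<le> N. (if \<alpha> = [] then 1 else 2) * cinner (word_op X \<alpha> (v' (\<beta> @ \<alpha>))) (v' \<beta>))"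
      by (rule sum.reindex_bij_betw[OF bij])
    finally show "0 \<le> Re (opmat_form (nc_eval m (truncation_poly f m) X) v v)"
      using truncated_kernel_nonneg[OF row, of N v'] by (simp add: v'_def)
  qed
  ultimately show ?thesis by (simp add: positive_polynomials_def truncation_poly_nc)
qed

text \<open>Exact, not approximate: entries of the kernel between words of length at most N involve
  only words of length at most N.\<close>

lemma truncation_form_Re:
  assumes A: "decaying A"
  shows "opmat_form (opmat_Re (nc_eval m (truncation_poly f m) A)) v w
    = (\<Sum>i<m. \<Sum>j<m. cinner (poisson_kernel A (ell2_single (f j) (v j))) (ell2_single (f i) (w i)))"
proof -
  define \<psi> where "\<psi> a b h k = (if \<exists>\<gamma>. a = b @ \<gamma> then (if a = b then 1 else 2) * cinner (word_op A (drop (length b) a) h) k else 0)"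
    for a b h k
  have form: "opmat_form (nc_eval m (truncation_poly f m) A) v w = (\<Sum>i<m. \<Sum>j<m. \<psi> (f j) (f i) (v j) (w i))" for v w
  proof -
    have "(\<Sum>\<alpha> | length \<alpha> \<le> N. if f j = f i @ \<alpha> then (if \<alpha> = [] then 1 else 2) * cinner (word_op A \<alpha> (v j)) (w i) else 0)
        = \<psi> (f j) (f i) (v j) (w i)" if "j < m" for i j
    proof (cases "\<exists>\<gamma>. f j = f i @ \<gamma>")
      case True
      then obtain \<gamma> where \<gamma>: "f j = f i @ \<gamma>" by blast
      then have "length \<gamma> \<le> N" using truncation_length[OF that] by simp
      then show ?thesis using \<gamma> by (simp add: \<psi>_def)
    qed (simp add: \<psi>_def)
    then show ?thesis
      unfolding truncation_form by (intro sum.cong refl) auto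
  qed
  have "cnj (opmat_form (nc_eval m (truncation_poly f m) A) w v) = (\<Sum>j<m. \<Sum>i<m. cnj (\<psi> (f i) (f j) (w i) (v j)))"
    unfolding form by simp
  also have "\<dots> = (\<Sum>i<m. \<Sum>j<m. cnj (\<psi> (f i) (f j) (w i) (v j)))" by (rule sum.swap)
  finally have adj: "cnj (opmat_form (nc_eval m (truncation_poly f m) A) w v) = \<dots>" .
  have coef: "(\<psi> a b h k + cnj (\<psi> b a k h)) / 2 = cinner (poisson_kernel A (ell2_single a h)) (ell2_single b k)" for a b h k
    unfolding poisson_coefficient[OF A] \<psi>_def by (auto simp: cinner_commute[symmetric])
  show ?thesis
    unfolding opmat_form_Re[OF nc_eval_carrier] adj unfolding form
    by (simp add: coef[symmetric] sum.distrib[symmetric] sum_divide_distrib)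
qed

end

text \<open>Any two vectors supported in \<open>F\<close> live on the words of length at most some
  N, where the form of the difference is that of an operator matrix bounded by c.\<close>

lemma norm_poisson_diff_le:
  fixes A B :: "'n::finite \<Rightarrow> 'h::chilbert_space bop"
  assumes inf: "infinite_dimensional TYPE('k::chilbert_space)"
    and A: "decaying A" and B: "decaying B" and c: "0 \<le> c"
    and le: "\<And>m p. 1 \<le> m \<Longrightarrow> p \<in> positive_polynomials TYPE('k) m \<Longrightarrow>
      opmat_norm (opmat_Re (nc_eval m p A) - opmat_Re (nc_eval m p B)) \<le> c"
  shows "norm (poisson_kernel A - poisson_kernel B) \<le> c"
proof (rule norm_bop_ell2_le[OF c])
  fix F :: "'n list set" and g h :: "('n list, 'h) ell2" assume F: "finite F"
  define T where "T = poisson_kernel A - poisson_kernel B"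
  obtain N where N: "\<And>\<alpha>. \<alpha> \<in> F \<Longrightarrow> length \<alpha> \<le> N"
    using finite_nat_set_iff_bounded_le[of "length ` F"] F by auto
  define m where "m = card {\<alpha> :: 'n list. length \<alpha> \<le> N}"
  obtain f :: "nat \<Rightarrow> 'n list" where f: "bij_betw f {..<m} {\<alpha>. length \<alpha> \<le> N}"
    using ex_bij_betw_nat_finite[OF finite_words_le[where 'n = 'n, of N]] by (auto simp: m_def atLeast0LessThan)
  have "[] \<in> {\<alpha> :: 'n list. length \<alpha> \<le> N}" by simp
  then have m: "1 \<le> m" unfolding m_def using card_gt_0_iff[of "{\<alpha> :: 'n list. length \<alpha> \<le> N}"] by fastforce
  define P where "P = opmat_Re (nc_eval m (truncation_poly f m) A) - opmat_Re (nc_eval m (truncation_poly f m) B)"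
  have P: "P \<in> carrier_mat m m"
    unfolding P_def by (intro opmat_diff_carrier opmat_Re_carrier nc_eval_carrier)
  have Pc: "opmat_norm P \<le> c"
    unfolding P_def by (rule le[OF m truncation_poly_positive[OF f inf]])
  define x where "x g j = ell2_nth (ell2_restrict F g) (f j)" for g :: "('n list, 'h) ell2" and j
  have expand: "ell2_restrict F g = (\<Sum>j<m. ell2_single (f j) (x g j))" for g :: "('n list, 'h) ell2"
  proof -
    have "ell2_restrict F g = ell2_restrict {\<alpha>. length \<alpha> \<le> N} (ell2_restrict F g)"
      using F N by (intro ell2_eqI) (auto simp: ell2_nth_restrict)
    also have "\<dots> = (\<Sum>j<m. ell2_single (f j) (x g j))"
      unfolding ell2_restrict_def[of "{\<alpha>. length \<alpha> \<le> N}"] x_def by (rule sum.reindex_bij_betw[OF f, symmetric])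
    finally show ?thesis .
  qed
  have norm: "norm (ell2_restrict F g) = tuple_norm m (x g)" for g :: "('n list, 'h) ell2"
  proof -
    have "(norm (ell2_restrict F g))\<^sup>2 = (norm (ell2_restrict {\<alpha>. length \<alpha> \<le> N} (ell2_restrict F g)))\<^sup>2"
      using F N by (intro arg_cong[where f = "\<lambda>x. (norm x)\<^sup>2"] ell2_eqI) (auto simp: ell2_nth_restrict)
    also have "\<dots> = (\<Sum>j<m. (norm (x g j))\<^sup>2)"
      unfolding norm_restrict[OF finite_words_le] x_def by (rule sum.reindex_bij_betw[OF f, symmetric])
    finally show ?thesis by (simp add: L2_set_def real_sqrt_unique)
  qed
  have "cinner (T (ell2_restrict F g)) (ell2_restrict F h)
      = (\<Sum>j<m. \<Sum>i<m. cinner (T (ell2_single (f j) (x g j))) (ell2_single (f i) (x h i)))"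
    unfolding expand[of g] expand[of h] bop_sum_right cinner_sum_left cinner_sum_right by (rule sum.swap)
  also have "\<dots> = (\<Sum>i<m. \<Sum>j<m. cinner (T (ell2_single (f j) (x g j))) (ell2_single (f i) (x h i)))"
    by (rule sum.swap)
  also have "\<dots> = opmat_form P (x g) (x h)"
    unfolding P_def opmat_form_diff[OF opmat_Re_carrier[OF nc_eval_carrier] opmat_Re_carrier[OF nc_eval_carrier]]
      truncation_form_Re[OF f A] truncation_form_Re[OF f B]
    by (simp add: T_def cinner_diff_left sum_subtractf)
  finally have "cmod (cinner (T (ell2_restrict F g)) (ell2_restrict F h)) \<le> opmat_norm P * tuple_norm m (x g) * tuple_norm m (x h)"
    using cmod_opmat_form_le[OF P] by simp
  also have "\<dots> \<le> c * tuple_norm m (x g) * tuple_norm m (x h)"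
    by (intro mult_right_mono Pc L2_set_nonneg)
  finally show "cmod (cinner (T (ell2_restrict F g)) (ell2_restrict F h)) \<le> c * norm (ell2_restrict F g) * norm (ell2_restrict F h)"
    by (simp add: norm)
qed

section \<open>Dilations of the arguments\<close>

text \<open>The coefficients of X -> p(r X): dilating the arguments becomes a change of
  polynomial.\<close>

definition dilate_poly :: "real \<Rightarrow> ('n list \<Rightarrow> complex mat) \<Rightarrow> 'n list \<Rightarrow> complex mat" where
  "dilate_poly r p \<alpha> = of_real (r ^ length \<alpha>) \<cdot>\<^sub>m p \<alpha>"

lemma dilate_poly_support:
  assumes "p \<in> nc_polynomials m"
  shows "{\<alpha>. dilate_poly r p \<alpha> \<noteq> 0\<^sub>m m m} \<subseteq> {\<alpha>. p \<alpha> \<noteq> 0\<^sub>m m m}"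
  by (auto simp: dilate_poly_def)

lemma dilate_poly_nc:
  assumes "p \<in> nc_polynomials m"
  shows "dilate_poly r p \<in> nc_polynomials m"
  using assms finite_subset[OF dilate_poly_support[OF assms]]
  by (auto simp: nc_polynomials_def dilate_poly_def)

lemma scaleC_of_real_mult: "(of_real r * c) *\<^sub>C x = r *\<^sub>R c *\<^sub>C x"
  by (metis scaleC_of_real scaleC_scaleC)

lemma nc_eval_dilate_poly:
  assumes p: "p \<in> nc_polynomials m"
  shows "nc_eval m (dilate_poly r p) A = nc_eval m p (\<lambda>i. r *\<^sub>R A i)"
proof -
  have carr: "p \<alpha> \<in> carrier_mat m m" for \<alpha> using p by (simp add: nc_polynomials_def)
  have "(\<Sum>\<alpha> | dilate_poly r p \<alpha> \<noteq> 0\<^sub>m m m. dilate_poly r p \<alpha> $$ (i, j) *\<^sub>C word_op A \<alpha>)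
      = (\<Sum>\<alpha> | p \<alpha> \<noteq> 0\<^sub>m m m. p \<alpha> $$ (i, j) *\<^sub>C word_op (\<lambda>i. r *\<^sub>R A i) \<alpha>)" if ij: "i < m" "j < m" for i j
  proof -
    have "(\<Sum>\<alpha> | dilate_poly r p \<alpha> \<noteq> 0\<^sub>m m m. dilate_poly r p \<alpha> $$ (i, j) *\<^sub>C word_op A \<alpha>)
        = (\<Sum>\<alpha> | p \<alpha> \<noteq> 0\<^sub>m m m. dilate_poly r p \<alpha> $$ (i, j) *\<^sub>C word_op A \<alpha>)"
      using p ij by (intro sum.mono_neutral_left dilate_poly_support) (auto simp: nc_polynomials_def)
    also have "\<dots> = (\<Sum>\<alpha> | p \<alpha> \<noteq> 0\<^sub>m m m. p \<alpha> $$ (i, j) *\<^sub>C word_op (\<lambda>i. r *\<^sub>R A i) \<alpha>)"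
      using carrier_matD[OF carr] ij
      by (intro sum.cong refl)
        (simp add: dilate_poly_def word_op_scaleR scaleC_scaleR_commute scaleC_of_real_mult del: of_real_power)
    finally show ?thesis .
  qed
  then show ?thesis unfolding nc_eval_def by (intro cong_mat) auto
qed

lemma dilate_poly_positive:
  assumes p: "p \<in> positive_polynomials TYPE('k::chilbert_space) m" and r: "0 \<le> r" "r \<le> 1"
  shows "dilate_poly r p \<in> positive_polynomials TYPE('k) m"
proof -
  have nc: "p \<in> nc_polynomials m" using p by (simp add: positive_polynomials_def)
  have "norm (\<Sum>i\<in>UNIV. (r *\<^sub>R X i) * adj (r *\<^sub>R X i)) < 1"
    if X: "norm (\<Sum>i\<in>UNIV. X i * adj (X i)) < 1" for X :: "'a \<Rightarrow> 'k bop"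
  proof -
    have "(\<Sum>i\<in>UNIV. (r *\<^sub>R X i) * adj (r *\<^sub>R X i)) = (r * r) *\<^sub>R (\<Sum>i\<in>UNIV. X i * adj (X i))"
      by (simp add: adj_scaleR scaleR_right.sum)
    then have "norm (\<Sum>i\<in>UNIV. (r *\<^sub>R X i) * adj (r *\<^sub>R X i)) = (r * r) * norm (\<Sum>i\<in>UNIV. X i * adj (X i))"
      using r by simp
    also have "\<dots> \<le> 1 * norm (\<Sum>i\<in>UNIV. X i * adj (X i))"
      using r by (intro mult_right_mono mult_le_one) auto
    finally show ?thesis using X by simp
  qed
  then show ?thesis
    using p by (simp add: positive_polynomials_def nc_eval_dilate_poly[OF nc] dilate_poly_nc[OF nc])
qed

lemma dK_upper:
  "1 \<le> m \<Longrightarrow> p \<in> positive_polynomials K m \<Longrightarrow>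
    ennreal (opmat_norm (opmat_Re (nc_eval m p A) - opmat_Re (nc_eval m p B))) \<le> dK K A B"
  unfolding dK_def by (rule SUP_upper2[of m], simp, rule SUP_upper2[of p], simp_all)

lemma dK_least:
  "(\<And>m p. 1 \<le> m \<Longrightarrow> p \<in> positive_polynomials K m \<Longrightarrow>
    ennreal (opmat_norm (opmat_Re (nc_eval m p A) - opmat_Re (nc_eval m p B))) \<le> c) \<Longrightarrow> dK K A B \<le> c"
  unfolding dK_def by (intro SUP_least) auto

lemma dK_dilate_le:
  fixes A B :: "'n::finite \<Rightarrow> 'h::chilbert_space bop"
  assumes "0 \<le> r" "r \<le> 1"
  shows "dK TYPE('k::chilbert_space) (\<lambda>i. r *\<^sub>R A i) (\<lambda>i. r *\<^sub>R B i) \<le> dK TYPE('k) A B"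
proof (rule dK_least)
  fix m and p :: "'n list \<Rightarrow> complex mat" assume m: "1 \<le> m" and p: "p \<in> positive_polynomials TYPE('k) m"
  then have nc: "p \<in> nc_polynomials m" by (simp add: positive_polynomials_def)
  show "ennreal (opmat_norm (opmat_Re (nc_eval m p (\<lambda>i. r *\<^sub>R A i)) - opmat_Re (nc_eval m p (\<lambda>i. r *\<^sub>R B i))))
      \<le> dK TYPE('k) A B"
    using dK_upper[OF m dilate_poly_positive[OF p assms], of A B] by (simp add: nc_eval_dilate_poly[OF nc])
qed

lemma mono_on_dK_dilate:
  "mono_on {0..<1} (\<lambda>r. dK TYPE('k::chilbert_space) (\<lambda>i. r *\<^sub>R A i) (\<lambda>i. r *\<^sub>R B i))"
proof (rule mono_onI)
  fix r s :: real assume rs: "r \<in> {0..<1}" "s \<in> {0..<1}" "r \<le> s"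
  \<comment> \<open>If s = 0 then r = 0, and the factorisation holds by the convention on
    division.\<close>
  have r: "r = (r / s) * s" using rs by (cases "s = 0") auto
  have "dK TYPE('k) (\<lambda>i. (r / s) *\<^sub>R s *\<^sub>R A i) (\<lambda>i. (r / s) *\<^sub>R s *\<^sub>R B i) \<le> dK TYPE('k) (\<lambda>i. s *\<^sub>R A i) (\<lambda>i. s *\<^sub>R B i)"
    by (rule dK_dilate_le) (use rs in \<open>auto simp: divide_le_eq_1\<close>)
  then show "dK TYPE('k) (\<lambda>i. r *\<^sub>R A i) (\<lambda>i. r *\<^sub>R B i) \<le> dK TYPE('k) (\<lambda>i. s *\<^sub>R A i) (\<lambda>i. s *\<^sub>R B i)"
    unfolding scaleR_scaleR r[symmetric] .
qed

lemma opmat_form_dilate: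
  "opmat_form (nc_eval m p (\<lambda>i. r *\<^sub>R A i)) v w =
    (\<Sum>i<m. \<Sum>j<m. \<Sum>\<alpha> | p \<alpha> \<noteq> 0\<^sub>m m m. p \<alpha> $$ (i, j) * (of_real (r ^ length \<alpha>) * cinner (word_op A \<alpha> (v j)) (w i)))"
  by (simp add: opmat_form_nc_eval word_op_scaleR cinner_scaleR)

text \<open>For a fixed polynomial the forms are polynomial in r, so a bound for all r < 1 passes to
  r = 1; the supremum over polynomials is taken only afterwards.\<close>

lemma dK_eq_SUP_dilate:
  fixes A B :: "'n::finite \<Rightarrow> 'h::chilbert_space bop"
  shows "dK TYPE('k::chilbert_space) A B = (SUP r\<in>{0..<1}. dK TYPE('k) (\<lambda>i. r *\<^sub>R A i) (\<lambda>i. r *\<^sub>R B i))"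
    (is "_ = ?S")
proof (rule antisym)
  show "?S \<le> dK TYPE('k) A B" by (rule SUP_least) (simp add: dK_dilate_le)
  show "dK TYPE('k) A B \<le> ?S"
  proof (cases ?S)
    case (real s)
    show ?thesis
      unfolding real(2)
    proof (rule dK_least, rule ennreal_leI)
      fix m and p :: "'n list \<Rightarrow> complex mat" assume m: "1 \<le> m" and p: "p \<in> positive_polynomials TYPE('k) m"
      define D where "D r = opmat_Re (nc_eval m p (\<lambda>i. r *\<^sub>R A i)) - opmat_Re (nc_eval m p (\<lambda>i. r *\<^sub>R B i))" for r
      have D: "D r \<in> carrier_mat m m" for r
        unfolding D_def by (intro opmat_diff_carrier opmat_Re_carrier nc_eval_carrier)
      have Ds: "opmat_norm (D r) \<le> s" if "0 \<le> r" "r < 1" for r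
      proof -
        have "ennreal (opmat_norm (D r)) \<le> dK TYPE('k) (\<lambda>i. r *\<^sub>R A i) (\<lambda>i. r *\<^sub>R B i)"
          unfolding D_def by (rule dK_upper[OF m p])
        also have "\<dots> \<le> ?S" by (rule SUP_upper) (use that in simp)
        also have "\<dots> = ennreal s" by (rule real(2))
        finally show ?thesis using real(1) by simp
      qed
      have "opmat_norm (D 1) \<le> s"
      proof (rule opmat_norm_le[OF D real(1)])
        fix v w :: "nat \<Rightarrow> 'h"
        have form: "Re (opmat_form (D r) v w) = Re (
            (opmat_form (nc_eval m p (\<lambda>i. r *\<^sub>R A i)) v w + cnj (opmat_form (nc_eval m p (\<lambda>i. r *\<^sub>R A i)) w v)) / 2
            - (opmat_form (nc_eval m p (\<lambda>i. r *\<^sub>R B i)) v w + cnj (opmat_form (nc_eval m p (\<lambda>i. r *\<^sub>R B i)) w v)) / 2)" for r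
          unfolding D_def opmat_form_diff[OF opmat_Re_carrier[OF nc_eval_carrier] opmat_Re_carrier[OF nc_eval_carrier]]
            opmat_form_Re[OF nc_eval_carrier] ..
        have "((\<lambda>r. Re (opmat_form (D r) v w)) \<longlongrightarrow> Re (opmat_form (D 1) v w)) (at_left 1)"
          unfolding form opmat_form_dilate by (intro tendsto_intros) simp_all
        moreover have "\<forall>\<^sub>F r in at_left 1. Re (opmat_form (D r) v w) \<le> s * tuple_norm m v * tuple_norm m w"
        proof (rule eventually_at_leftI[of 0])
          fix r :: real assume r: "r \<in> {0<..<1}"
          have "Re (opmat_form (D r) v w) \<le> opmat_norm (D r) * tuple_norm m v * tuple_norm m w"
            using cmod_opmat_form_le[OF D, of r v w] complex_Re_le_cmod order_trans by blast
          also have "\<dots> \<le> s * tuple_norm m v * tuple_norm m w"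
            using r by (intro mult_right_mono Ds L2_set_nonneg) auto
          finally show "Re (opmat_form (D r) v w) \<le> s * tuple_norm m v * tuple_norm m w" .
        qed simp
        ultimately show "Re (opmat_form (D 1) v w) \<le> s * tuple_norm m v * tuple_norm m w"
          by (rule tendsto_upperbound) simp
      qed
      then show "opmat_norm (opmat_Re (nc_eval m p A) - opmat_Re (nc_eval m p B)) \<le> s"
        by (simp add: D_def)
    qed
  next
    case top
    show ?thesis unfolding top by simp
  qed
qed

section \<open>The metric\<close>

lemma dK_eq_norm_poisson:
  assumes inf: "infinite_dimensional TYPE('k::chilbert_space)"
    and A: "decaying A" and B: "decaying B"
  shows "dK TYPE('k) A B = ennreal (norm (poisson_kernel A - poisson_kernel B))"
proof (rule antisym)
  show le: "dK TYPE('k) A B \<le> ennreal (norm (poisson_kernel A - poisson_kernel B))"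
    by (intro dK_least ennreal_leI positive_polynomial_norm_le[OF inf _ A B])
  \<comment> \<open>The upper bound makes \<open>dK\<close> finite, so that it can serve as the real
    constant in the converse estimate.\<close>
  then have fin: "dK TYPE('k) A B = ennreal (enn2real (dK TYPE('k) A B))"
    by (metis ennreal_enn2real ennreal_less_top order.strict_trans1)
  have "norm (poisson_kernel A - poisson_kernel B) \<le> enn2real (dK TYPE('k) A B)"
  proof (rule norm_poisson_diff_le[OF inf A B enn2real_nonneg])
    fix m and p :: "'a list \<Rightarrow> complex mat" assume "1 \<le> m" "p \<in> positive_polynomials TYPE('k) m"
    then have "ennreal (opmat_norm (opmat_Re (nc_eval m p A) - opmat_Re (nc_eval m p B))) \<le> ennreal (enn2real (dK TYPE('k) A B))"
      unfolding fin[symmetric] by (rule dK_upper)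
    then show "opmat_norm (opmat_Re (nc_eval m p A) - opmat_Re (nc_eval m p B)) \<le> enn2real (dK TYPE('k) A B)"
      by simp
  qed
  then show "ennreal (norm (poisson_kernel A - poisson_kernel B)) \<le> dK TYPE('k) A B"
    using fin ennreal_leI by metis
qed

text \<open>The entries from one-letter words to the empty word are the operators of the tuple
  themselves.\<close>

lemma poisson_kernel_inject:
  assumes A: "decaying A" and B: "decaying B" and eq: "poisson_kernel A = poisson_kernel B"
  shows "A = B"
proof (rule ext, rule bop_eqI, rule cinner_eqI)
  fix i h z
  have "cinner (word_op A [i] h) z = cinner (word_op B [i] h) z"
    unfolding poisson_coefficient_Nil[OF A, symmetric] poisson_coefficient_Nil[OF B, symmetric] eq ..
  then have "cnj (cinner (A i h) z) = cnj (cinner (B i h) z)" by simp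
  then show "cinner z (A i h) = cinner z (B i h)" unfolding cinner_commute[symmetric] .
qed

lemma opmat_norm_diff_commute:
  assumes P: "P \<in> carrier_mat m m" and Q: "Q \<in> carrier_mat m m"
  shows "opmat_norm (P - Q) = opmat_norm (Q - P)"
proof -
  have apply_diff: "opmat_apply (P - Q) v i = opmat_apply P v i - opmat_apply Q v i"
    if "P \<in> carrier_mat m m" "Q \<in> carrier_mat m m" "i < m" for P Q :: "'a bop mat" and v i
  proof -
    have "(P - Q) $$ (i, j) = P $$ (i, j) - Q $$ (i, j)" if "j < m" for j
      using carrier_matD[OF \<open>Q \<in> carrier_mat m m\<close>] \<open>i < m\<close> that by (simp only: index_minus_mat)
    then show ?thesis
      unfolding opmat_apply_def carrier_matD[OF opmat_diff_carrier[OF that(2)]] carrier_matD[OF that(1)] carrier_matD[OF that(2)]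
      by (simp add: sum_subtractf)
  qed
  have "tuple_norm m (opmat_apply (P - Q) v) = tuple_norm m (opmat_apply (Q - P) v)" for v
    by (rule L2_set_cong) (simp_all add: apply_diff[OF P Q] apply_diff[OF Q P] norm_minus_commute)
  then show ?thesis
    unfolding opmat_norm_altdef[OF opmat_diff_carrier[OF P]] opmat_norm_altdef[OF opmat_diff_carrier[OF Q]] by simp
qed

text \<open>\<open>Metric_space\<close> asks for symmetry at all pairs, also outside the carrier, so
  it is read off from the matrices and not from the norm formula.\<close>

lemma dK_commute: "dK K A B = dK K B A"
  unfolding dK_def
  by (intro SUP_cong refl arg_cong[where f = ennreal] opmat_norm_diff_commute opmat_Re_carrier)
    (rule nc_eval_carrier)+

theorem proposition5p2:
  assumes "infinite_dimensional TYPE('k::chilbert_space)"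
  shows "Metric_space (spectral_ball :: ('n::finite \<Rightarrow> 'h::chilbert_space bop) set)
      (\<lambda>A B. enn2real (dK TYPE('k) A B))
    \<and> (\<forall>A\<in>spectral_ball. \<forall>B\<in>spectral_ball.
        dK TYPE('k) A B
          = ennreal (norm (poisson_kernel (A :: 'n \<Rightarrow> 'h bop) - poisson_kernel B))
        \<and> mono_on {0..<1::real} (\<lambda>r. dK TYPE('k) (\<lambda>i. r *\<^sub>R A i) (\<lambda>i. r *\<^sub>R B i))
        \<and> dK TYPE('k) A B = (SUP r\<in>{0..<1::real}. dK TYPE('k) (\<lambda>i. r *\<^sub>R A i) (\<lambda>i. r *\<^sub>R B i)))"
proof (intro conjI ballI)
  note dK = dK_eq_norm_poisson[OF assms spectral_ball_decaying spectral_ball_decaying]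
  show "Metric_space (spectral_ball :: ('n \<Rightarrow> 'h bop) set) (\<lambda>A B. enn2real (dK TYPE('k) A B))"
  proof
    fix A B C :: "'n \<Rightarrow> 'h bop"
    show "0 \<le> enn2real (dK TYPE('k) A B)" by simp
    show "enn2real (dK TYPE('k) A B) = enn2real (dK TYPE('k) B A)" by (simp add: dK_commute)
    assume A: "A \<in> spectral_ball" and B: "B \<in> spectral_ball"
    show "enn2real (dK TYPE('k) A B) = 0 \<longleftrightarrow> A = B"
      using poisson_kernel_inject[OF spectral_ball_decaying[OF A] spectral_ball_decaying[OF B]]
      by (auto simp: dK[OF A B])
    assume C: "C \<in> spectral_ball"
    show "enn2real (dK TYPE('k) A C) \<le> enn2real (dK TYPE('k) A B) + enn2real (dK TYPE('k) B C)"
      using norm_triangle_ineq[of "poisson_kernel A - poisson_kernel B" "poisson_kernel B - poisson_kernel C"]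
      by (simp add: dK[OF A B] dK[OF A C] dK[OF B C])
  qed
  fix A B :: "'n \<Rightarrow> 'h bop" assume A: "A \<in> spectral_ball" and B: "B \<in> spectral_ball"
  show "dK TYPE('k) A B = ennreal (norm (poisson_kernel A - poisson_kernel B))" by (rule dK[OF A B])
  show "mono_on {0..<1} (\<lambda>r. dK TYPE('k) (\<lambda>i. r *\<^sub>R A i) (\<lambda>i. r *\<^sub>R B i))" by (rule mono_on_dK_dilate)
  show "dK TYPE('k) A B = (SUP r\<in>{0..<1}. dK TYPE('k) (\<lambda>i. r *\<^sub>R A i) (\<lambda>i. r *\<^sub>R B i))"
    by (rule dK_eq_SUP_dilate)
qed

end
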